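(* The system $\mathsf{Z}_2^{\omega}+\mathsf{QF\text{-}DC}^{1,1}$ cannot prove $\mathsf{NIN}_{[0,1]}$, where $\mathsf{NIN}_{[0,1]}$ is the sentence: for any $Y:[0,1]\to\mathbb{N}$, there are $x,y\in[0,1]$ such that $x\neq_{\mathbb{R}}y$ and $Y(x)=_{\mathbb{N}}Y(y)$.
   Context: The metatheory is $\mathsf{ZFC}$. Finite types: $0$ is the type of natural numbers; if $\sigma,\tau$ are types then so is $\sigma\to\tau$; $1=0\to0$ (elements of $\mathbb{N}^{\mathbb{N}}$), $2=1\to 0$, $n+1=n\to0$. The only primitive predicate of the language is equality $=_0$ at type $0$; equality at higher types is defined extensionally (pointwise). $\mathsf{RCA}_0^{\omega}$ is Kohlenbach's base theory of higher-order Reverse Mathematics, i.e. E-PRA$^{\omega}$ + $\mathsf{QF\text{-}AC}^{1,0}$: classical many-sorted logic in the language of finite types with the usual axioms for $0$ and successor, the combinators $\Pi,\Sigma$ for all types, the primitive recursor $\mathbf{R}_0$ (recursion with values of type $0$), quantifier-free induction, the axiom of extensionality at all finite types, and $\mathsf{QF\text{-}AC}^{1,0}$: for quantifier-free $\varphi$, $(\forall f^{1})(\exists n^{0})\varphi(f,n)\to(\exists\Phi^{1\to0})(\forall f^{1})\varphi(f,\Phi(f))$. For $k\geq 1$, $(\mathsf{S}_k^2)$ is the axiom stating that there is a functional $\mathsf{S}_k^2:\mathbb{N}^{\mathbb{N}}\to\{0,1\}$ deciding $\Sigma^1_k$-formulas in normal form, i.e. for all $f\in\mathbb{N}^{\mathbb{N}}$,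 $\mathsf{S}^2_k(f)=0\leftrightarrow(\exists g_1)(\forall g_2)\cdots(Qg_k)(Q'n)\,\big(f(\langle\overline{g_1}n,\dots,\overline{g_k}n\rangle)=0\big)$, with $g_i$ ranging over $\mathbb{N}^{\mathbb{N}}$, $n$ over $\mathbb{N}$, alternating quantifiers, $\overline{g}n$ the code of the finite sequence $(g(0),\dots,g(n-1))$; for $k=1$: $\mathsf{S}_1^2(f)=0\leftrightarrow(\exists g)(\forall n)(f(\overline{g}n)=0)$. $\Pi^1_k\text{-}\mathsf{CA}_0^{\omega}$ is $\mathsf{RCA}_0^{\omega}+(\mathsf{S}_k^2)$, and $\mathsf{Z}_2^{\omega}=\bigcup_k\Pi^1_k\text{-}\mathsf{CA}_0^{\omega}$. $\mathsf{QF\text{-}DC}^{1,1}$ is the following schema: let $\varphi$ be quantifier-free (parameters of any finite type allowed) and such that $(\forall n\in\mathbb{N})(\forall f\in\mathbb{N}^{\mathbb{N}})(\exists g\in\mathbb{N}^{\mathbb{N}})\varphi(n,f,g)$; then there is a sequence $(f_n)_{n\in\mathbb{N}}$ in $\mathbb{N}^{\mathbb{N}}$ such that $(\forall n\in\mathbb{N})\varphi(n,f_n,f_{n+1})$. Real numbers are represented by fast-converging Cauchy sequences of rationals, $=_{\mathbb{R}}$ is the usual equality of representations, and functions on (subsets of) $\mathbb{R}$ are functionals on representations that respect $=_{\mathbb{R}}$. *)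

theory Defs
  imports Main
begin

section \<open>The language of all finite types\<close>

datatype ty = T0 | Fn ty ty  (infixr "\<rightarrow>\<^sub>t" 60)

abbreviation T1 :: ty where "T1 \<equiv> T0 \<rightarrow>\<^sub>t T0"
abbreviation T2 :: ty where "T2 \<equiv> T1 \<rightarrow>\<^sub>t T0"

text \<open>A variable is an index together with its type; variables of different types are
  different variables, even if they have the same index.\<close>

type_synonym var = "nat \<times> ty"

text \<open>\<open>CPi \<rho> \<tau>\<close> and \<open>CSig \<delta> \<rho> \<tau>\<close> are the combinators \<open>\<Pi>\<close> (also known as K) and \<open>\<Sigma>\<close> (also
  known as S), \<open>CRec\<close> is the recursor with values of type \<open>0\<close>.\<close>

datatype trm =
    Var var
  | CZero
  | CSuc
  | CPi ty ty
  | CSig ty ty ty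
  | CRec
  | App trm trm  (infixl "\<cdot>" 90)

text \<open>The value of \<open>tyof\<close> is only meaningful on terms satisfying \<open>wft\<close>.\<close>

fun tyof :: "trm \<Rightarrow> ty" where
  "tyof (Var x) = snd x"
| "tyof CZero = T0"
| "tyof CSuc = T0 \<rightarrow>\<^sub>t T0"
| "tyof (CPi \<rho> \<tau>) = \<rho> \<rightarrow>\<^sub>t \<tau> \<rightarrow>\<^sub>t \<rho>"
| "tyof (CSig \<delta> \<rho> \<tau>) = (\<delta> \<rightarrow>\<^sub>t \<rho> \<rightarrow>\<^sub>t \<tau>) \<rightarrow>\<^sub>t (\<delta> \<rightarrow>\<^sub>t \<rho>) \<rightarrow>\<^sub>t \<delta> \<rightarrow>\<^sub>t \<tau>"
| "tyof CRec = T0 \<rightarrow>\<^sub>t T0 \<rightarrow>\<^sub>t (T0 \<rightarrow>\<^sub>t T0 \<rightarrow>\<^sub>t T0) \<rightarrow>\<^sub>t T0"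
| "tyof (s \<cdot> t) = (case tyof s of T0 \<Rightarrow> T0 | \<sigma> \<rightarrow>\<^sub>t \<tau> \<Rightarrow> \<tau>)"

fun wft :: "trm \<Rightarrow> bool" where
  "wft (s \<cdot> t) \<longleftrightarrow> wft s \<and> wft t \<and> (\<exists>\<tau>. tyof s = tyof t \<rightarrow>\<^sub>t \<tau>)"
| "wft _ \<longleftrightarrow> True"

fun vars :: "trm \<Rightarrow> var set" where
  "vars (Var x) = {x}"
| "vars (s \<cdot> t) = vars s \<union> vars t"
| "vars _ = {}"

fun substt :: "var \<Rightarrow> trm \<Rightarrow> trm \<Rightarrow> trm" where
  "substt x u (Var y) = (if y = x then u else Var y)"
| "substt x u (s \<cdot> t) = substt x u s \<cdot> substt x u t"
| "substt x u c = c"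

datatype fm =
    Eq trm trm  (infix "\<^bold>=" 58)
  | Falsum  ("\<^bold>\<bottom>")
  | Imp fm fm  (infixr "\<^bold>\<longrightarrow>" 53)
  | Forall var fm  ("\<^bold>\<forall>_. _" [100, 52] 52)

abbreviation Neg :: "fm \<Rightarrow> fm"  ("\<^bold>\<not> _" [57] 57) where
  "\<^bold>\<not> \<phi> \<equiv> \<phi> \<^bold>\<longrightarrow> \<^bold>\<bottom>"
abbreviation Disj :: "fm \<Rightarrow> fm \<Rightarrow> fm"  (infixr "\<^bold>\<or>" 55) where
  "\<phi> \<^bold>\<or> \<psi> \<equiv> \<^bold>\<not> \<phi> \<^bold>\<longrightarrow> \<psi>"
abbreviation Conj :: "fm \<Rightarrow> fm \<Rightarrow> fm"  (infixr "\<^bold>\<and>" 56) where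
  "\<phi> \<^bold>\<and> \<psi> \<equiv> \<^bold>\<not> (\<phi> \<^bold>\<longrightarrow> \<^bold>\<not> \<psi>)"
abbreviation Iff :: "fm \<Rightarrow> fm \<Rightarrow> fm"  (infix "\<^bold>\<longleftrightarrow>" 53) where
  "\<phi> \<^bold>\<longleftrightarrow> \<psi> \<equiv> (\<phi> \<^bold>\<longrightarrow> \<psi>) \<^bold>\<and> (\<psi> \<^bold>\<longrightarrow> \<phi>)"
abbreviation Exists :: "var \<Rightarrow> fm \<Rightarrow> fm"  ("\<^bold>\<exists>_. _" [100, 52] 52) where
  "\<^bold>\<exists>x. \<phi> \<equiv> \<^bold>\<not> (\<^bold>\<forall>x. \<^bold>\<not> \<phi>)"

fun wff :: "fm \<Rightarrow> bool" where
  "wff (s \<^bold>= t) \<longleftrightarrow> wft s \<and> wft t \<and> tyof s = T0 \<and> tyof t = T0"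
| "wff \<^bold>\<bottom> \<longleftrightarrow> True"
| "wff (\<phi> \<^bold>\<longrightarrow> \<psi>) \<longleftrightarrow> wff \<phi> \<and> wff \<psi>"
| "wff (\<^bold>\<forall>x. \<phi>) \<longleftrightarrow> wff \<phi>"

fun qf :: "fm \<Rightarrow> bool" where
  "qf (s \<^bold>= t) \<longleftrightarrow> True"
| "qf \<^bold>\<bottom> \<longleftrightarrow> True"
| "qf (\<phi> \<^bold>\<longrightarrow> \<psi>) \<longleftrightarrow> qf \<phi> \<and> qf \<psi>"
| "qf (\<^bold>\<forall>x. \<phi>) \<longleftrightarrow> False"

fun fvs :: "fm \<Rightarrow> var set" where
  "fvs (s \<^bold>= t) = vars s \<union> vars t"
| "fvs \<^bold>\<bottom> = {}"
| "fvs (\<phi> \<^bold>\<longrightarrow> \<psi>) = fvs \<phi> \<union> fvs \<psi>"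
| "fvs (\<^bold>\<forall>x. \<phi>) = fvs \<phi> - {x}"

text \<open>\<open>subst x u \<phi>\<close> does not rename bound variables; it is used for
  quantifier-free \<open>\<phi>\<close>, or under the proviso \<open>free_for u x \<phi>\<close>.\<close>

fun subst :: "var \<Rightarrow> trm \<Rightarrow> fm \<Rightarrow> fm" where
  "subst x u (s \<^bold>= t) = (substt x u s \<^bold>= substt x u t)"
| "subst x u \<^bold>\<bottom> = \<^bold>\<bottom>"
| "subst x u (\<phi> \<^bold>\<longrightarrow> \<psi>) = (subst x u \<phi> \<^bold>\<longrightarrow> subst x u \<psi>)"
| "subst x u (\<^bold>\<forall>y. \<phi>) = (if y = x then \<^bold>\<forall>y. \<phi> else \<^bold>\<forall>y. subst x u \<phi>)"

fun free_for :: "trm \<Rightarrow> var \<Rightarrow> fm \<Rightarrow> bool" where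
  "free_for u x (s \<^bold>= t) \<longleftrightarrow> True"
| "free_for u x \<^bold>\<bottom> \<longleftrightarrow> True"
| "free_for u x (\<phi> \<^bold>\<longrightarrow> \<psi>) \<longleftrightarrow> free_for u x \<phi> \<and> free_for u x \<psi>"
| "free_for u x (\<^bold>\<forall>y. \<phi>) \<longleftrightarrow> x \<notin> fvs (\<^bold>\<forall>y. \<phi>) \<or> (y \<notin> vars u \<and> free_for u x \<phi>)"


section \<open>Classical many-sorted logic\<close>

text \<open>A Hilbert calculus for classical many-sorted first-order logic. Generalisation is
  unrestricted, so an axiom with free variables has the force of its universal closure.
  The equality axioms belong to the theories below.\<close>

inductive proves :: "fm set \<Rightarrow> fm \<Rightarrow> bool"  (infix "\<turnstile>" 40) for T :: "fm set" where
  Axiom: "\<phi> \<in> T \<Longrightarrow> T \<turnstile> \<phi>"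
| PropK: "wff \<phi> \<Longrightarrow> wff \<psi> \<Longrightarrow> T \<turnstile> \<phi> \<^bold>\<longrightarrow> \<psi> \<^bold>\<longrightarrow> \<phi>"
| PropS: "wff \<phi> \<Longrightarrow> wff \<psi> \<Longrightarrow> wff \<chi> \<Longrightarrow>
    T \<turnstile> (\<phi> \<^bold>\<longrightarrow> \<psi> \<^bold>\<longrightarrow> \<chi>) \<^bold>\<longrightarrow> (\<phi> \<^bold>\<longrightarrow> \<psi>) \<^bold>\<longrightarrow> \<phi> \<^bold>\<longrightarrow> \<chi>"
| DNeg: "wff \<phi> \<Longrightarrow> T \<turnstile> \<^bold>\<not> \<^bold>\<not> \<phi> \<^bold>\<longrightarrow> \<phi>"
| Inst: "wff \<phi> \<Longrightarrow> wft t \<Longrightarrow> tyof t = snd x \<Longrightarrow> free_for t x \<phi> \<Longrightarrow>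
    T \<turnstile> (\<^bold>\<forall>x. \<phi>) \<^bold>\<longrightarrow> subst x t \<phi>"
| Distr: "wff \<phi> \<Longrightarrow> wff \<psi> \<Longrightarrow> x \<notin> fvs \<phi> \<Longrightarrow>
    T \<turnstile> (\<^bold>\<forall>x. \<phi> \<^bold>\<longrightarrow> \<psi>) \<^bold>\<longrightarrow> \<phi> \<^bold>\<longrightarrow> (\<^bold>\<forall>x. \<psi>)"
| MP: "T \<turnstile> \<phi> \<^bold>\<longrightarrow> \<psi> \<Longrightarrow> T \<turnstile> \<phi> \<Longrightarrow> T \<turnstile> \<psi>"
| Gen: "T \<turnstile> \<phi> \<Longrightarrow> T \<turnstile> \<^bold>\<forall>x. \<phi>"


section \<open>The base theory\<close>

text \<open>Every variable occurring in \<open>t\<close> has an index below \<open>fresh t\<close>.\<close>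

fun fresh :: "trm \<Rightarrow> nat" where
  "fresh (Var x) = Suc (fst x)"
| "fresh (s \<cdot> t) = max (fresh s) (fresh t)"
| "fresh _ = 0"

text \<open>Extensional equality \<open>=\<^sub>\<rho>\<close>: \<open>\<forall>z\<^sub>1 \<dots> z\<^sub>k. s z\<^sub>1 \<dots> z\<^sub>k =\<^sub>0 t z\<^sub>1 \<dots> z\<^sub>k\<close>.\<close>

fun heq :: "ty \<Rightarrow> trm \<Rightarrow> trm \<Rightarrow> fm" where
  "heq T0 s t = (s \<^bold>= t)"
| "heq (\<sigma> \<rightarrow>\<^sub>t \<tau>) s t =
     (let z = (max (fresh s) (fresh t), \<sigma>) in \<^bold>\<forall>z. heq \<tau> (s \<cdot> Var z) (t \<cdot> Var z))"

abbreviation \<v> :: "nat \<Rightarrow> ty \<Rightarrow> trm" where "\<v> i \<rho> \<equiv> Var (i, \<rho>)"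

inductive_set RCA0\<omega> :: "fm set" where
  eq_refl: "\<v> 0 T0 \<^bold>= \<v> 0 T0 \<in> RCA0\<omega>"
| eq_sym: "\<v> 0 T0 \<^bold>= \<v> 1 T0 \<^bold>\<longrightarrow> \<v> 1 T0 \<^bold>= \<v> 0 T0 \<in> RCA0\<omega>"
| eq_trans: "\<v> 0 T0 \<^bold>= \<v> 1 T0 \<^bold>\<longrightarrow> \<v> 1 T0 \<^bold>= \<v> 2 T0 \<^bold>\<longrightarrow> \<v> 0 T0 \<^bold>= \<v> 2 T0 \<in> RCA0\<omega>"
| suc_not_zero: "\<^bold>\<not> CSuc \<cdot> \<v> 0 T0 \<^bold>= CZero \<in> RCA0\<omega>"
| suc_inject: "CSuc \<cdot> \<v> 0 T0 \<^bold>= CSuc \<cdot> \<v> 1 T0 \<^bold>\<longrightarrow> \<v> 0 T0 \<^bold>= \<v> 1 T0 \<in> RCA0\<omega>"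
| Pi: "heq \<rho> (CPi \<rho> \<tau> \<cdot> \<v> 0 \<rho> \<cdot> \<v> 1 \<tau>) (\<v> 0 \<rho>) \<in> RCA0\<omega>"
| Sig: "x = \<v> 0 (\<delta> \<rightarrow>\<^sub>t \<rho> \<rightarrow>\<^sub>t \<tau>) \<Longrightarrow> y = \<v> 1 (\<delta> \<rightarrow>\<^sub>t \<rho>) \<Longrightarrow> z = \<v> 2 \<delta> \<Longrightarrow>
    heq \<tau> (CSig \<delta> \<rho> \<tau> \<cdot> x \<cdot> y \<cdot> z) (x \<cdot> z \<cdot> (y \<cdot> z)) \<in> RCA0\<omega>"
| Rec_0: "y = \<v> 1 T0 \<Longrightarrow> z = \<v> 2 (T0 \<rightarrow>\<^sub>t T0 \<rightarrow>\<^sub>t T0) \<Longrightarrow>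
    CRec \<cdot> CZero \<cdot> y \<cdot> z \<^bold>= y \<in> RCA0\<omega>"
| Rec_Suc: "x = \<v> 0 T0 \<Longrightarrow> y = \<v> 1 T0 \<Longrightarrow> z = \<v> 2 (T0 \<rightarrow>\<^sub>t T0 \<rightarrow>\<^sub>t T0) \<Longrightarrow>
    CRec \<cdot> (CSuc \<cdot> x) \<cdot> y \<cdot> z \<^bold>= z \<cdot> (CRec \<cdot> x \<cdot> y \<cdot> z) \<cdot> x \<in> RCA0\<omega>"
| QF_induction: "wff \<phi> \<Longrightarrow> qf \<phi> \<Longrightarrow> n = (i, T0) \<Longrightarrow>
    subst n CZero \<phi> \<^bold>\<and> (\<^bold>\<forall>n. \<phi> \<^bold>\<longrightarrow> subst n (CSuc \<cdot> Var n) \<phi>) \<^bold>\<longrightarrow> (\<^bold>\<forall>n. \<phi>) \<in> RCA0\<omega>"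
| extensionality: "x = \<v> 0 \<rho> \<Longrightarrow> y = \<v> 1 \<rho> \<Longrightarrow> z = \<v> 2 (\<rho> \<rightarrow>\<^sub>t \<tau>) \<Longrightarrow>
    heq \<rho> x y \<^bold>\<longrightarrow> heq \<tau> (z \<cdot> x) (z \<cdot> y) \<in> RCA0\<omega>"
| QF_AC_1_0: "wff \<phi> \<Longrightarrow> qf \<phi> \<Longrightarrow> f = (i, T1) \<Longrightarrow> n = (j, T0) \<Longrightarrow> \<Phi> = (k, T2) \<Longrightarrow> \<Phi> \<notin> fvs \<phi> \<Longrightarrow>
    (\<^bold>\<forall>f. \<^bold>\<exists>n. \<phi>) \<^bold>\<longrightarrow> (\<^bold>\<exists>\<Phi>. \<^bold>\<forall>f. subst n (Var \<Phi> \<cdot> Var f) \<phi>) \<in> RCA0\<omega>"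

inductive_set QF_DC_1_1 :: "fm set" where
  "wff \<phi> \<Longrightarrow> qf \<phi> \<Longrightarrow> n = (i, T0) \<Longrightarrow> f = (j, T1) \<Longrightarrow> g = (k, T1) \<Longrightarrow> f \<noteq> g \<Longrightarrow>
   F = (l, T0 \<rightarrow>\<^sub>t T1) \<Longrightarrow> F \<notin> fvs \<phi> \<Longrightarrow>
    (\<^bold>\<forall>n. \<^bold>\<forall>f. \<^bold>\<exists>g. \<phi>) \<^bold>\<longrightarrow>
    (\<^bold>\<exists>F. \<^bold>\<forall>n. subst g (Var F \<cdot> (CSuc \<cdot> Var n)) (subst f (Var F \<cdot> Var n) \<phi>)) \<in> QF_DC_1_1"


section \<open>Primitive recursive terms\<close>

text \<open>Bracket abstraction: \<open>lam x t\<close> is the combinatory term for \<open>\<lambda>x. t\<close>.\<close>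

fun lam :: "var \<Rightarrow> trm \<Rightarrow> trm" where
  "lam x (Var y) =
     (if y = x
      then CSig (snd x) (snd x \<rightarrow>\<^sub>t snd x) (snd x) \<cdot> CPi (snd x) (snd x \<rightarrow>\<^sub>t snd x) \<cdot> CPi (snd x) (snd x)
      else CPi (snd y) (snd x) \<cdot> Var y)"
| "lam x (s \<cdot> t) =
     (if x \<in> vars s \<union> vars t
      then CSig (snd x) (tyof t) (tyof (s \<cdot> t)) \<cdot> lam x s \<cdot> lam x t
      else CPi (tyof (s \<cdot> t)) (snd x) \<cdot> (s \<cdot> t))"
| "lam x c = CPi (tyof c) (snd x) \<cdot> c"

abbreviation (input) \<a> :: var where "\<a> \<equiv> (0, T0)"
abbreviation (input) \<b> :: var where "\<b> \<equiv> (1, T0)"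
abbreviation (input) \<m> :: var where "\<m> \<equiv> (2, T0)"  \<comment> \<open>recursion index\<close>
abbreviation (input) \<r> :: var where "\<r> \<equiv> (3, T0)"  \<comment> \<open>result of the recursive call\<close>

definition addC :: trm where
  "addC = lam \<a> (lam \<b> (CRec \<cdot> Var \<b> \<cdot> Var \<a> \<cdot> lam \<r> (lam \<m> (CSuc \<cdot> Var \<r>))))"
abbreviation add :: "trm \<Rightarrow> trm \<Rightarrow> trm"  (infixl "\<^bold>+" 65) where "s \<^bold>+ t \<equiv> addC \<cdot> s \<cdot> t"

definition mulC :: trm where
  "mulC = lam \<a> (lam \<b> (CRec \<cdot> Var \<b> \<cdot> CZero \<cdot> lam \<r> (lam \<m> (Var \<r> \<^bold>+ Var \<a>))))"
abbreviation mul :: "trm \<Rightarrow> trm \<Rightarrow> trm"  (infixl "\<^bold>*" 70) where "s \<^bold>* t \<equiv> mulC \<cdot> s \<cdot> t"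

definition predC :: trm where
  "predC = lam \<a> (CRec \<cdot> Var \<a> \<cdot> CZero \<cdot> lam \<r> (lam \<m> (Var \<m>)))"

text \<open>Truncated subtraction.\<close>

definition subC :: trm where
  "subC = lam \<a> (lam \<b> (CRec \<cdot> Var \<b> \<cdot> Var \<a> \<cdot> lam \<r> (lam \<m> (predC \<cdot> Var \<r>))))"
abbreviation sub :: "trm \<Rightarrow> trm \<Rightarrow> trm"  (infixl "\<^bold>-" 65) where "s \<^bold>- t \<equiv> subC \<cdot> s \<cdot> t"

text \<open>\<open>2\<^sup>a\<close>\<close>

definition pow2C :: trm where
  "pow2C = lam \<a> (CRec \<cdot> Var \<a> \<cdot> (CSuc \<cdot> CZero) \<cdot> lam \<r> (lam \<m> (Var \<r> \<^bold>+ Var \<r>)))"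

text \<open>The Cantor pairing \<open>(a, b) \<mapsto> (a + b)(a + b + 1)/2 + b\<close>, a bijection, and its inverse.
  \<open>triC\<close> yields the triangular numbers \<open>a(a + 1)/2\<close>, and \<open>rootC\<close> the greatest \<open>w\<close> with
  \<open>w(w + 1)/2 \<le> a\<close>.\<close>

definition triC :: trm where
  "triC = lam \<a> (CRec \<cdot> Var \<a> \<cdot> CZero \<cdot> lam \<r> (lam \<m> (Var \<r> \<^bold>+ CSuc \<cdot> Var \<m>)))"

definition pairC :: trm where
  "pairC = lam \<a> (lam \<b> (triC \<cdot> (Var \<a> \<^bold>+ Var \<b>) \<^bold>+ Var \<b>))"
abbreviation pair :: "trm \<Rightarrow> trm \<Rightarrow> trm" where "pair s t \<equiv> pairC \<cdot> s \<cdot> t"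

definition rootC :: trm where
  "rootC = lam \<a> (CRec \<cdot> Var \<a> \<cdot> CZero \<cdot>
     lam \<r> (lam \<m> (Var \<r> \<^bold>+ (CSuc \<cdot> CZero \<^bold>- (triC \<cdot> (CSuc \<cdot> Var \<r>) \<^bold>- CSuc \<cdot> Var \<m>)))))"

definition sndC :: trm where
  "sndC = lam \<a> (Var \<a> \<^bold>- triC \<cdot> (rootC \<cdot> Var \<a>))"

definition fstC :: trm where
  "fstC = lam \<a> (rootC \<cdot> Var \<a> \<^bold>- sndC \<cdot> Var \<a>)"

text \<open>Codes of finite sequences: the empty sequence has code \<open>0\<close>, and appending \<open>y\<close> to the
  sequence with code \<open>c\<close> gives the sequence with code \<open>pair c y + 1\<close>. Hence \<open>initseg g n\<close>
  is the code of \<open>(g(0), \<dots>, g(n - 1))\<close>.\<close>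

definition initsegC :: trm where
  "initsegC = lam (0, T1) (lam \<a>
     (CRec \<cdot> Var \<a> \<cdot> CZero \<cdot> lam \<r> (lam \<m> (CSuc \<cdot> pair (Var \<r>) (\<v> 0 T1 \<cdot> Var \<m>)))))"
abbreviation initseg :: "trm \<Rightarrow> trm \<Rightarrow> trm" where "initseg g n \<equiv> initsegC \<cdot> g \<cdot> n"

text \<open>\<open>\<langle>t\<^sub>1, \<dots>, t\<^sub>k\<rangle>\<close>, with \<open>\<langle>t\<rangle> = t\<close>.\<close>

fun tuple :: "trm list \<Rightarrow> trm" where
  "tuple [] = CZero"
| "tuple [t] = t"
| "tuple (t # ts) = pair t (tuple ts)"


section \<open>The functionals \<open>S\<^sup>2\<^sub>k\<close>, and \<open>Z\<^sub>2\<^sup>\<omega>\<close>\<close>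

text \<open>\<open>alternating True [x\<^sub>1, x\<^sub>2, x\<^sub>3, \<dots>] \<phi>\<close> is \<open>\<exists>x\<^sub>1 \<forall>x\<^sub>2 \<exists>x\<^sub>3 \<dots> \<phi>\<close>.\<close>

fun alternating :: "bool \<Rightarrow> var list \<Rightarrow> fm \<Rightarrow> fm" where
  "alternating e [] \<phi> = \<phi>"
| "alternating e (x # xs) \<phi> =
     (if e then \<^bold>\<exists>x. alternating (\<not> e) xs \<phi> else \<^bold>\<forall>x. alternating (\<not> e) xs \<phi>)"

definition Sigma1_nf :: "nat \<Rightarrow> trm \<Rightarrow> fm" where
  "Sigma1_nf k f =
     (let g = (\<lambda>i. (fresh f + i, T1)); n = (fresh f, T0) in
      alternating True (map g [1..<Suc k] @ [n])
        (f \<cdot> tuple (map (\<lambda>i. initseg (Var (g i)) (Var n)) [1..<Suc k]) \<^bold>= CZero))"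

definition S2 :: "nat \<Rightarrow> fm" where
  "S2 k =
     (let S = (0, T2); f = (0, T1); Sf = Var S \<cdot> Var f in
      \<^bold>\<exists>S. \<^bold>\<forall>f. (Sf \<^bold>= CZero \<^bold>\<or> Sf \<^bold>= CSuc \<cdot> CZero) \<^bold>\<and> (Sf \<^bold>= CZero \<^bold>\<longleftrightarrow> Sigma1_nf k (Var f)))"

definition Pi1_CA0\<omega> :: "nat \<Rightarrow> fm set" where
  "Pi1_CA0\<omega> k = RCA0\<omega> \<union> {S2 k}"

definition Z2\<omega> :: "fm set" where
  "Z2\<omega> = (\<Union>k\<in>{1..}. Pi1_CA0\<omega> k)"


section \<open>Rational and real numbers\<close>

text \<open>Every number is the code of a rational number: \<open>pair (pair c d) e\<close> codes
  \<open>(c - d)/(e + 1)\<close>.\<close>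

definition ratq :: "trm \<Rightarrow> trm \<Rightarrow> trm \<Rightarrow> trm" where
  "ratq c d e = pair (pair c d) e"

definition posq :: "trm \<Rightarrow> trm" where "posq q = fstC \<cdot> (fstC \<cdot> q)"
definition negq :: "trm \<Rightarrow> trm" where "negq q = sndC \<cdot> (fstC \<cdot> q)"
definition denq :: "trm \<Rightarrow> trm" where "denq q = CSuc \<cdot> (sndC \<cdot> q)"

definition addq :: "trm \<Rightarrow> trm \<Rightarrow> trm" where
  "addq p q = ratq (posq p \<^bold>* denq q \<^bold>+ posq q \<^bold>* denq p) (negq p \<^bold>* denq q \<^bold>+ negq q \<^bold>* denq p)
                (predC \<cdot> (denq p \<^bold>* denq q))"

definition le0 :: "trm \<Rightarrow> trm \<Rightarrow> fm" where "le0 s t = (s \<^bold>- t \<^bold>= CZero)"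

definition leq :: "trm \<Rightarrow> trm \<Rightarrow> fm" where
  "leq p q = le0 (posq p \<^bold>* denq q \<^bold>+ negq q \<^bold>* denq p) (posq q \<^bold>* denq p \<^bold>+ negq p \<^bold>* denq q)"

definition lessq :: "trm \<Rightarrow> trm \<Rightarrow> fm" where
  "lessq p q = \<^bold>\<not> leq q p"

text \<open>\<open>2\<^sup>-\<^sup>n\<close> and \<open>2\<^sup>-\<^sup>n\<^sup>+\<^sup>1\<close>\<close>

definition epsq :: "trm \<Rightarrow> trm" where
  "epsq n = ratq (CSuc \<cdot> CZero) CZero (predC \<cdot> (pow2C \<cdot> n))"
definition eps2q :: "trm \<Rightarrow> trm" where
  "eps2q n = ratq (CSuc \<cdot> (CSuc \<cdot> CZero)) CZero (predC \<cdot> (pow2C \<cdot> n))"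

text \<open>\<open>x \<in> \<real>\<close>: \<open>\<forall>n i. \<bar>x\<^sub>n - x\<^sub>n\<^sub>+\<^sub>i\<bar> < 2\<^sup>-\<^sup>n\<close>\<close>

definition isreal :: "trm \<Rightarrow> fm" where
  "isreal x =
     (let n = (fresh x, T0); i = (Suc (fresh x), T0); p = x \<cdot> Var n; q = x \<cdot> (Var n \<^bold>+ Var i) in
      \<^bold>\<forall>n. \<^bold>\<forall>i. lessq p (addq q (epsq (Var n))) \<^bold>\<and> lessq q (addq p (epsq (Var n))))"

text \<open>\<open>x \<le>\<^sub>\<real> y\<close>: \<open>\<forall>n. x\<^sub>n \<le> y\<^sub>n + 2\<^sup>-\<^sup>n\<^sup>+\<^sup>1\<close>; and \<open>x =\<^sub>\<real> y\<close>: \<open>\<forall>n. \<bar>x\<^sub>n - y\<^sub>n\<bar> \<le> 2\<^sup>-\<^sup>n\<^sup>+\<^sup>1\<close>\<close>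

definition leR :: "trm \<Rightarrow> trm \<Rightarrow> fm" where
  "leR x y =
     (let n = (max (fresh x) (fresh y), T0) in
      \<^bold>\<forall>n. leq (x \<cdot> Var n) (addq (y \<cdot> Var n) (eps2q (Var n))))"

definition eqR :: "trm \<Rightarrow> trm \<Rightarrow> fm" where
  "eqR x y =
     (let n = (max (fresh x) (fresh y), T0); p = x \<cdot> Var n; q = y \<cdot> Var n in
      \<^bold>\<forall>n. leq p (addq q (eps2q (Var n))) \<^bold>\<and> leq q (addq p (eps2q (Var n))))"

definition zeroR :: trm where
  "zeroR = CPi T0 T0 \<cdot> ratq CZero CZero CZero"
definition oneR :: trm where
  "oneR = CPi T0 T0 \<cdot> ratq (CSuc \<cdot> CZero) CZero CZero"

definition in01 :: "trm \<Rightarrow> fm" where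
  "in01 x = (isreal x \<^bold>\<and> leR zeroR x \<^bold>\<and> leR x oneR)"

text \<open>\<open>Y : [0,1] \<rightarrow> \<nat>\<close> is a functional of type \<open>2\<close> that respects \<open>=\<^sub>\<real>\<close> on \<open>[0,1]\<close>.\<close>

definition fun01 :: "trm \<Rightarrow> fm" where
  "fun01 Y =
     (let x = (fresh Y, T1); y = (Suc (fresh Y), T1) in
      \<^bold>\<forall>x. \<^bold>\<forall>y. in01 (Var x) \<^bold>\<and> in01 (Var y) \<^bold>\<and> eqR (Var x) (Var y) \<^bold>\<longrightarrow> Y \<cdot> Var x \<^bold>= Y \<cdot> Var y)"

definition NIN01 :: fm where
  "NIN01 =
     (let Y = (0, T2); x = (0, T1); y = (1, T1) in
      \<^bold>\<forall>Y. fun01 (Var Y) \<^bold>\<longrightarrow>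
        (\<^bold>\<exists>x. \<^bold>\<exists>y. in01 (Var x) \<^bold>\<and> in01 (Var y) \<^bold>\<and> \<^bold>\<not> eqR (Var x) (Var y) \<^bold>\<and>
                Var Y \<cdot> Var x \<^bold>= Var Y \<cdot> Var y))"


section \<open>All axioms and \<open>NIN01\<close> are well-typed, and \<open>NIN01\<close> is a sentence\<close>

lemma lam_tyof: "tyof (lam x t) = snd x \<rightarrow>\<^sub>t tyof t"
  by (induction x t rule: lam.induct) auto

lemma lam_wf: "wft t \<Longrightarrow> wft (lam x t)"
  by (induction x t rule: lam.induct) (auto simp: lam_tyof)

lemma lam_vars: "vars (lam x t) = vars t - {x}"
  by (induction x t rule: lam.induct) auto

lemmas C_defs = addC_def mulC_def predC_def subC_def pow2C_def triC_def pairC_def rootC_def sndC_def fstC_def initsegC_def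
context
  notes lam.simps [simp del] and lam_tyof [simp] lam_wf [simp] and lam_vars [simp] 
begin

lemma C_wf: "wft addC" "tyof addC = T0 \<rightarrow>\<^sub>t T0 \<rightarrow>\<^sub>t T0" "wft mulC" "tyof mulC = T0 \<rightarrow>\<^sub>t T0 \<rightarrow>\<^sub>t T0"
  "wft predC" "tyof predC = T1"  "wft subC" "tyof subC = T0 \<rightarrow>\<^sub>t T0 \<rightarrow>\<^sub>t T0" "wft pow2C" "tyof pow2C = T1"
  "wft triC" "tyof triC = T1" "wft pairC" "tyof pairC = T0 \<rightarrow>\<^sub>t T0 \<rightarrow>\<^sub>t T0"
  "wft rootC" "tyof rootC = T1" "wft sndC" "tyof sndC = T1" "wft fstC" "tyof fstC = T1"
  "wft initsegC" "tyof initsegC = T1 \<rightarrow>\<^sub>t T1"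
  by (simp_all add: C_defs)

lemma C_vars: "vars addC = {}" "vars mulC = {}" "vars predC = {}" "vars subC = {}" "vars pow2C = {}"
  "vars triC = {}" "vars pairC = {}" "vars rootC = {}" "vars sndC = {}" "vars fstC = {}" "vars initsegC = {}"
  by (auto simp add: C_defs)
end

abbreviation num_trm :: "trm \<Rightarrow> bool" where "num_trm t \<equiv> wft t \<and> tyof t = T0"

lemma q_wf:
  "num_trm c \<Longrightarrow> num_trm d \<Longrightarrow> num_trm e \<Longrightarrow> num_trm (ratq c d e)"
  "num_trm q \<Longrightarrow> num_trm (posq q)" "num_trm q \<Longrightarrow> num_trm (negq q)" "num_trm q \<Longrightarrow> num_trm (denq q)"
  "num_trm n \<Longrightarrow> num_trm (epsq n)" "num_trm n \<Longrightarrow> num_trm (eps2q n)"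
  by (auto simp: ratq_def posq_def negq_def denq_def epsq_def eps2q_def C_wf)

lemma q_vars:
  "vars (ratq c d e) = vars c \<union> vars d \<union> vars e"
  "vars (posq q) = vars q" "vars (negq q) = vars q" "vars (denq q) = vars q"
  "vars (epsq n) = vars n" "vars (eps2q n) = vars n"
  by (auto simp: ratq_def posq_def negq_def denq_def epsq_def eps2q_def C_vars)

lemma addq_wf: "num_trm p \<Longrightarrow> num_trm q \<Longrightarrow> num_trm (addq p q)"
  by (simp add: addq_def q_wf C_wf)

lemma addq_vars: "vars (addq p q) = vars p \<union> vars q"
  by (auto simp: addq_def q_vars C_vars)

lemma leq_wf: "num_trm p \<Longrightarrow> num_trm q \<Longrightarrow> wff (leq p q)" "num_trm p \<Longrightarrow> num_trm q \<Longrightarrow> wff (lessq p q)"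
  by (simp_all add: leq_def lessq_def le0_def q_wf C_wf)

lemma leq_fvs: "fvs (leq p q) = vars p \<union> vars q" "fvs (lessq p q) = vars p \<union> vars q"
  by (auto simp: leq_def lessq_def le0_def q_vars C_vars)

lemma fresh_vars: "fresh t \<le> i \<Longrightarrow> (i, \<rho>) \<notin> vars t"
  by (induction t) auto

lemma real_wf:
  assumes "wft x" "tyof x = T1" "wft y" "tyof y = T1"
  shows "wff (isreal x)" "wff (leR x y)" "wff (eqR x y)"
  using assms by (simp_all add: isreal_def leR_def eqR_def Let_def leq_wf addq_wf q_wf C_wf)

lemma real_fvs: "fvs (isreal x) = vars x" "fvs (leR x y) = vars x \<union> vars y" "fvs (eqR x y) = vars x \<union> vars y"
  by (auto simp: isreal_def leR_def eqR_def Let_def leq_fvs addq_vars q_vars C_vars fresh_vars)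

lemma in01_wf: "wft x \<Longrightarrow> tyof x = T1 \<Longrightarrow> wff (in01 x)"
  by (simp add: in01_def real_wf zeroR_def oneR_def q_wf)

lemma in01_fvs: "fvs (in01 x) = vars x"
  by (simp add: in01_def real_fvs zeroR_def oneR_def q_vars)

lemma NIN01_wf: "wff NIN01"
  by (simp add: NIN01_def fun01_def Let_def in01_wf real_wf)

lemma NIN01_closed: "fvs NIN01 = {}"
  by (auto simp: NIN01_def fun01_def Let_def in01_fvs real_fvs)

lemma substt_wf: "wft t \<Longrightarrow> wft u \<Longrightarrow> tyof u = snd x \<Longrightarrow> wft (substt x u t) \<and> tyof (substt x u t) = tyof t"
  by (induction t) auto

lemma subst_wf: "wff \<phi> \<Longrightarrow> wft u \<Longrightarrow> tyof u = snd x \<Longrightarrow> wff (subst x u \<phi>)"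
  by (induction \<phi>) (auto simp: substt_wf)

lemma heq_wf: "wft s \<Longrightarrow> wft t \<Longrightarrow> tyof s = \<rho> \<Longrightarrow> tyof t = \<rho> \<Longrightarrow> wff (heq \<rho> s t)"
  by (induction \<rho> s t rule: heq.induct) (auto simp: Let_def)

lemma tuple_wf: "(\<forall>t\<in>set ts. wft t \<and> tyof t = T0) \<Longrightarrow> wft (tuple ts) \<and> tyof (tuple ts) = T0"
  by (induction ts rule: tuple.induct) (auto simp: C_wf)

lemma tuple_vars: "vars (tuple ts) = (\<Union>t\<in>set ts. vars t)"
  by (induction ts rule: tuple.induct) (auto simp: C_vars)

lemma alternating_wf: "wff (alternating e xs \<phi>) = wff \<phi>"
  by (induction e xs \<phi> rule: alternating.induct) auto

lemma alternating_fvs: "fvs (alternating e xs \<phi>) = fvs \<phi> - set xs"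
  by (induction e xs \<phi> rule: alternating.induct) auto

lemma S2_sentence: "wff (S2 k) \<and> fvs (S2 k) = {}"
  by (auto simp: S2_def Sigma1_nf_def Let_def alternating_wf alternating_fvs tuple_wf tuple_vars C_wf C_vars
      simp del: upt_Suc)

lemma RCA_wf: "\<phi> \<in> RCA0\<omega> \<Longrightarrow> wff \<phi>"
  by (induction rule: RCA0\<omega>.induct) (simp_all add: heq_wf subst_wf)

lemma DC_wf: "\<phi> \<in> QF_DC_1_1 \<Longrightarrow> wff \<phi>"
  by (induction rule: QF_DC_1_1.induct) (simp_all add: subst_wf)

lemma axioms_wf: "\<phi> \<in> Z2\<omega> \<union> QF_DC_1_1 \<Longrightarrow> wff \<phi>"
  by (auto simp: Z2\<omega>_def Pi1_CA0\<omega>_def RCA_wf DC_wf S2_sentence)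

lemma proves_wf: "T \<turnstile> \<phi> \<Longrightarrow> (\<forall>\<psi>\<in>T. wff \<psi>) \<Longrightarrow> wff \<phi>"
  by (induction rule: proves.induct) (auto intro!: subst_wf)

end

theory Submission
  imports Defs Complex_Main
begin

text \<open>The proof forces, over the ground model of all reals, with partial injections from the reals
  to the naturals that leave infinitely many naturals unused. A condition also carries a set of
  values that later extensions may not take. Reserving one fresh value at each step, one can fuse
  a sequence of conditions into a condition; the fusion need not extend them, but it contains all
  their injections. Hence the generic injection \<open>Y\<close> adds no elements of Baire space, so
  the functionals \<open>S\<^sup>2\<^sub>k\<close> can be those of the ground model, and quantifier-free
  dependent choice is forced although the generic collapses the continuum. Since HOL has no single
  type containing the full type structure over the naturals, the objects of higher type are
  combinator codes with oracles, identified by a hereditary (logical) relation at each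
  condition.\<close>

section \<open>Codes and their evaluation\<close>

text \<open>A standard model with all of Baire space cannot contain the injection, as [0,1] is
  uncountable; so each condition holds only a part of it, and equations between numbers are required
  only densely. Finite conditions would not do: along a ground sequence of distinct reals the
  generic values would form a new element of Baire space, about which the ground functionals say
  nothing. Hence one condition must be able to settle countably many values. The obstacle is that
  the union of an increasing sequence of partial injections may use up every natural number, and the
  second component of a condition exists to prevent this. The price is that a fusion keeps from its
  stages only what depends on the injections alone: evaluation of codes, but not forcing in general.
  Therefore both choice axioms go through characteristic terms, which turn a quantifier-free formula
  into a number to be evaluated. For the functionals \<open>S2\<close> it suffices that second-order
  statements with ground parameters are absolute.\<close>

datatype code =
    K
  | S
  | R
  | Num nat
  | Op "nat \<Rightarrow> nat \<Rightarrow> nat"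
  | Orc nat
  | Mu
  | Ap code code  (infixl "\<bullet>" 90)

text \<open>Evaluation is call-by-name: \<open>hr\<close> is head reduction. \<open>Orc 0\<close> stands for the
  generic injection, \<open>Orc k\<close> with positive \<open>k\<close> for \<open>S\<^sup>2\<^sub>k\<close>, and \<open>Mu\<close> searches for the least zero.\<close>

inductive hr :: "code \<Rightarrow> code \<Rightarrow> bool" where
  hrK: "hr (K \<bullet> a \<bullet> b) a"
| hrS: "hr (S \<bullet> a \<bullet> b \<bullet> c) (a \<bullet> c \<bullet> (b \<bullet> c))"
| hrA: "hr s t \<Longrightarrow> hr (s \<bullet> u) (t \<bullet> u)"

inductive_simps hr_simps [simp]:
  "hr K t" "hr S t" "hr R t" "hr (Num n) t" "hr (Op g) t" "hr (Orc k) t" "hr Mu t" "hr (s \<bullet> u) t"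

type_synonym queries = "nat \<Rightarrow> (nat \<Rightarrow> nat) \<Rightarrow> nat option"

text \<open>\<open>ev_Orc\<close> has infinitely many premises: an oracle is consulted only when the
  present injection determines every value of its argument. So a code may lack a value at one
  condition and gain it at an extension.\<close>

inductive ev :: "queries \<Rightarrow> code \<Rightarrow> nat \<Rightarrow> bool" for X :: queries where
  ev_Num: "ev X (Num n) n"
| ev_Op: "ev X s m \<Longrightarrow> ev X t n \<Longrightarrow> ev X (Op g \<bullet> s \<bullet> t) (g m n)"
| ev_R0: "ev X t 0 \<Longrightarrow> ev X y m \<Longrightarrow> ev X (R \<bullet> t \<bullet> y \<bullet> z) m"
| ev_RSuc: "ev X t (Suc n) \<Longrightarrow> ev X (z \<bullet> (R \<bullet> Num n \<bullet> y \<bullet> z) \<bullet> Num n) m \<Longrightarrow>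
    ev X (R \<bullet> t \<bullet> y \<bullet> z) m"
| ev_Orc: "(\<And>m. ev X (t \<bullet> Num m) (f m)) \<Longrightarrow> X k f = Some n \<Longrightarrow> ev X (Orc k \<bullet> t) n"
| ev_Mu: "ev X (t \<bullet> Num n) 0 \<Longrightarrow> (\<And>i. i < n \<Longrightarrow> ev X (t \<bullet> Num i) (Suc (f i))) \<Longrightarrow>
    ev X (Mu \<bullet> t) n"
| ev_hr: "hr s t \<Longrightarrow> ev X t n \<Longrightarrow> ev X s n"

inductive_cases ev_NumE: "ev X (Num n) m"
inductive_cases ev_OpE: "ev X (Op g \<bullet> s \<bullet> t) m"
inductive_cases ev_RE: "ev X (R \<bullet> t \<bullet> y \<bullet> z) m"
inductive_cases ev_OrcE: "ev X (Orc k \<bullet> t) m"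
inductive_cases ev_MuE: "ev X (Mu \<bullet> t) m"

section \<open>Evaluation is deterministic and monotone in the oracle answers\<close>

lemma hr_det: "hr s t \<Longrightarrow> hr s u \<Longrightarrow> t = u"
proof (induction arbitrary: u rule: hr.induct)
  case (hrA s t v)
  from hrA.prems have "\<exists>t'. u = t' \<bullet> v \<and> hr s t'" using hrA.hyps by auto
  then show ?case using hrA.IH by blast
qed auto

lemma ev_hrD: "ev X s n \<Longrightarrow> hr s t \<Longrightarrow> ev X t n"
  by (cases rule: ev.cases) (auto dest: hr_det)

lemma ev_det: "ev X s m \<Longrightarrow> ev X s n \<Longrightarrow> m = n"
proof (induction arbitrary: n rule: ev.induct)
  case (ev_Orc t f k n)
  from ev_Orc.prems show ?case
  proof (rule ev_OrcE, goal_cases)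
    case (1 f')
    have "f m = f' m" for m using ev_Orc.IH[of m "f' m"] 1 by simp
    then have "f = f'" by (rule ext)
    then show ?case using 1 ev_Orc.hyps by simp
  qed simp
next
  case (ev_Mu t m f)
  from ev_Mu.prems show ?case
  proof (rule ev_MuE, goal_cases)
    case (1 f')
    show ?case
    proof (rule linorder_cases[of m n])
      assume "m < n" with 1 ev_Mu.IH(1)[of "Suc (f' m)"] show ?thesis by simp
    next
      assume "n < m" with 1 ev_Mu.IH(2)[of n 0] show ?thesis by simp
    qed
  qed simp
next
  case (ev_hr s t n)
  then show ?case using ev_hrD[of X s n t] by simp
next
  case (ev_Op s m t n g n')
  from ev_Op.prems show ?case
  proof (rule ev_OpE, goal_cases)
    case (1 m' n')
    then show ?case using ev_Op.IH(1)[of m'] ev_Op.IH(2)[of n'] by simp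
  qed simp
next
  case (ev_R0 t y m z n)
  from ev_R0.prems show ?case
  proof (rule ev_RE, goal_cases)
    case (2 n')
    then show ?case using ev_R0.IH(1)[of "Suc n'"] by simp
  next
    case 1
    then show ?case using ev_R0.IH(2)[of n] by simp
  qed simp
next
  case (ev_RSuc t n z y m na)
  from ev_RSuc.prems show ?case
  proof (rule ev_RE, goal_cases)
    case (2 n')
    then have "n' = n" using ev_RSuc.IH(1)[of "Suc n'"] by simp
    then show ?case using ev_RSuc.IH(2)[of na] 2 by simp
  next
    case 1
    then show ?case using ev_RSuc.IH(1)[of 0] by simp
  qed simp
next
  case (ev_Num n)
  then show ?case by (auto elim: ev_NumE)
qed

text \<open>A derivation uses only positive answers of the oracles, so it survives when more queries
  are answered. This carries values both to extensions and to a fusion.\<close>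

lemma ev_mono:
  assumes "ev X s n" "\<And>k f n. X k f = Some n \<Longrightarrow> X' k f = Some n"
  shows "ev X' s n"
  using assms(1) by (induction rule: ev.induct) (auto intro: ev.intros assms(2))

fun cl :: "(var \<Rightarrow> code) \<Rightarrow> trm \<Rightarrow> code" where
  "cl \<rho> (Var x) = \<rho> x"
| "cl \<rho> CZero = Num 0"
| "cl \<rho> CSuc = Op (\<lambda>_ n. Suc n) \<bullet> Num 0"
| "cl \<rho> (CPi _ _) = K"
| "cl \<rho> (CSig _ _ _) = S"
| "cl \<rho> CRec = R"
| "cl \<rho> (s \<cdot> t) = cl \<rho> s \<bullet> cl \<rho> t"

text \<open>\<open>Op\<close> carries an arbitrary ground function of two numbers. With a dummy
  first argument it codes an element of Baire space; left unapplied it codes a sequence of such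
  elements.\<close>

abbreviation Fn0 :: "(nat \<Rightarrow> nat) \<Rightarrow> code" where
  "Fn0 f \<equiv> Op (\<lambda>_. f) \<bullet> Num 0"

lemma cl_cong: "(\<And>x. x \<in> vars t \<Longrightarrow> \<rho> x = \<rho>' x) \<Longrightarrow> cl \<rho> t = cl \<rho>' t"
  by (induction t) auto

lemma cl_upd [simp]: "x \<notin> vars t \<Longrightarrow> cl (\<rho>(x := a)) t = cl \<rho> t"
  by (rule cl_cong) auto

lemma cl_substt: "cl \<rho> (substt x u t) = cl (\<rho>(x := cl \<rho> u)) t"
  by (induction t) auto

lemma substt_id: "x \<notin> vars t \<Longrightarrow> substt x u t = t"
  by (induction t) auto

lemma subst_id: "x \<notin> fvs \<phi> \<Longrightarrow> subst x u \<phi> = \<phi>"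
  by (induction \<phi>) (auto simp: substt_id)

lemma qf_free_for: "qf \<phi> \<Longrightarrow> free_for u x \<phi>"
  by (induction \<phi>) auto


section \<open>Hereditary equality of codes at a condition\<close>

text \<open>Reflexivity is restricted to the field of the order: \<open>p \<sqsubseteq> p\<close>
  says that \<open>p\<close> is a condition, because invalid pairs inhabit the same type. The locale
  is abstract since it is also instantiated with a single point without oracles, to compute values
  of terms in the ground model.\<close>

locale forcing =
  fixes le :: "'p \<Rightarrow> 'p \<Rightarrow> bool"  (infix "\<sqsubseteq>" 50)
    and orc :: "'p \<Rightarrow> queries"
  assumes le_refl: "q \<sqsubseteq> p \<Longrightarrow> q \<sqsubseteq> q"
    and le_trans: "r \<sqsubseteq> q \<Longrightarrow> q \<sqsubseteq> p \<Longrightarrow> r \<sqsubseteq> p"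
    and orc_mono: "q \<sqsubseteq> p \<Longrightarrow> orc p k f = Some n \<Longrightarrow> orc q k f = Some n"
begin

lemma ev_le: "ev (orc p) s n \<Longrightarrow> q \<sqsubseteq> p \<Longrightarrow> ev (orc q) s n"
  by (erule ev_mono) (rule orc_mono)

text \<open>Agreement at type 0 is asked for densely, as in weak forcing, because no condition
  answers all queries; function types look at all extensions, as in a Kripke logical relation. The
  codes are untyped: being related to itself is what makes a code an object of the type at
  \<open>p\<close>.\<close>

fun rel :: "ty \<Rightarrow> 'p \<Rightarrow> code \<Rightarrow> code \<Rightarrow> bool" where
  "rel T0 p s t \<longleftrightarrow> (\<forall>q. q \<sqsubseteq> p \<longrightarrow> (\<exists>r n. r \<sqsubseteq> q \<and> ev (orc r) s n \<and> ev (orc r) t n))"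
| "rel (\<sigma> \<rightarrow>\<^sub>t \<tau>) p s t \<longleftrightarrow> (\<forall>q a b. q \<sqsubseteq> p \<longrightarrow> rel \<sigma> q a b \<longrightarrow> rel \<tau> q (s \<bullet> a) (t \<bullet> b))"

declare rel.simps [simp del]

lemma rel_mono: "rel \<sigma> p s t \<Longrightarrow> q \<sqsubseteq> p \<Longrightarrow> rel \<sigma> q s t"
  by (cases \<sigma>) (auto simp: rel.simps intro: le_trans)

text \<open>At type 0 density below a dense set is density, and at function types the claim descends
  to the values. Classical logic rests on this.\<close>

lemma rel_stable: "(\<And>q. q \<sqsubseteq> p \<Longrightarrow> \<exists>r. r \<sqsubseteq> q \<and> rel \<sigma> r s t) \<Longrightarrow> rel \<sigma> p s t"
proof (induction \<sigma> arbitrary: p s t)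
  case T0
  then show ?case unfolding rel.simps(1) by (meson le_refl le_trans)
next
  case (Fn \<sigma> \<tau>)
  show ?case
    unfolding rel.simps(2)
  proof (intro allI impI)
    fix q a b assume q: "q \<sqsubseteq> p" and ab: "rel \<sigma> q a b"
    show "rel \<tau> q (s \<bullet> a) (t \<bullet> b)"
    proof (rule Fn.IH(2))
      fix q' assume q': "q' \<sqsubseteq> q"
      then obtain r where r: "r \<sqsubseteq> q'" "rel (\<sigma> \<rightarrow>\<^sub>t \<tau>) r s t" using Fn.prems q le_trans by blast
      have "rel \<sigma> r a b" using ab rel_mono r q' le_trans by blast
      then show "\<exists>r. r \<sqsubseteq> q' \<and> rel \<tau> r (s \<bullet> a) (t \<bullet> b)" using r le_refl unfolding rel.simps(2) by blast
    qed
  qed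
qed

lemma rel_sym: "rel \<sigma> p s t \<Longrightarrow> rel \<sigma> p t s"
proof (induction \<sigma> arbitrary: p s t)
  case T0
  then show ?case unfolding rel.simps(1) by meson
next
  case (Fn \<sigma> \<tau>)
  then show ?case unfolding rel.simps(2) by meson
qed

lemma rel_trans: "rel \<sigma> p s t \<Longrightarrow> rel \<sigma> p t u \<Longrightarrow> rel \<sigma> p s u"
proof (induction \<sigma> arbitrary: p s t u)
  case T0
  show ?case
  unfolding rel.simps(1) proof (intro allI impI)
    fix q assume q: "q \<sqsubseteq> p"
    then obtain r n where r: "r \<sqsubseteq> q" "ev (orc r) s n" "ev (orc r) t n"
      using T0(1) unfolding rel.simps(1) by meson
    then obtain r' n' where "r' \<sqsubseteq> r" "ev (orc r') t n'" "ev (orc r') u n'"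
      using T0(2) q le_trans unfolding rel.simps(1) by meson
    then show "\<exists>r n. r \<sqsubseteq> q \<and> ev (orc r) s n \<and> ev (orc r) u n"
      using r ev_le ev_det le_trans by blast
  qed
next
  case (Fn \<sigma> \<tau>)
  show ?case
    unfolding rel.simps(2)
  proof (intro allI impI)
    fix q a b assume q: "q \<sqsubseteq> p" and ab: "rel \<sigma> q a b"
    \<comment> \<open>The chain runs through \<open>t \<bullet> b\<close>, so its second link needs
      \<open>b\<close> paired with itself.\<close>
    have "rel \<sigma> q b b" using Fn.IH(1)[of q b a b] ab rel_sym[OF ab] by simp
    then have "rel \<tau> q (s \<bullet> a) (t \<bullet> b)" "rel \<tau> q (t \<bullet> b) (u \<bullet> b)" using Fn.prems q ab unfolding rel.simps(2) by blast+
    then show "rel \<tau> q (s \<bullet> a) (u \<bullet> b)" by (rule Fn.IH(2))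
  qed
qed

lemma rel_left: "rel \<sigma> p s t \<Longrightarrow> rel \<sigma> p s s"
  using rel_sym rel_trans by blast

lemma rel_right: "rel \<sigma> p s t \<Longrightarrow> rel \<sigma> p t t"
  using rel_sym rel_trans by blast

lemma rel_app: "rel (\<sigma> \<rightarrow>\<^sub>t \<tau>) p s t \<Longrightarrow> rel \<sigma> p a b \<Longrightarrow> p \<sqsubseteq> p \<Longrightarrow> rel \<tau> p (s \<bullet> a) (t \<bullet> b)"
  unfolding rel.simps(2) by blast

text \<open>Head reduction is preserved by further application (\<open>hrA\<close>), so the claim
  descends to type 0, where evaluation is closed under it. This is what call-by-name buys: the
  combinator equations hold at all types.\<close>

lemma rel_hr: "hr s s' \<Longrightarrow> rel \<sigma> p s' t \<Longrightarrow> rel \<sigma> p s t"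
proof (induction \<sigma> arbitrary: p s s' t)
  case T0
  then show ?case using ev_hr unfolding rel.simps(1) by meson
next
  case (Fn \<sigma> \<tau>)
  show ?case
    unfolding rel.simps(2)
  proof (intro allI impI)
    fix q a b assume "q \<sqsubseteq> p" "rel \<sigma> q a b"
    then have "rel \<tau> q (s' \<bullet> a) (t \<bullet> b)" using Fn.prems(2) unfolding rel.simps(2) by blast
    then show "rel \<tau> q (s \<bullet> a) (t \<bullet> b)" by (rule Fn.IH(2)[OF hrA[OF Fn.prems(1)]])
  qed
qed

lemma rel_hr2: "hr s s' \<Longrightarrow> hr t t' \<Longrightarrow> rel \<sigma> p s' t' \<Longrightarrow> rel \<sigma> p s t"
  using rel_hr rel_sym by blast

lemma rel_T0I: "(\<And>q. q \<sqsubseteq> p \<Longrightarrow> \<exists>r n. r \<sqsubseteq> q \<and> ev (orc r) s n \<and> ev (orc r) t n) \<Longrightarrow> rel T0 p s t"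
  unfolding rel.simps(1) by blast

lemma rel_T0D: "rel T0 p s t \<Longrightarrow> p \<sqsubseteq> p \<Longrightarrow> \<exists>r n. r \<sqsubseteq> p \<and> ev (orc r) s n \<and> ev (orc r) t n"
  unfolding rel.simps(1) by blast

lemma rel_ev: "ev (orc p) s n \<Longrightarrow> ev (orc p) t n \<Longrightarrow> rel T0 p s t"
  using ev_le le_refl unfolding rel.simps(1) by meson

lemma rel_Num: "rel T0 p (Num n) (Num n)"
  by (rule rel_ev) (rule ev_Num)+

lemma rel_decide:
  assumes "rel T0 p s t" "p \<sqsubseteq> p"
  obtains q n where "q \<sqsubseteq> p" "ev (orc q) s n" "ev (orc q) t n" "rel T0 q s (Num n)" "rel T0 q t (Num n)"
  using rel_T0D[OF assms] rel_ev ev_Num by metis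

lemma rel_Num_eq: "rel T0 p s (Num m) \<Longrightarrow> rel T0 p s (Num n) \<Longrightarrow> p \<sqsubseteq> p \<Longrightarrow> m = n"
  using rel_T0D[of p "Num m" "Num n"] rel_trans[of T0 p "Num m" s "Num n"] rel_sym[of T0 p s "Num m"]
    by (auto elim!: ev_NumE)

section \<open>Every constant is related to itself\<close>

lemma rel_K: "rel (\<sigma> \<rightarrow>\<^sub>t \<tau> \<rightarrow>\<^sub>t \<sigma>) p K K"
  unfolding rel.simps(2) by (intro allI impI rel_hr2[OF hrK hrK]) (rule rel_mono)

lemma rel_S: "rel ((\<delta> \<rightarrow>\<^sub>t \<sigma> \<rightarrow>\<^sub>t \<tau>) \<rightarrow>\<^sub>t (\<delta> \<rightarrow>\<^sub>t \<sigma>) \<rightarrow>\<^sub>t \<delta> \<rightarrow>\<^sub>t \<tau>) p S S"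
proof -
  { fix q a b c d x y q' q'' assume *: "q'' \<sqsubseteq> q'" "q' \<sqsubseteq> q" "rel (\<delta> \<rightarrow>\<^sub>t \<sigma> \<rightarrow>\<^sub>t \<tau>) q a b" "rel (\<delta> \<rightarrow>\<^sub>t \<sigma>) q' c d"
      "rel \<delta> q'' x y"
    have r: "q'' \<sqsubseteq> q''" using * le_refl by blast
    have "rel \<tau> q'' (a \<bullet> x \<bullet> (c \<bullet> x)) (b \<bullet> y \<bullet> (d \<bullet> y))"
      using rel_app[OF rel_app[OF rel_mono[OF *(3) le_trans[OF *(1,2)]] *(5) r] rel_app[OF rel_mono[OF *(4,1)] *(5) r] r] .
    then have "rel \<tau> q'' (S \<bullet> a \<bullet> c \<bullet> x) (S \<bullet> b \<bullet> d \<bullet> y)" by (rule rel_hr2[OF hrS hrS]) }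
  then show ?thesis unfolding rel.simps(2) by blast
qed

lemma rel_Op: "rel (T0 \<rightarrow>\<^sub>t T0 \<rightarrow>\<^sub>t T0) p (Op g) (Op g)"
proof -
  { fix q q' a b c d assume *: "q' \<sqsubseteq> q" "rel T0 q a b" "rel T0 q' c d"
    have "rel T0 q' (Op g \<bullet> a \<bullet> c) (Op g \<bullet> b \<bullet> d)"
    proof (rule rel_T0I)
      fix r assume r: "r \<sqsubseteq> q'"
      obtain s n where s: "s \<sqsubseteq> r" "ev (orc s) a n" "ev (orc s) b n"
        using * r le_trans unfolding rel.simps(1) by meson
      obtain u m where u: "u \<sqsubseteq> s" "ev (orc u) c m" "ev (orc u) d m"
        using * r s le_trans unfolding rel.simps(1) by meson
      have "ev (orc u) a n" "ev (orc u) b n" "u \<sqsubseteq> r" using s u ev_le le_trans by blast+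
      with u show "\<exists>r' n. r' \<sqsubseteq> r \<and> ev (orc r') (Op g \<bullet> a \<bullet> c) n \<and> ev (orc r') (Op g \<bullet> b \<bullet> d) n"
        by (blast intro: ev_Op)
    qed }
  then show ?thesis unfolding rel.simps(2) by blast
qed

lemma rel_Fn0: "p \<sqsubseteq> p \<Longrightarrow> rel T1 p (Fn0 f) (Fn0 f)"
  by (rule rel_app[OF rel_Op rel_Num])

lemma rel_Op_Num: "p \<sqsubseteq> p \<Longrightarrow> rel T0 p a (Num n) \<Longrightarrow> rel T0 p (Op g \<bullet> Num m \<bullet> a) (Num (g m n))"
  using rel_app[OF rel_app[OF rel_Op rel_Num], of p a "Num n" g m]
    rel_ev[of p "Op g \<bullet> Num m \<bullet> Num n" "g m n" "Num (g m n)", OF ev_Op[OF ev_Num ev_Num] ev_Num] rel_trans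
  by blast

lemma rel_R0: "rel T0 p y y \<Longrightarrow> rel T0 p (R \<bullet> Num 0 \<bullet> y \<bullet> z) y"
  unfolding rel.simps(1) by (meson ev_Num ev_R0)

lemma rel_RSuc:
  assumes "rel T0 p (z \<bullet> (R \<bullet> Num n \<bullet> y \<bullet> z) \<bullet> Num n) (z \<bullet> (R \<bullet> Num n \<bullet> y \<bullet> z) \<bullet> Num n)"
  shows "rel T0 p (R \<bullet> Num (Suc n) \<bullet> y \<bullet> z) (z \<bullet> (R \<bullet> Num n \<bullet> y \<bullet> z) \<bullet> Num n)"
  using assms unfolding rel.simps(1) by (meson ev_Num ev_RSuc)

lemma rel_R: "rel (T0 \<rightarrow>\<^sub>t T0 \<rightarrow>\<^sub>t (T0 \<rightarrow>\<^sub>t T0 \<rightarrow>\<^sub>t T0) \<rightarrow>\<^sub>t T0) p R R"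
proof -
  { fix q q1 q2 a b y y' z z'
    assume *: "q2 \<sqsubseteq> q1" "q1 \<sqsubseteq> q" "rel T0 q a b" "rel T0 q1 y y'" "rel (T0 \<rightarrow>\<^sub>t T0 \<rightarrow>\<^sub>t T0) q2 z z'"
    \<comment> \<open>Induction is possible only on a numeral; a general first argument is evaluated
      densely afterwards.\<close>
    have "rel T0 r (R \<bullet> Num n \<bullet> y \<bullet> z) (R \<bullet> Num n \<bullet> y' \<bullet> z')" if r: "r \<sqsubseteq> q2" for r n
    proof (induction n)
      case 0
      have "rel T0 r y y'" using * r rel_mono le_trans by blast
      then have "rel T0 r (R \<bullet> Num 0 \<bullet> y \<bullet> z) y" "rel T0 r y y'" "rel T0 r y' (R \<bullet> Num 0 \<bullet> y' \<bullet> z')"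
        using rel_R0 rel_left rel_right rel_sym by meson+
      then show ?case using rel_trans by meson
    next
      case (Suc n)
      have "rel (T0 \<rightarrow>\<^sub>t T0 \<rightarrow>\<^sub>t T0) r z z'" "r \<sqsubseteq> r" using * r rel_mono le_refl by blast+
      then have "rel T0 r (z \<bullet> (R \<bullet> Num n \<bullet> y \<bullet> z) \<bullet> Num n) (z' \<bullet> (R \<bullet> Num n \<bullet> y' \<bullet> z') \<bullet> Num n)"
        using rel_app[OF rel_app[OF _ Suc] rel_Num] by blast
      then show ?case using rel_RSuc[OF rel_left] rel_RSuc[OF rel_right, THEN rel_sym] rel_trans by meson
    qed
    note 1 = this
    have "rel T0 q2 (R \<bullet> a \<bullet> y \<bullet> z) (R \<bullet> b \<bullet> y' \<bullet> z')"
    proof (rule rel_T0I)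
      fix r assume r: "r \<sqsubseteq> q2"
      obtain s n where s: "s \<sqsubseteq> r" "ev (orc s) a n" "ev (orc s) b n"
        using * r le_trans unfolding rel.simps(1) by meson
      then obtain u m where u: "u \<sqsubseteq> s" "ev (orc u) (R \<bullet> Num n \<bullet> y \<bullet> z) m" "ev (orc u) (R \<bullet> Num n \<bullet> y' \<bullet> z') m"
        using rel_T0D[OF 1[of s n]] r le_trans[OF s(1) r] le_refl[OF s(1)] by blast
      have "ev (orc u) (R \<bullet> c \<bullet> w \<bullet> x) m" if "ev (orc u) c n" "ev (orc u) (R \<bullet> Num n \<bullet> w \<bullet> x) m" for c w x
        using that(2) by (rule ev_RE) (use that(1) in \<open>auto elim!: ev_NumE intro: ev_R0 ev_RSuc\<close>)
      then show "\<exists>r' n. r' \<sqsubseteq> r \<and> ev (orc r') (R \<bullet> a \<bullet> y \<bullet> z) n \<and> ev (orc r') (R \<bullet> b \<bullet> y' \<bullet> z') n"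
        using u s ev_le le_trans by blast
    qed }
  then show ?thesis unfolding rel.simps(2) by blast
qed

text \<open>The fundamental lemma of the logical relation: the constants are self-related, and
  application preserves relatedness.\<close>

lemma rel_cl:
  "wft t \<Longrightarrow> (\<And>x. x \<in> vars t \<Longrightarrow> rel (snd x) p (\<rho> x) (\<rho>' x)) \<Longrightarrow> p \<sqsubseteq> p \<Longrightarrow>
   rel (tyof t) p (cl \<rho> t) (cl \<rho>' t)"
proof (induction t)
  case (App s t)
  then obtain \<tau> where \<tau>: "tyof s = tyof t \<rightarrow>\<^sub>t \<tau>" by auto
  have "rel (tyof s) p (cl \<rho> s) (cl \<rho>' s)" "rel (tyof t) p (cl \<rho> t) (cl \<rho>' t)"
    using App by auto
  then show ?case using rel_app[of "tyof t" \<tau>] App.prems \<tau> by simp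
next
  case CSuc
  show ?case using rel_Fn0[OF CSuc(3)] by simp
next
  case CZero
  show ?case using rel_Num by simp
next
  case (CPi x1 x2)
  then show ?case using rel_K by simp
next
  case (CSig x1 x2 x3)
  then show ?case using rel_S by simp
next
  case CRec
  then show ?case using rel_R by simp
qed auto

text \<open>This is beta reduction for bracket abstraction: each clause produces a \<open>K\<close>
  or \<open>S\<close> redex at the head, so head expansion applies. Admitting \<open>b\<close> in
  place of \<open>a\<close> lets an argument be replaced by its numeral in the same step.\<close>

lemma rel_lam:
  assumes "rel (snd x) p a b" "p \<sqsubseteq> p"
  shows "wft t \<Longrightarrow> (\<And>y. y \<in> vars t \<Longrightarrow> y \<noteq> x \<Longrightarrow> rel (snd y) p (\<rho> y) (\<rho> y)) \<Longrightarrow>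
    rel (tyof t) p (cl \<rho> (lam x t) \<bullet> a) (cl (\<rho>(x := b)) t)"
proof (induction t)
  case (Var y)
  show ?case
  proof (cases "y = x")
    case True
    then show ?thesis using assms
      rel_hr[OF hrS rel_hr[OF hrK]] by simp
  next
    case False
    then show ?thesis using Var rel_hr[OF hrK] by simp
  qed
next
  case (App s t)
  then obtain \<tau> where \<tau>: "tyof s = tyof t \<rightarrow>\<^sub>t \<tau>" by auto
  show ?case
  proof (cases "x \<in> vars s \<union> vars t")
    case True
    have "rel (tyof s) p (cl \<rho> (lam x s) \<bullet> a) (cl (\<rho>(x := b)) s)"
      by (rule App.IH) (use App.prems in auto)
    moreover have "rel (tyof t) p (cl \<rho> (lam x t) \<bullet> a) (cl (\<rho>(x := b)) t)"
      by (rule App.IH) (use App.prems in auto)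
    ultimately have "rel \<tau> p (cl \<rho> (lam x s) \<bullet> a \<bullet> (cl \<rho> (lam x t) \<bullet> a)) (cl (\<rho>(x := b)) (s \<cdot> t))"
      using rel_app[of "tyof t" \<tau>] assms \<tau> by simp
    then show ?thesis using True \<tau> rel_hr[OF hrS] by (simp del: fun_upd_apply)
  next
    case False
    have *: "rel (tyof (s \<cdot> t)) p (cl \<rho> (s \<cdot> t)) (cl (\<rho>(x := b)) (s \<cdot> t))"
      by (rule rel_cl) (use App False assms in auto)
    show ?thesis using rel_hr[OF hrK *] False by (simp del: fun_upd_apply)
  qed
qed (use assms rel_hr[OF hrK] rel_cl[of CZero p \<rho> \<rho>] rel_cl[of CSuc p \<rho> \<rho>] rel_K rel_S rel_R in simp_all)

section \<open>The forcing relation\<close>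

text \<open>No density is written into the clauses: atoms inherit it from \<open>rel\<close>, and
  the other clauses preserve stability. The quantifier ranges over the codes that are objects of the
  type at the extension.\<close>

fun F :: "'p \<Rightarrow> (var \<Rightarrow> code) \<Rightarrow> fm \<Rightarrow> bool" where
  "F p \<rho> (s \<^bold>= t) \<longleftrightarrow> rel T0 p (cl \<rho> s) (cl \<rho> t)"
| "F p \<rho> \<^bold>\<bottom> \<longleftrightarrow> False"
| "F p \<rho> (\<phi> \<^bold>\<longrightarrow> \<psi>) \<longleftrightarrow> (\<forall>q. q \<sqsubseteq> p \<longrightarrow> F q \<rho> \<phi> \<longrightarrow> F q \<rho> \<psi>)"
| "F p \<rho> (\<^bold>\<forall>x. \<phi>) \<longleftrightarrow> (\<forall>q a. q \<sqsubseteq> p \<longrightarrow> rel (snd x) q a a \<longrightarrow> F q (\<rho>(x := a)) \<phi>)"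

declare F.simps(3,4) [simp del]
declare fun_upd_apply [simp del] fun_upd_same [simp] fun_upd_other [simp]

lemma F_ImpI: "(\<And>q. q \<sqsubseteq> p \<Longrightarrow> F q \<rho> \<phi> \<Longrightarrow> F q \<rho> \<psi>) \<Longrightarrow> F p \<rho> (\<phi> \<^bold>\<longrightarrow> \<psi>)"
  by (simp add: F.simps)

lemma F_ImpD: "F p \<rho> (\<phi> \<^bold>\<longrightarrow> \<psi>) \<Longrightarrow> q \<sqsubseteq> p \<Longrightarrow> F q \<rho> \<phi> \<Longrightarrow> F q \<rho> \<psi>"
  by (simp add: F.simps)

lemma F_AllI: "(\<And>q a. q \<sqsubseteq> p \<Longrightarrow> rel (snd x) q a a \<Longrightarrow> F q (\<rho>(x := a)) \<phi>) \<Longrightarrow> F p \<rho> (\<^bold>\<forall>x. \<phi>)"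
  by (simp add: F.simps)

lemma F_AllD: "F p \<rho> (\<^bold>\<forall>x. \<phi>) \<Longrightarrow> q \<sqsubseteq> p \<Longrightarrow> rel (snd x) q a a \<Longrightarrow> F q (\<rho>(x := a)) \<phi>"
  by (simp add: F.simps)

lemma F_mono: "F p \<rho> \<phi> \<Longrightarrow> q \<sqsubseteq> p \<Longrightarrow> F q \<rho> \<phi>"
  by (cases \<phi>) (auto simp: F.simps intro: rel_mono le_trans)

text \<open>This validates double negation elimination. The premise \<open>p \<sqsubseteq> p\<close>
  serves falsum: below a pair without extensions the density hypothesis would be vacuous.\<close>

lemma F_stable: "p \<sqsubseteq> p \<Longrightarrow> (\<And>q. q \<sqsubseteq> p \<Longrightarrow> \<exists>r. r \<sqsubseteq> q \<and> F r \<rho> \<phi>) \<Longrightarrow> F p \<rho> \<phi>"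
proof (induction \<phi> arbitrary: p \<rho>)
  case (Eq s t)
  then show ?case by (auto intro!: rel_stable)
next
  case (Imp \<phi> \<psi>)
  show ?case
  proof (rule F_ImpI)
    fix q assume q: "q \<sqsubseteq> p" "F q \<rho> \<phi>"
    show "F q \<rho> \<psi>"
    proof (rule Imp.IH(2))
      fix r assume r: "r \<sqsubseteq> q"
      then obtain s where "s \<sqsubseteq> r" "F s \<rho> (\<phi> \<^bold>\<longrightarrow> \<psi>)" using Imp.prems q le_trans by blast
      then show "\<exists>s. s \<sqsubseteq> r \<and> F s \<rho> \<psi>" using F_ImpD F_mono q r le_refl le_trans by blast
    qed (use q le_refl in blast)
  qed
next
  case (Forall x \<phi>)
  show ?case
  proof (rule F_AllI)
    fix q a assume q: "q \<sqsubseteq> p" "rel (snd x) q a a"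
    show "F q (\<rho>(x := a)) \<phi>"
    proof (rule Forall.IH)
      fix r assume r: "r \<sqsubseteq> q"
      then obtain s where "s \<sqsubseteq> r" "F s \<rho> (\<^bold>\<forall>x. \<phi>)" using Forall.prems q le_trans by blast
      then show "\<exists>s. s \<sqsubseteq> r \<and> F s (\<rho>(x := a)) \<phi>" using F_AllD rel_mono q r le_refl le_trans by blast
    qed (use q le_refl in blast)
  qed
qed (auto)

lemma F_Neg: "F p \<rho> (\<^bold>\<not> \<phi>) \<longleftrightarrow> (\<forall>q. q \<sqsubseteq> p \<longrightarrow> \<not> F q \<rho> \<phi>)"
  by (simp add: F.simps)

text \<open>Conjunction abbreviates a formula with negations; stability restores its componentwise
  reading.\<close>

lemma F_Conj: "p \<sqsubseteq> p \<Longrightarrow> F p \<rho> (\<phi> \<^bold>\<and> \<psi>) \<longleftrightarrow> F p \<rho> \<phi> \<and> F p \<rho> \<psi>"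
proof
  assume p: "p \<sqsubseteq> p" and *: "F p \<rho> (\<phi> \<^bold>\<and> \<psi>)"
  have "\<exists>r. r \<sqsubseteq> q \<and> F r \<rho> \<phi> \<and> F r \<rho> \<psi>" if q: "q \<sqsubseteq> p" for q
  proof -
    have "\<not> F q \<rho> (\<phi> \<^bold>\<longrightarrow> \<^bold>\<not> \<psi>)" using q * unfolding F_Neg by blast
    then obtain r where r: "r \<sqsubseteq> q" "F r \<rho> \<phi>" "\<not> F r \<rho> (\<^bold>\<not> \<psi>)" unfolding F.simps(3)[of q] by blast
    then show ?thesis unfolding F_Neg using F_mono le_trans by blast
  qed
  then show "F p \<rho> \<phi> \<and> F p \<rho> \<psi>" using p by (meson F_stable)
next
  assume "p \<sqsubseteq> p" "F p \<rho> \<phi> \<and> F p \<rho> \<psi>"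
  then show "F p \<rho> (\<phi> \<^bold>\<and> \<psi>)"
    unfolding F_Neg F.simps(3)[of _ _ \<phi>] using F_mono le_refl by metis
qed

text \<open>The existential quantifier abbreviates a negated universal one, so a witness appears
  only after extending the condition.\<close>

lemma F_ExD: "F p \<rho> (\<^bold>\<exists>x. \<phi>) \<Longrightarrow> q \<sqsubseteq> p \<Longrightarrow> \<exists>r a. r \<sqsubseteq> q \<and> rel (snd x) r a a \<and> F r (\<rho>(x := a)) \<phi>"
  unfolding F_Neg F.simps(4) using le_trans rel_mono by blast

lemma F_ExI:
  assumes "\<And>q. q \<sqsubseteq> p \<Longrightarrow> \<exists>r a. r \<sqsubseteq> q \<and> rel (snd x) r a a \<and> F r (\<rho>(x := a)) \<phi>"
  shows "F p \<rho> (\<^bold>\<exists>x. \<phi>)"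
  unfolding F_Neg
proof (intro allI impI notI)
  fix q assume q: "q \<sqsubseteq> p" and n: "F q \<rho> (\<^bold>\<forall>x. \<^bold>\<not> \<phi>)"
  obtain r a where r: "r \<sqsubseteq> q" "rel (snd x) r a a" "F r (\<rho>(x := a)) \<phi>" using assms[OF q] by blast
  then have "F r (\<rho>(x := a)) (\<^bold>\<not> \<phi>)" using F_AllD n by blast
  then show False unfolding F_Neg using r le_refl by blast
qed

lemma F_coinc: "(\<And>x. x \<in> fvs \<phi> \<Longrightarrow> \<rho> x = \<rho>' x) \<Longrightarrow> F p \<rho> \<phi> \<longleftrightarrow> F p \<rho>' \<phi>"
proof (induction \<phi> arbitrary: p \<rho> \<rho>')
  case (Eq s t)
  then show ?case using cl_cong[of s \<rho> \<rho>'] cl_cong[of t \<rho> \<rho>'] by simp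
next
  case (Imp \<phi> \<psi>)
  have "F q \<rho> \<phi> \<longleftrightarrow> F q \<rho>' \<phi>" "F q \<rho> \<psi> \<longleftrightarrow> F q \<rho>' \<psi>" for q
    by (rule Imp.IH; use Imp.prems in simp)+
  then show ?case by (simp add: F.simps)
next
  case (Forall x \<phi>)
  have "F q (\<rho>(x := a)) \<phi> \<longleftrightarrow> F q (\<rho>'(x := a)) \<phi>" for q a
    by (rule Forall.IH) (use Forall.prems in \<open>auto simp: fun_upd_apply\<close>)
  then show ?case by (simp add: F.simps)
qed auto

lemma F_subst: "free_for u x \<phi> \<Longrightarrow> F p \<rho> (subst x u \<phi>) \<longleftrightarrow> F p (\<rho>(x := cl \<rho> u)) \<phi>"
proof (induction \<phi> arbitrary: p \<rho>)
  case (Forall y \<phi>)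
  show ?case
  proof (cases "x \<in> fvs (\<^bold>\<forall>y. \<phi>)")
    case False
    then show ?thesis
      unfolding subst_id[OF False] by (intro F_coinc) (use False in \<open>auto simp: fun_upd_apply\<close>)
  next
    case True
    then have y: "y \<noteq> x" "y \<notin> vars u" "free_for u x \<phi>" using Forall.prems by auto
    have "F q (\<rho>(y := a)) (subst x u \<phi>) \<longleftrightarrow> F q (\<rho>(x := cl \<rho> u, y := a)) \<phi>" for q a
      using Forall.IH[of q "\<rho>(y := a)"] y by (simp add: fun_upd_twist)
    then show ?thesis using y by (simp add: F.simps)
  qed
qed (auto simp: cl_substt F.simps(3))

text \<open>Atoms are handled by \<open>rel_cl\<close>, and the symmetry of \<open>rel\<close>
  handles premises of implications. Its use is to replace arbitrary codes by numerals and ground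
  functions once they are decided.\<close>

lemma F_cong:
  "wff \<phi> \<Longrightarrow> (\<And>x. x \<in> fvs \<phi> \<Longrightarrow> rel (snd x) p (\<rho> x) (\<rho>' x)) \<Longrightarrow> p \<sqsubseteq> p \<Longrightarrow> F p \<rho> \<phi> \<Longrightarrow> F p \<rho>' \<phi>"
proof (induction \<phi> arbitrary: p \<rho> \<rho>')
  case (Eq s t)
  have "rel T0 p (cl \<rho> s) (cl \<rho>' s)" "rel T0 p (cl \<rho> t) (cl \<rho>' t)"
    using rel_cl[of s p \<rho> \<rho>'] rel_cl[of t p \<rho> \<rho>'] Eq.prems by auto
  then show ?case using Eq.prems(4) rel_trans rel_sym unfolding F.simps by blast
next
  case (Imp \<phi> \<psi>)
  show ?case
  proof (rule F_ImpI)
    fix q assume q: "q \<sqsubseteq> p" "F q \<rho>' \<phi>"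
    have r: "rel (snd x) q (\<rho> x) (\<rho>' x)" if "x \<in> fvs \<phi> \<union> fvs \<psi>" for x
      using Imp.prems(2)[of x] that q(1) rel_mono by simp
    have "q \<sqsubseteq> q" using q le_refl by blast
    then have "F q \<rho> \<phi>" using Imp.IH(1)[of q \<rho>' \<rho>] r rel_sym q(2) Imp.prems(1) by simp
    then have "F q \<rho> \<psi>" using Imp.prems(4) q F_ImpD by blast
    then show "F q \<rho>' \<psi>" using Imp.IH(2)[of q \<rho> \<rho>'] r \<open>q \<sqsubseteq> q\<close> Imp.prems(1) by simp
  qed
next
  case (Forall x \<phi>)
  show ?case
  proof (rule F_AllI)
    fix q a assume q: "q \<sqsubseteq> p" "rel (snd x) q a a"
    have "F q (\<rho>(x := a)) \<phi>" using Forall.prems(4) q F_AllD by blast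
    moreover have "rel (snd y) q ((\<rho>(x := a)) y) ((\<rho>'(x := a)) y)" if "y \<in> fvs \<phi>" for y
      by (cases "y = x") (use Forall.prems(2)[of y] that q rel_mono in auto)
    ultimately show "F q (\<rho>'(x := a)) \<phi>"
      using Forall.IH[of q "\<rho>(x := a)" "\<rho>'(x := a)"] Forall.prems(1) le_refl[OF q(1)] by simp
  qed
qed simp

section \<open>Soundness of the calculus\<close>

definition good :: "'p \<Rightarrow> (var \<Rightarrow> code) \<Rightarrow> bool" where
  "good p \<rho> \<longleftrightarrow> (\<forall>x. rel (snd x) p (\<rho> x) (\<rho> x))"

lemma goodD: "good p \<rho> \<Longrightarrow> snd x = \<sigma> \<Longrightarrow> rel \<sigma> p (\<rho> x) (\<rho> x)"
  unfolding good_def by blast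

lemma good_mono: "good p \<rho> \<Longrightarrow> q \<sqsubseteq> p \<Longrightarrow> good q \<rho>"
  unfolding good_def using rel_mono by blast

lemma good_upd: "good p \<rho> \<Longrightarrow> rel (snd x) p a a \<Longrightarrow> good p (\<rho>(x := a))"
  unfolding good_def by (metis fun_upd_apply)

lemma good_cl: "good p \<rho> \<Longrightarrow> wft t \<Longrightarrow> tyof t = \<sigma> \<Longrightarrow> p \<sqsubseteq> p \<Longrightarrow> rel \<sigma> p (cl \<rho> t) (cl \<rho> t)"
  using rel_cl goodD by blast

lemma F_cong_upd:
  assumes "wff \<phi>" "good p \<rho>" "rel (snd x) p a b" "p \<sqsubseteq> p" "F p (\<rho>(x := a)) \<phi>"
  shows "F p (\<rho>(x := b)) \<phi>"
proof (rule F_cong[OF assms(1) _ assms(4,5)])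
  show "rel (snd y) p ((\<rho>(x := a)) y) ((\<rho>(x := b)) y)" for y
    by (cases "y = x") (simp_all add: assms goodD)
qed

definition forced :: "fm \<Rightarrow> bool" where
  "forced \<phi> \<longleftrightarrow> (\<forall>p \<rho>. p \<sqsubseteq> p \<longrightarrow> good p \<rho> \<longrightarrow> F p \<rho> \<phi>)"

lemma forcedI: "(\<And>p \<rho>. p \<sqsubseteq> p \<Longrightarrow> good p \<rho> \<Longrightarrow> F p \<rho> \<phi>) \<Longrightarrow> forced \<phi>"
  by (simp add: forced_def)

lemma forcedD: "forced \<phi> \<Longrightarrow> p \<sqsubseteq> p \<Longrightarrow> good p \<rho> \<Longrightarrow> F p \<rho> \<phi>"
  by (simp add: forced_def)

theorem soundness: "T \<turnstile> \<phi> \<Longrightarrow> (\<And>\<psi>. \<psi> \<in> T \<Longrightarrow> forced \<psi>) \<Longrightarrow> forced \<phi>"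
proof (induction rule: proves.induct)
  case (PropK \<phi> \<psi>)
  show ?case by (intro forcedI F_ImpI) (rule F_mono)
next
  case (PropS \<phi> \<psi> \<chi>)
  show ?case
    by (intro forcedI F_ImpI) (meson F_ImpD le_refl le_trans)
next
  case (DNeg \<phi>)
  show ?case
  proof (intro forcedI F_ImpI)
    fix p \<rho> q assume "q \<sqsubseteq> p" "F q \<rho> (\<^bold>\<not> \<^bold>\<not> \<phi>)"
    then show "F q \<rho> \<phi>" unfolding F_Neg by (meson F_stable le_refl)
  qed
next
  case (Inst \<phi> t x)
  show ?case
  proof (intro forcedI F_ImpI)
    fix p \<rho> q assume "good p \<rho>" "q \<sqsubseteq> p" "F q \<rho> (\<^bold>\<forall>x. \<phi>)"
    then show "F q \<rho> (subst x t \<phi>)"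
      unfolding F_subst[OF Inst(4)]
      using F_AllD[of q \<rho> x \<phi> q] good_cl[OF good_mono Inst(2,3)] le_refl by blast
  qed
next
  case (Distr \<phi> \<psi> x)
  show ?case
  proof (intro forcedI F_ImpI F_AllI)
    fix p \<rho> q r s a assume *: "q \<sqsubseteq> p" "F q \<rho> (\<^bold>\<forall>x. \<phi> \<^bold>\<longrightarrow> \<psi>)" "r \<sqsubseteq> q" "F r \<rho> \<phi>" "s \<sqsubseteq> r" "rel (snd x) s a a"
    have "F s (\<rho>(x := a)) \<phi>"
      using F_coinc[of \<phi> \<rho> "\<rho>(x := a)"] Distr(3) F_mono[OF *(4,5)] by (metis fun_upd_other)
    moreover have "F s (\<rho>(x := a)) (\<phi> \<^bold>\<longrightarrow> \<psi>)" using F_AllD * le_trans by blast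
    ultimately show "F s (\<rho>(x := a)) \<psi>" using F_ImpD le_refl[OF *(5)] by blast
  qed
next
  case (MP \<phi> \<psi>)
  then show ?case unfolding forced_def by (meson F_ImpD)
next
  case (Gen \<phi> x)
  then show ?case
    unfolding forced_def by (meson F_AllI good_mono good_upd le_refl)
qed auto

text \<open>The formula feeds one and the same argument to both sides, whereas \<open>rel\<close>
  feeds two related ones; the self-relatedness of \<open>t\<close> bridges the gap. With this the
  extensionality axiom becomes an instance of \<open>rel_app\<close>.\<close>

lemma F_heq:
  "wft s \<Longrightarrow> wft t \<Longrightarrow> tyof s = \<sigma> \<Longrightarrow> tyof t = \<sigma> \<Longrightarrow> good p \<rho> \<Longrightarrow> p \<sqsubseteq> p \<Longrightarrow>
   F p \<rho> (heq \<sigma> s t) \<longleftrightarrow> rel \<sigma> p (cl \<rho> s) (cl \<rho> t)"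
proof (induction \<sigma> s t arbitrary: p \<rho> rule: heq.induct)
  case (2 \<sigma> \<tau> s t)
  define z where "z = (max (fresh s) (fresh t), \<sigma>)"
  have z: "z \<notin> vars s" "z \<notin> vars t" "snd z = \<sigma>" by (simp_all add: z_def fresh_vars)
  have heq: "heq (\<sigma> \<rightarrow>\<^sub>t \<tau>) s t = (\<^bold>\<forall>z. heq \<tau> (s \<cdot> Var z) (t \<cdot> Var z))"
    by (simp add: z_def Let_def)
  have IH: "F q (\<rho>(z := a)) (heq \<tau> (s \<cdot> Var z) (t \<cdot> Var z)) \<longleftrightarrow> rel \<tau> q (cl \<rho> s \<bullet> a) (cl \<rho> t \<bullet> a)"
    if "q \<sqsubseteq> p" "rel \<sigma> q a a" for q a
  proof -
    have "good q (\<rho>(z := a))" using that z good_mono[OF 2(6)] good_upd by simp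
    then show ?thesis
      using 2(1)[OF z_def, of q "\<rho>(z := a)"] 2(2-5) z le_refl[OF that(1)] by simp
  qed
  have t: "rel (\<sigma> \<rightarrow>\<^sub>t \<tau>) p (cl \<rho> t) (cl \<rho> t)" using good_cl 2 by blast
  show ?case
    unfolding heq F.simps(4) rel.simps(2) z(3)
  proof (intro iffI allI impI)
    fix q a b
    assume *: "\<forall>q a. q \<sqsubseteq> p \<longrightarrow> rel \<sigma> q a a \<longrightarrow> F q (\<rho>(z := a)) (heq \<tau> (s \<cdot> Var z) (t \<cdot> Var z))"
      and q: "q \<sqsubseteq> p" and ab: "rel \<sigma> q a b"
    have "rel \<tau> q (cl \<rho> s \<bullet> a) (cl \<rho> t \<bullet> a)" using * IH q rel_left[OF ab] by blast
    moreover have "rel \<tau> q (cl \<rho> t \<bullet> a) (cl \<rho> t \<bullet> b)" using t q ab unfolding rel.simps(2) by blast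
    ultimately show "rel \<tau> q (cl \<rho> s \<bullet> a) (cl \<rho> t \<bullet> b)" by (rule rel_trans)
  next
    fix q a assume "\<forall>q a b. q \<sqsubseteq> p \<longrightarrow> rel \<sigma> q a b \<longrightarrow> rel \<tau> q (cl \<rho> s \<bullet> a) (cl \<rho> t \<bullet> b)"
      "q \<sqsubseteq> p" "rel \<sigma> q a a"
    then show "F q (\<rho>(z := a)) (heq \<tau> (s \<cdot> Var z) (t \<cdot> Var z))" using IH by blast
  qed
qed simp

section \<open>The axioms of the base theory\<close>

lemma forced_induction:
  assumes \<phi>: "wff \<phi>" "qf \<phi>" and n: "n = (i, T0)"
  shows "forced (subst n CZero \<phi> \<^bold>\<and> (\<^bold>\<forall>n. \<phi> \<^bold>\<longrightarrow> subst n (CSuc \<cdot> Var n) \<phi>) \<^bold>\<longrightarrow> (\<^bold>\<forall>n. \<phi>))"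
proof (intro forcedI F_ImpI F_AllI)
  fix p \<rho> q r a
  assume \<rho>: "good p \<rho>" and q: "q \<sqsubseteq> p" and r: "r \<sqsubseteq> q" and a: "rel (snd n) r a a"
    and H: "F q \<rho> (subst n CZero \<phi> \<^bold>\<and> (\<^bold>\<forall>n. \<phi> \<^bold>\<longrightarrow> subst n (CSuc \<cdot> Var n) \<phi>))"
  have qq: "q \<sqsubseteq> q" using q le_refl by blast
  note H = H[unfolded F_Conj[OF qq]]
  \<comment> \<open>Numerals come first, by induction in the metatheory; an arbitrary code of type 0
    is densely related to a numeral.\<close>
  have step: "F s (\<rho>(n := Num k)) \<phi>" if s: "s \<sqsubseteq> q" for s k
  proof (induction k)
    case 0
    show ?case using H F_subst[OF qf_free_for[OF \<phi>(2)], of q \<rho> n CZero] F_mono[OF _ s] by simp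
  next
    case (Suc k)
    have ss: "s \<sqsubseteq> s" using s le_refl by blast
    have g: "good s \<rho>" using \<rho> good_mono q s by blast
    have "F s (\<rho>(n := Num k)) (\<phi> \<^bold>\<longrightarrow> subst n (CSuc \<cdot> Var n) \<phi>)"
      using H F_AllD s rel_Num n by auto
    then have "F s (\<rho>(n := Num k)) (subst n (CSuc \<cdot> Var n) \<phi>)" using Suc ss F_ImpD by blast
    then have "F s (\<rho>(n := Op (\<lambda>_ n. Suc n) \<bullet> Num 0 \<bullet> Num k)) \<phi>"
      unfolding F_subst[OF qf_free_for[OF \<phi>(2)]] by simp
    moreover have "rel (snd n) s (Op (\<lambda>_ n. Suc n) \<bullet> Num 0 \<bullet> Num k) (Num (Suc k))"
      using rel_Op_Num[OF ss rel_Num, of "\<lambda>_ n. Suc n"] n by simp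
    ultimately show ?case by (rule F_cong_upd[OF \<phi>(1) g _ ss, rotated])
  qed
  show "F r (\<rho>(n := a)) \<phi>"
  proof (rule F_stable)
    fix s assume s: "s \<sqsubseteq> r"
    have "rel T0 s a a" "s \<sqsubseteq> s" using a n rel_mono[OF _ s] le_refl s by auto
    then obtain u k where u: "u \<sqsubseteq> s" "rel T0 u a (Num k)" using rel_decide by metis
    have "F u (\<rho>(n := Num k)) \<phi>" using step u s r le_trans by blast
    moreover have "good u \<rho>" "u \<sqsubseteq> u" using \<rho> u s r q good_mono le_trans le_refl by blast+
    ultimately have "F u (\<rho>(n := a)) \<phi>" using F_cong_upd[OF \<phi>(1)] rel_sym[OF u(2)] n by simp
    then show "\<exists>u. u \<sqsubseteq> s \<and> F u (\<rho>(n := a)) \<phi>" using u by blast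
  qed (use r le_refl in blast)
qed

lemma forced_suc_inject: "forced (CSuc \<cdot> \<v> 0 T0 \<^bold>= CSuc \<cdot> \<v> 1 T0 \<^bold>\<longrightarrow> \<v> 0 T0 \<^bold>= \<v> 1 T0)"
proof (intro forcedI F_ImpI)
  fix p \<rho> q assume \<rho>: "good p \<rho>" "q \<sqsubseteq> p" and H: "F q \<rho> (CSuc \<cdot> \<v> 0 T0 \<^bold>= CSuc \<cdot> \<v> 1 T0)"
  let ?S = "\<lambda>a. Op (\<lambda>_ n. Suc n) \<bullet> Num 0 \<bullet> a"
  let ?a = "\<rho> (0, T0)" and ?b = "\<rho> (1, T0)"
  have "rel T0 q ?a ?b"
  proof (rule rel_stable)
    fix r assume r: "r \<sqsubseteq> q"
    have "r \<sqsubseteq> r" "rel T0 r ?a ?a"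
      using \<rho> r le_refl goodD[OF good_mono[OF good_mono[OF \<rho>] r]] by auto
    then obtain s m where s: "s \<sqsubseteq> r" "rel T0 s ?a (Num m)" by (metis rel_decide)
    have "s \<sqsubseteq> s" "rel T0 s ?b ?b"
      using \<rho> r s le_refl goodD[OF good_mono[OF good_mono[OF good_mono[OF \<rho>] r] s(1)]] by auto
    then obtain u n where u: "u \<sqsubseteq> s" "rel T0 u ?b (Num n)" by (metis rel_decide)
    have uu: "u \<sqsubseteq> u" and um: "rel T0 u ?a (Num m)" using u s le_refl rel_mono by blast+
    have "rel T0 u (?S ?a) (?S ?b)" using H rel_mono[OF _ le_trans[OF u(1) le_trans[OF s(1) r]]] by simp
    moreover have "rel T0 u (?S ?a) (Num (Suc m))" "rel T0 u (?S ?b) (Num (Suc n))"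
      using rel_Op_Num[OF uu um] rel_Op_Num[OF uu u(2)] by blast+
    ultimately have "Suc m = Suc n" using rel_Num_eq uu rel_trans by blast
    then show "\<exists>u. u \<sqsubseteq> r \<and> rel T0 u ?a ?b" using um u s le_trans rel_trans rel_sym by blast
  qed
  then show "F q \<rho> (\<v> 0 T0 \<^bold>= \<v> 1 T0)" by simp
qed

lemma forced_suc_not_zero: "forced (\<^bold>\<not> CSuc \<cdot> \<v> 0 T0 \<^bold>= CZero)"
proof (intro forcedI F_ImpI)
  fix p \<rho> q assume \<rho>: "good p \<rho>" "q \<sqsubseteq> p" and H: "F q \<rho> (CSuc \<cdot> \<v> 0 T0 \<^bold>= CZero)"
  let ?S = "\<lambda>a. Op (\<lambda>_ n. Suc n) \<bullet> Num 0 \<bullet> a"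
  have "q \<sqsubseteq> q" "rel T0 q (\<rho> (0, T0)) (\<rho> (0, T0))" using \<rho> le_refl goodD[OF good_mono[OF \<rho>]] by auto
  then obtain s m where s: "s \<sqsubseteq> q" "rel T0 s (\<rho> (0, T0)) (Num m)" by (metis rel_decide)
  have ss: "s \<sqsubseteq> s" using s le_refl by blast
  have "rel T0 s (?S (\<rho> (0, T0))) (Num 0)" using H rel_mono[OF _ s(1)] by simp
  then have "Suc m = 0" using rel_Num_eq ss rel_Op_Num[OF ss s(2)] by blast
  then show "F q \<rho> \<^bold>\<bottom>" by simp
qed

lemma forced_Rec_Suc:
  assumes "x = \<v> 0 T0" "y = \<v> 1 T0" "z = \<v> 2 (T0 \<rightarrow>\<^sub>t T0 \<rightarrow>\<^sub>t T0)"
  shows "forced (CRec \<cdot> (CSuc \<cdot> x) \<cdot> y \<cdot> z \<^bold>= z \<cdot> (CRec \<cdot> x \<cdot> y \<cdot> z) \<cdot> x)"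
proof (rule forcedI)
  fix p \<rho> assume p: "p \<sqsubseteq> p" and \<rho>: "good p \<rho>"
  let ?S = "\<lambda>a. Op (\<lambda>_ n. Suc n) \<bullet> Num 0 \<bullet> a"
  let ?x = "cl \<rho> x" and ?y = "cl \<rho> y" and ?z = "cl \<rho> z"
  have "rel T0 p (R \<bullet> ?S ?x \<bullet> ?y \<bullet> ?z) (?z \<bullet> (R \<bullet> ?x \<bullet> ?y \<bullet> ?z) \<bullet> ?x)"
  proof (rule rel_stable)
    fix q assume q: "q \<sqsubseteq> p"
    have qq: "q \<sqsubseteq> q" using q le_refl by blast
    have "rel T0 q ?x ?x"
      by (rule good_cl[OF good_mono[OF \<rho> q]]) (use qq assms in simp_all)
    then obtain r n where r: "r \<sqsubseteq> q" "rel T0 r ?x (Num n)" using rel_decide qq by metis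
    have rr: "r \<sqsubseteq> r" and g: "good r \<rho>" using r q \<rho> le_refl good_mono by blast+
    have y: "rel T0 r ?y ?y" by (rule good_cl[OF g]) (use rr assms in simp_all)
    have z: "rel (T0 \<rightarrow>\<^sub>t T0 \<rightarrow>\<^sub>t T0) r ?z ?z" by (rule good_cl[OF g]) (use rr assms in simp_all)
    note R = rel_app[OF rel_app[OF rel_app[OF rel_R _ rr] y rr] z rr]
    have 1: "rel T0 r (R \<bullet> ?S ?x \<bullet> ?y \<bullet> ?z) (R \<bullet> Num (Suc n) \<bullet> ?y \<bullet> ?z)"
      by (rule R) (rule rel_Op_Num[OF rr r(2)])
    have 2: "rel T0 r (?z \<bullet> (R \<bullet> Num n \<bullet> ?y \<bullet> ?z) \<bullet> Num n) (?z \<bullet> (R \<bullet> ?x \<bullet> ?y \<bullet> ?z) \<bullet> ?x)"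
      by (intro rel_app[OF rel_app[OF z _ rr] _ rr] R rel_sym[OF r(2)])
    show "\<exists>r. r \<sqsubseteq> q \<and> rel T0 r (R \<bullet> ?S ?x \<bullet> ?y \<bullet> ?z) (?z \<bullet> (R \<bullet> ?x \<bullet> ?y \<bullet> ?z) \<bullet> ?x)"
      using r 1 2 rel_RSuc[OF rel_left[OF 2]] rel_trans by blast
  qed
  then show "F p \<rho> (CRec \<cdot> (CSuc \<cdot> x) \<cdot> y \<cdot> z \<^bold>= z \<cdot> (CRec \<cdot> x \<cdot> y \<cdot> z) \<cdot> x)" by simp
qed

lemma forced_extensionality:
  assumes "x = \<v> 0 \<sigma>" "y = \<v> 1 \<sigma>" "z = \<v> 2 (\<sigma> \<rightarrow>\<^sub>t \<tau>)"
  shows "forced (heq \<sigma> x y \<^bold>\<longrightarrow> heq \<tau> (z \<cdot> x) (z \<cdot> y))"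
proof (intro forcedI F_ImpI)
  fix p \<rho> q assume \<rho>: "good p \<rho>" "q \<sqsubseteq> p" and H: "F q \<rho> (heq \<sigma> x y)"
  have q: "q \<sqsubseteq> q" and g: "good q \<rho>" using \<rho> le_refl good_mono by blast+
  have "rel \<sigma> q (cl \<rho> x) (cl \<rho> y)" using H F_heq g q assms by simp
  moreover have "rel (\<sigma> \<rightarrow>\<^sub>t \<tau>) q (cl \<rho> z) (cl \<rho> z)" by (rule good_cl[OF g]) (use q assms in simp_all)
  ultimately have "rel \<tau> q (cl \<rho> (z \<cdot> x)) (cl \<rho> (z \<cdot> y))" using rel_app q by simp
  then show "F q \<rho> (heq \<tau> (z \<cdot> x) (z \<cdot> y))" using F_heq g q assms by simp
qed

text \<open>The choice schema stays a hypothesis because its proof needs fusion, which an abstract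
  forcing order does not provide.\<close>

lemma forced_RCA:
  assumes "\<phi> \<in> RCA0\<omega>"
    and AC: "\<And>\<phi> f n \<Phi> i j k. wff \<phi> \<Longrightarrow> qf \<phi> \<Longrightarrow> f = (i, T1) \<Longrightarrow> n = (j, T0) \<Longrightarrow> \<Phi> = (k, T2) \<Longrightarrow> \<Phi> \<notin> fvs \<phi> \<Longrightarrow>
      forced ((\<^bold>\<forall>f. \<^bold>\<exists>n. \<phi>) \<^bold>\<longrightarrow> (\<^bold>\<exists>\<Phi>. \<^bold>\<forall>f. subst n (Var \<Phi> \<cdot> Var f) \<phi>))"
  shows "forced \<phi>"
  using assms(1)
proof (cases rule: RCA0\<omega>.cases)
  case eq_refl
  then show ?thesis by (auto intro!: forcedI goodD)
next
  case eq_sym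
  show ?thesis
    unfolding eq_sym by (intro forcedI F_ImpI) (simp add: rel_sym)
next
  case eq_trans
  show ?thesis
    unfolding eq_trans
  proof (intro forcedI F_ImpI)
    fix p \<rho> q r assume "F q \<rho> (\<v> 0 T0 \<^bold>= \<v> 1 T0)" "r \<sqsubseteq> q" "F r \<rho> (\<v> 1 T0 \<^bold>= \<v> 2 T0)"
    then show "F r \<rho> (\<v> 0 T0 \<^bold>= \<v> 2 T0)" using rel_mono rel_trans unfolding F.simps by blast
  qed
next
  case (Pi \<rho> \<tau>)
  show ?thesis
  proof (rule forcedI)
    fix p \<eta> assume p: "p \<sqsubseteq> p" and g: "good p \<eta>"
    have "rel \<rho> p (K \<bullet> \<eta> (0, \<rho>) \<bullet> \<eta> (1, \<tau>)) (\<eta> (0, \<rho>))"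
      by (rule rel_hr[OF hrK]) (use goodD g in simp)
    then show "F p \<eta> \<phi>" using Pi F_heq p g by simp
  qed
next
  case (Sig x \<delta> \<rho> \<tau> y z)
  show ?thesis
  proof (rule forcedI)
    fix p \<eta> assume p: "p \<sqsubseteq> p" and g: "good p \<eta>"
    have "rel \<tau> p (cl \<eta> (x \<cdot> z \<cdot> (y \<cdot> z))) (cl \<eta> (x \<cdot> z \<cdot> (y \<cdot> z)))"
      by (rule good_cl[OF g]) (use Sig p in simp_all)
    then have "rel \<tau> p (S \<bullet> cl \<eta> x \<bullet> cl \<eta> y \<bullet> cl \<eta> z) (cl \<eta> (x \<cdot> z \<cdot> (y \<cdot> z)))"
      using rel_hr[OF hrS] by simp
    then show "F p \<eta> \<phi>" using Sig F_heq p g by simp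
  qed
next
  case (Rec_0 y z)
  then show ?thesis by (auto intro!: forcedI rel_R0 goodD)
next
  case (QF_AC_1_0 \<phi> f i n j \<Phi> k)
  then show ?thesis using AC[of \<phi> f i n j \<Phi> k] by simp
next
  case suc_not_zero
  then show ?thesis using forced_suc_not_zero by simp
next
  case suc_inject
  then show ?thesis using forced_suc_inject by simp
next
  case (Rec_Suc x y z)
  then show ?thesis using forced_Rec_Suc by simp
next
  case (QF_induction \<phi> n i)
  then show ?thesis using forced_induction by simp
next
  case (extensionality x \<rho> y z \<tau>)
  then show ?thesis using forced_extensionality by simp
qed

end

section \<open>Arithmetic in the forcing relation\<close>

text \<open>These functions follow the recursions of the coding terms clause by clause, so that the
  values of the terms can be read off directly.\<close>

primrec tri :: "nat \<Rightarrow> nat" where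
  "tri 0 = 0"
| "tri (Suc n) = tri n + Suc n"

primrec root :: "nat \<Rightarrow> nat" where
  "root 0 = 0"
| "root (Suc n) = root n + (1 - (tri (Suc (root n)) - Suc n))"

definition sn :: "nat \<Rightarrow> nat" where "sn a = a - tri (root a)"
definition fs :: "nat \<Rightarrow> nat" where "fs a = root a - sn a"
definition pr :: "nat \<Rightarrow> nat \<Rightarrow> nat" where "pr a b = tri (a + b) + b"

lemma tri_mono: "m \<le> n \<Longrightarrow> tri m \<le> tri n"
  by (induction n) (auto simp: le_Suc_eq)

text \<open>The truncated difference in \<open>root\<close> is 1 if
  \<open>tri (Suc (root n)) \<le> Suc n\<close>, which is when the root has to grow, and 0
  otherwise.\<close>

lemma root_bounds: "tri (root n) \<le> n \<and> n < tri (Suc (root n))"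
proof (induction n)
  case (Suc n)
  then show ?case
    by (cases "tri (Suc (root n)) \<le> Suc n") auto
qed simp

lemma root_pr: "root (pr a b) = a + b"
proof -
  have 1: "tri (a + b) \<le> pr a b" "pr a b < tri (Suc (a + b))" by (simp_all add: pr_def)
  have "\<not> root (pr a b) < a + b"
    using tri_mono[of "Suc (root (pr a b))" "a + b"] root_bounds[of "pr a b"] 1 by linarith
  moreover have "\<not> a + b < root (pr a b)"
    using tri_mono[of "Suc (a + b)" "root (pr a b)"] root_bounds[of "pr a b"] 1 by linarith
  ultimately show ?thesis by simp
qed

lemma sn_pr [simp]: "sn (pr a b) = b"
  by (simp add: sn_def root_pr) (simp add: pr_def)

lemma fs_pr [simp]: "fs (pr a b) = a"
  by (simp add: fs_def root_pr)

text \<open>\<open>ch \<phi>\<close> takes the value \<open>0\<close> iff \<open>\<phi>\<close> holds; this is meaningful for quantifier-free \<open>\<phi>\<close> only.\<close>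

fun ch :: "fm \<Rightarrow> trm" where
  "ch (s \<^bold>= t) = (s \<^bold>- t) \<^bold>+ (t \<^bold>- s)"
| "ch \<^bold>\<bottom> = CSuc \<cdot> CZero"
| "ch (\<phi> \<^bold>\<longrightarrow> \<psi>) = (CSuc \<cdot> CZero \<^bold>- ch \<phi>) \<^bold>* ch \<psi>"
| "ch (\<^bold>\<forall>x. \<phi>) = CZero"

lemma ch_wf: "qf \<phi> \<Longrightarrow> wff \<phi> \<Longrightarrow> wft (ch \<phi>) \<and> tyof (ch \<phi>) = T0"
  by (induction \<phi>) (auto simp: C_wf)

context forcing
begin

declare lam.simps [simp del] lam_tyof [simp] lam_wf [simp] lam_vars [simp] C_wf [simp] C_vars [simp]

section \<open>Forced values of primitive recursive terms\<close>

lemma rel_lam2: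
  assumes t: "wft t" "tyof t = \<tau>" and xy: "x \<noteq> y"
    and a: "rel (snd x) p a a'" and b: "rel (snd y) p b b'" and p: "p \<sqsubseteq> p"
    and \<rho>: "\<And>v. v \<in> vars t \<Longrightarrow> v \<noteq> x \<Longrightarrow> v \<noteq> y \<Longrightarrow> rel (snd v) p (\<rho> v) (\<rho> v)"
  shows "rel \<tau> p (cl \<rho> (lam x (lam y t)) \<bullet> a \<bullet> b) (cl (\<rho>(x := a', y := b')) t)"
proof -
  have "rel (snd y \<rightarrow>\<^sub>t \<tau>) p (cl \<rho> (lam x (lam y t)) \<bullet> a) (cl (\<rho>(x := a')) (lam y t))"
    using rel_lam[OF a p, of "lam y t" \<rho>] t \<rho> by simp
  then have "rel \<tau> p (cl \<rho> (lam x (lam y t)) \<bullet> a \<bullet> b) (cl (\<rho>(x := a')) (lam y t) \<bullet> b)"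
    using rel_app rel_left[OF b] p by blast
  moreover have "rel (snd v) p ((\<rho>(x := a')) v) ((\<rho>(x := a')) v)" if "v \<in> vars t" "v \<noteq> y" for v
    using \<rho>[OF that(1) _ that(2)] rel_right[OF a] by (cases "v = x") simp_all
  then have "rel \<tau> p (cl (\<rho>(x := a')) (lam y t) \<bullet> b) (cl (\<rho>(x := a', y := b')) t)"
    using rel_lam[OF b p, of t "\<rho>(x := a')"] t by simp
  ultimately show ?thesis by (rule rel_trans)
qed

definition vt :: "'p \<Rightarrow> (var \<Rightarrow> code) \<Rightarrow> trm \<Rightarrow> nat \<Rightarrow> bool" where
  "vt p \<rho> t n \<longleftrightarrow> rel T0 p (cl \<rho> t) (Num n)"

lemma vt_zero: "vt p \<rho> CZero 0"
  by (simp add: vt_def rel_Num)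

lemma vt_suc: "p \<sqsubseteq> p \<Longrightarrow> vt p \<rho> t n \<Longrightarrow> vt p \<rho> (CSuc \<cdot> t) (Suc n)"
  using rel_Op_Num[of p _ n "\<lambda>_ n. Suc n"] by (simp add: vt_def)

lemma vt_Var: "\<rho> x = Num n \<Longrightarrow> vt p \<rho> (Var x) n"
  by (simp add: vt_def rel_Num)

text \<open>The step term abstracts the recursive result before the index, while
  \<open>rec_nat\<close> passes the index first; the order of arguments in \<open>h\<close> absorbs
  the swap.\<close>

lemma vt_rec:
  assumes n: "vt p \<rho> t n" and a: "vt p \<rho> y a" and p: "p \<sqsubseteq> p"
    and s: "wft s" "tyof s = T0"
    and \<rho>: "\<And>v. v \<in> vars s \<Longrightarrow> v \<noteq> \<r> \<Longrightarrow> v \<noteq> \<m> \<Longrightarrow> rel (snd v) p (\<rho> v) (\<rho> v)"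
    and h: "\<And>i k. vt p (\<rho>(\<r> := Num k, \<m> := Num i)) s (h i k)"
  shows "vt p \<rho> (CRec \<cdot> t \<cdot> y \<cdot> lam \<r> (lam \<m> s)) (rec_nat a h n)"
proof -
  let ?z = "cl \<rho> (lam \<r> (lam \<m> s))"
  have z: "rel (T0 \<rightarrow>\<^sub>t T0 \<rightarrow>\<^sub>t T0) p ?z ?z"
    using rel_cl[of "lam \<r> (lam \<m> s)" p \<rho> \<rho>] \<rho> p s by auto
  have "rel T0 p (R \<bullet> Num n \<bullet> Num a \<bullet> ?z) (Num (rec_nat a h n))"
  proof (induction n)
    case 0
    show ?case using rel_R0[OF rel_Num] by simp
  next
    case (Suc n)
    let ?r = "R \<bullet> Num n \<bullet> Num a \<bullet> ?z"
    have 1: "rel T0 p (?z \<bullet> ?r \<bullet> Num n) (cl (\<rho>(\<r> := Num (rec_nat a h n), \<m> := Num n)) s)"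
      by (rule rel_lam2) (use s Suc rel_Num p \<rho> in auto)
    have 2: "rel T0 p (cl (\<rho>(\<r> := Num (rec_nat a h n), \<m> := Num n)) s) (Num (rec_nat a h (Suc n)))"
      using h unfolding vt_def by simp
    show ?case using rel_RSuc[OF rel_left[OF 1]] 1 2 rel_trans by blast
  qed
  moreover have "rel T0 p (R \<bullet> cl \<rho> t \<bullet> cl \<rho> y \<bullet> ?z) (R \<bullet> Num n \<bullet> Num a \<bullet> ?z)"
    using rel_app[OF rel_app[OF rel_app[OF rel_R n[unfolded vt_def] p] a[unfolded vt_def] p] z p] .
  ultimately show ?thesis unfolding vt_def cl.simps using rel_trans by blast
qed

lemma vt_lam1:
  assumes "p \<sqsubseteq> p" "vt p \<rho> s m" "wft t" "tyof t = T0" "vars t \<subseteq> {\<a>}"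
    and "vt p (\<rho>(\<a> := Num m)) t k"
  shows "vt p \<rho> (lam \<a> t \<cdot> s) k"
proof -
  have "rel T0 p (cl \<rho> (lam \<a> t) \<bullet> cl \<rho> s) (cl (\<rho>(\<a> := Num m)) t)"
    using rel_lam[of \<a> p "cl \<rho> s" "Num m" t \<rho>] assms(1-5) unfolding vt_def by auto
  then show ?thesis using assms(6) rel_trans unfolding vt_def cl.simps by blast
qed

lemma vt_lam2:
  assumes "p \<sqsubseteq> p" "vt p \<rho> s m" "vt p \<rho> u n" "wft t" "tyof t = T0" "vars t \<subseteq> {\<a>, \<b>}"
    and "vt p (\<rho>(\<a> := Num m, \<b> := Num n)) t k"
  shows "vt p \<rho> (lam \<a> (lam \<b> t) \<cdot> s \<cdot> u) k"
proof -
  have "rel T0 p (cl \<rho> (lam \<a> (lam \<b> t)) \<bullet> cl \<rho> s \<bullet> cl \<rho> u) (cl (\<rho>(\<a> := Num m, \<b> := Num n)) t)"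
    by (rule rel_lam2) (use assms in \<open>auto simp: vt_def\<close>)
  then show ?thesis using assms(7) rel_trans unfolding vt_def cl.simps by blast
qed

lemma vt_add:
  assumes "p \<sqsubseteq> p" "vt p \<rho> s m" "vt p \<rho> t n"
  shows "vt p \<rho> (s \<^bold>+ t) (m + n)"
proof -
  have "rec_nat m (\<lambda>_ k. Suc k) n = m + n" by (induction n) auto
  moreover have "vt p \<rho> (s \<^bold>+ t) (rec_nat m (\<lambda>_ k. Suc k) n)"
    unfolding addC_def
    by (intro vt_lam2 vt_rec vt_suc assms) (auto intro!: vt_Var rel_Num assms)
  ultimately show ?thesis by simp
qed

lemma vt_mul:
  assumes "p \<sqsubseteq> p" "vt p \<rho> s m" "vt p \<rho> t n"
  shows "vt p \<rho> (s \<^bold>* t) (m * n)"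
proof -
  have "rec_nat 0 (\<lambda>_ k. k + m) n = m * n" by (induction n) auto
  moreover have "vt p \<rho> (s \<^bold>* t) (rec_nat 0 (\<lambda>_ k. k + m) n)"
    unfolding mulC_def
    by (intro vt_lam2 vt_rec vt_add vt_zero assms) (auto intro!: vt_Var rel_Num assms)
  ultimately show ?thesis by simp
qed

lemma vt_pred:
  assumes "p \<sqsubseteq> p" "vt p \<rho> t n"
  shows "vt p \<rho> (predC \<cdot> t) (n - 1)"
proof -
  have "rec_nat 0 (\<lambda>i _. i) n = n - 1" by (induction n) auto
  moreover have "vt p \<rho> (predC \<cdot> t) (rec_nat 0 (\<lambda>i _. i) n)"
    unfolding predC_def
    by (intro vt_lam1 vt_rec vt_zero assms) (auto intro!: vt_Var rel_Num assms)
  ultimately show ?thesis by simp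
qed

lemma vt_sub:
  assumes "p \<sqsubseteq> p" "vt p \<rho> s m" "vt p \<rho> t n"
  shows "vt p \<rho> (s \<^bold>- t) (m - n)"
proof -
  have "rec_nat m (\<lambda>_ k. k - 1) n = m - n" by (induction n) auto
  moreover have "vt p \<rho> (s \<^bold>- t) (rec_nat m (\<lambda>_ k. k - 1) n)"
    unfolding subC_def
    by (intro vt_lam2 vt_rec vt_pred assms) (auto intro!: vt_Var rel_Num assms)
  ultimately show ?thesis by simp
qed

lemma vt_pow2:
  assumes "p \<sqsubseteq> p" "vt p \<rho> t n"
  shows "vt p \<rho> (pow2C \<cdot> t) (2 ^ n)"
proof -
  have "rec_nat (Suc 0) (\<lambda>_ k. k + k) n = 2 ^ n" by (induction n) auto
  moreover have "vt p \<rho> (pow2C \<cdot> t) (rec_nat (Suc 0) (\<lambda>_ k. k + k) n)"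
    unfolding pow2C_def
    by (intro vt_lam1 vt_rec vt_add vt_suc vt_zero assms) (auto intro!: vt_Var rel_Num assms)
  ultimately show ?thesis by simp
qed

lemma vt_tri:
  assumes "p \<sqsubseteq> p" "vt p \<rho> t n"
  shows "vt p \<rho> (triC \<cdot> t) (tri n)"
proof -
  have "rec_nat 0 (\<lambda>i k. k + Suc i) n = tri n" by (induction n) auto
  moreover have "vt p \<rho> (triC \<cdot> t) (rec_nat 0 (\<lambda>i k. k + Suc i) n)"
    unfolding triC_def
    by (intro vt_lam1 vt_rec vt_add vt_suc vt_zero assms) (auto intro!: vt_Var rel_Num assms)
  ultimately show ?thesis by simp
qed

lemma vt_root:
  assumes "p \<sqsubseteq> p" "vt p \<rho> t n"
  shows "vt p \<rho> (rootC \<cdot> t) (root n)"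
proof -
  let ?h = "\<lambda>i k. k + (Suc 0 - (tri (Suc k) - Suc i))"
  have "rec_nat 0 ?h n = root n" by (induction n) auto
  moreover have "vt p \<rho> (rootC \<cdot> t) (rec_nat 0 ?h n)"
    unfolding rootC_def
    by (intro vt_lam1 vt_rec vt_add vt_sub vt_tri vt_suc vt_zero assms) (auto intro!: vt_Var rel_Num assms)
  ultimately show ?thesis by simp
qed

lemma vt_pair:
  assumes "p \<sqsubseteq> p" "vt p \<rho> s m" "vt p \<rho> t n"
  shows "vt p \<rho> (pair s t) (pr m n)"
  unfolding pairC_def pr_def
  by (intro vt_lam2 vt_add vt_tri assms) (auto intro!: vt_Var assms)

lemma vt_snd:
  assumes "p \<sqsubseteq> p" "vt p \<rho> t n"
  shows "vt p \<rho> (sndC \<cdot> t) (sn n)"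
  unfolding sndC_def sn_def
  by (intro vt_lam1 vt_sub vt_tri vt_root assms) (auto intro!: vt_Var assms)

lemma vt_fst:
  assumes "p \<sqsubseteq> p" "vt p \<rho> t n"
  shows "vt p \<rho> (fstC \<cdot> t) (fs n)"
  unfolding fstC_def fs_def
  by (intro vt_lam1 vt_sub vt_snd vt_root assms) (auto intro!: vt_Var assms)

lemma vt_decide:
  assumes "good p \<rho>" "wft t" "tyof t = T0" "q \<sqsubseteq> p"
  obtains r n where "r \<sqsubseteq> q" "r \<sqsubseteq> r" "vt r \<rho> t n" "ev (orc r) (cl \<rho> t) n"
  using rel_decide[OF good_cl[OF good_mono[OF assms(1,4)] assms(2,3) le_refl[OF assms(4)]] le_refl[OF assms(4)]]
    le_refl unfolding vt_def by metis

lemma vt_mono: "vt p \<rho> t n \<Longrightarrow> q \<sqsubseteq> p \<Longrightarrow> vt q \<rho> t n"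
  unfolding vt_def by (rule rel_mono)

lemma vt_stable: "(\<And>q. q \<sqsubseteq> p \<Longrightarrow> \<exists>r. r \<sqsubseteq> q \<and> vt r \<rho> t n) \<Longrightarrow> vt p \<rho> t n"
  unfolding vt_def by (rule rel_stable)

lemma vt_det: "vt p \<rho> t m \<Longrightarrow> vt p \<rho> t n \<Longrightarrow> p \<sqsubseteq> p \<Longrightarrow> m = n"
  unfolding vt_def by (rule rel_Num_eq)

lemma F_Eq_vt: "vt p \<rho> s m \<Longrightarrow> vt p \<rho> t n \<Longrightarrow> p \<sqsubseteq> p \<Longrightarrow> F p \<rho> (s \<^bold>= t) \<longleftrightarrow> m = n"
  unfolding vt_def F.simps using rel_trans rel_sym rel_Num_eq by metis

text \<open>Quantifier-free formulas turn into equations here, so that evaluating a single term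
  decides them. Both directions pass to a dense set of conditions at which the component terms have
  values.\<close>

lemma F_ch:
  "wff \<phi> \<Longrightarrow> qf \<phi> \<Longrightarrow> good p \<rho> \<Longrightarrow> p \<sqsubseteq> p \<Longrightarrow> F p \<rho> \<phi> \<longleftrightarrow> vt p \<rho> (ch \<phi>) 0"
proof (induction \<phi> arbitrary: p)
  case (Eq s t)
  have *: "\<exists>r m n. r \<sqsubseteq> q \<and> r \<sqsubseteq> r \<and> vt r \<rho> s m \<and> vt r \<rho> t n \<and> vt r \<rho> (ch (s \<^bold>= t)) ((m - n) + (n - m))"
    if q: "q \<sqsubseteq> p" for q
  proof -
    have ws: "wft s" "tyof s = T0" using Eq.prems by auto
    obtain r m where r: "r \<sqsubseteq> q" "vt r \<rho> s m"
      by (rule vt_decide[OF Eq.prems(3) ws q]) (rule that)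
    have rp: "r \<sqsubseteq> p" using r q le_trans by blast
    have wt: "wft t" "tyof t = T0" using Eq.prems by auto
    obtain u n where u: "u \<sqsubseteq> r" "u \<sqsubseteq> u" "vt u \<rho> t n"
      by (rule vt_decide[OF Eq.prems(3) wt rp]) (rule that)
    have s: "vt u \<rho> s m" using r u vt_mono by blast
    have "vt u \<rho> (ch (s \<^bold>= t)) ((m - n) + (n - m))"
      unfolding ch.simps by (intro vt_add vt_sub u s)
    then show ?thesis using u s r le_trans by blast
  qed
  show ?case
  proof
    assume H: "F p \<rho> (s \<^bold>= t)"
    show "vt p \<rho> (ch (s \<^bold>= t)) 0"
    proof (rule vt_stable)
      fix q assume q: "q \<sqsubseteq> p"
      then obtain r m n where r: "r \<sqsubseteq> q" "r \<sqsubseteq> r" "vt r \<rho> s m" "vt r \<rho> t n"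
        "vt r \<rho> (ch (s \<^bold>= t)) ((m - n) + (n - m))" using * by blast
      have "m = n" using F_Eq_vt[OF r(3,4,2)] F_mono[OF H le_trans[OF r(1) q]] by blast
      then show "\<exists>r. r \<sqsubseteq> q \<and> vt r \<rho> (ch (s \<^bold>= t)) 0" using r by auto
    qed
  next
    assume H: "vt p \<rho> (ch (s \<^bold>= t)) 0"
    show "F p \<rho> (s \<^bold>= t)"
    proof (rule F_stable[OF Eq.prems(4)])
      fix q assume q: "q \<sqsubseteq> p"
      then obtain r m n where r: "r \<sqsubseteq> q" "r \<sqsubseteq> r" "vt r \<rho> s m" "vt r \<rho> t n"
        "vt r \<rho> (ch (s \<^bold>= t)) ((m - n) + (n - m))" using * by blast
      have "(m - n) + (n - m) = 0" using vt_det[OF r(5) vt_mono[OF H le_trans[OF r(1) q]] r(2)] .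
      then show "\<exists>r. r \<sqsubseteq> q \<and> F r \<rho> (s \<^bold>= t)" using r F_Eq_vt[OF r(3,4,2)] by auto
    qed
  qed
next
  case Falsum
  have "vt p \<rho> (ch \<^bold>\<bottom>) (Suc 0)" using Falsum by (auto intro: vt_suc vt_zero)
  then show ?case using vt_det Falsum(4) by fastforce
next
  case (Imp \<phi> \<psi>)
  have \<phi>: "wff \<phi>" "qf \<phi>" and \<psi>: "wff \<psi>" "qf \<psi>" using Imp.prems by auto
  have *: "\<exists>r m n. r \<sqsubseteq> q \<and> r \<sqsubseteq> r \<and> vt r \<rho> (ch \<phi>) m \<and> vt r \<rho> (ch \<psi>) n \<and>
      vt r \<rho> (ch (\<phi> \<^bold>\<longrightarrow> \<psi>)) ((Suc 0 - m) * n)" if q: "q \<sqsubseteq> p" for q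
  proof -
    have ws: "wft (ch \<phi>)" "tyof (ch \<phi>) = T0" using ch_wf \<phi> \<psi> by blast+
    obtain r m where r: "r \<sqsubseteq> q" "vt r \<rho> (ch \<phi>) m"
      by (rule vt_decide[OF Imp.prems(3) ws q]) (rule that)
    have rp: "r \<sqsubseteq> p" using r q le_trans by blast
    have wt: "wft (ch \<psi>)" "tyof (ch \<psi>) = T0" using ch_wf \<phi> \<psi> by blast+
    obtain u n where u: "u \<sqsubseteq> r" "u \<sqsubseteq> u" "vt u \<rho> (ch \<psi>) n"
      by (rule vt_decide[OF Imp.prems(3) wt rp]) (rule that)
    have s: "vt u \<rho> (ch \<phi>) m" using r u vt_mono by blast
    have "vt u \<rho> (ch (\<phi> \<^bold>\<longrightarrow> \<psi>)) ((Suc 0 - m) * n)"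
      unfolding ch.simps by (intro vt_mul vt_sub vt_suc vt_zero u s)
    then show ?thesis using u s r le_trans by blast
  qed
  have IH: "F q \<rho> \<phi> \<longleftrightarrow> vt q \<rho> (ch \<phi>) 0" "F q \<rho> \<psi> \<longleftrightarrow> vt q \<rho> (ch \<psi>) 0" if "q \<sqsubseteq> p" for q
    using Imp.IH[of q] \<phi> \<psi> good_mono[OF Imp.prems(3)] that le_refl by blast+
  show ?case
  proof
    assume H: "F p \<rho> (\<phi> \<^bold>\<longrightarrow> \<psi>)"
    show "vt p \<rho> (ch (\<phi> \<^bold>\<longrightarrow> \<psi>)) 0"
    proof (rule vt_stable)
      fix q assume q: "q \<sqsubseteq> p"
      then obtain r m n where r: "r \<sqsubseteq> q" "r \<sqsubseteq> r" "vt r \<rho> (ch \<phi>) m" "vt r \<rho> (ch \<psi>) n"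
        "vt r \<rho> (ch (\<phi> \<^bold>\<longrightarrow> \<psi>)) ((Suc 0 - m) * n)" using * by blast
      have rp: "r \<sqsubseteq> p" using r q le_trans by blast
      have "n = 0" if "m = 0"
      proof -
        have "F r \<rho> \<phi>" using IH(1)[OF rp] r that by simp
        then have "F r \<rho> \<psi>" using H rp F_ImpD by blast
        then show ?thesis using IH(2)[OF rp] vt_det r by blast
      qed
      then have "(Suc 0 - m) * n = 0" by (cases m) auto
      then show "\<exists>r. r \<sqsubseteq> q \<and> vt r \<rho> (ch (\<phi> \<^bold>\<longrightarrow> \<psi>)) 0" using r by metis
    qed
  next
    assume H: "vt p \<rho> (ch (\<phi> \<^bold>\<longrightarrow> \<psi>)) 0"
    show "F p \<rho> (\<phi> \<^bold>\<longrightarrow> \<psi>)"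
    proof (rule F_ImpI)
      fix q assume q: "q \<sqsubseteq> p" and \<phi>q: "F q \<rho> \<phi>"
      have "vt q \<rho> (ch \<psi>) 0"
      proof (rule vt_stable)
        fix s assume s: "s \<sqsubseteq> q"
        then have sp: "s \<sqsubseteq> p" using q le_trans by blast
        then obtain r m n where r: "r \<sqsubseteq> s" "r \<sqsubseteq> r" "vt r \<rho> (ch \<phi>) m" "vt r \<rho> (ch \<psi>) n"
          "vt r \<rho> (ch (\<phi> \<^bold>\<longrightarrow> \<psi>)) ((Suc 0 - m) * n)" using * by blast
        have rp: "r \<sqsubseteq> p" "r \<sqsubseteq> q" using r s sp le_trans by blast+
        have "m = 0" using IH(1)[OF rp(1)] F_mono[OF \<phi>q rp(2)] vt_det r by blast
        moreover have "(Suc 0 - m) * n = 0" using vt_det[OF r(5) vt_mono[OF H rp(1)] r(2)] .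
        ultimately have "n = 0" by simp
        then show "\<exists>r. r \<sqsubseteq> s \<and> vt r \<rho> (ch \<psi>) 0" using r by blast
      qed
      then show "F q \<rho> \<psi>" using IH q by blast
    qed
  qed
qed simp

end

section \<open>Conditions and fusion\<close>

text \<open>Truth in the ground model, intended for second-order formulas: every type other than 0
  is read as type 1. No condition and no oracle occurs, so the oracle answers can be defined from it
  without circularity.\<close>

fun truth :: "(var \<Rightarrow> code) \<Rightarrow> fm \<Rightarrow> bool" where
  "truth \<rho> (s \<^bold>= t) \<longleftrightarrow> (\<exists>n. ev (\<lambda>_ _. None) (cl \<rho> s) n \<and> ev (\<lambda>_ _. None) (cl \<rho> t) n)"
| "truth \<rho> \<^bold>\<bottom> \<longleftrightarrow> False"
| "truth \<rho> (\<phi> \<^bold>\<longrightarrow> \<psi>) \<longleftrightarrow> (truth \<rho> \<phi> \<longrightarrow> truth \<rho> \<psi>)"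
| "truth \<rho> (\<^bold>\<forall>x. \<phi>) \<longleftrightarrow>
     (if snd x = T0 then \<forall>n. truth (\<rho>(x := Num n)) \<phi> else \<forall>f. truth (\<rho>(x := Fn0 f)) \<phi>)"

definition ratval :: "nat \<Rightarrow> real" where
  "ratval q = (real (fs (fs q)) - real (sn (fs q))) / real (Suc (sn q))"

text \<open>Conditions are injections on real numbers rather than on their representations, so the generic
  functional respects equality of reals; off the fast Cauchy sequences \<open>limval\<close> is junk.\<close>

definition limval :: "(nat \<Rightarrow> nat) \<Rightarrow> real" where
  "limval f = lim (\<lambda>n. ratval (f n))"

definition Sigma1_true :: "nat \<Rightarrow> (nat \<Rightarrow> nat) \<Rightarrow> bool" where
  "Sigma1_true k f = truth (\<lambda>_. Fn0 f) (Sigma1_nf k (Var (0, T1)))"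

text \<open>For positive \<open>k\<close> the answer is total and the same at all conditions; only
  \<open>Orc 0\<close> looks at the injection.\<close>

definition query :: "(real \<rightharpoonup> nat) \<Rightarrow> queries" where
  "query y k f = (if k = 0 then y (limval f) else Some (if Sigma1_true k f then 0 else 1))"

type_synonym cond = "(real \<rightharpoonup> nat) \<times> nat set"

text \<open>The second component contains all values that an extension may not newly take.\<close>

definition valid :: "cond \<Rightarrow> bool" where
  "valid p \<longleftrightarrow> inj_on (fst p) (dom (fst p)) \<and> ran (fst p) \<subseteq> snd p \<and> infinite (- snd p)"

definition ext :: "cond \<Rightarrow> cond \<Rightarrow> bool" where
  "ext q p \<longleftrightarrow> valid q \<and> valid p \<and> fst p \<subseteq>\<^sub>m fst q \<and> snd p \<subseteq> snd q \<and>
     (\<forall>x n. fst q x = Some n \<longrightarrow> fst p x = None \<longrightarrow> n \<notin> snd p)"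

lemma map_leD: "y \<subseteq>\<^sub>m z \<Longrightarrow> y x = Some n \<Longrightarrow> z x = Some n"
  unfolding map_le_def by (metis domI)

lemma query_mono: "y \<subseteq>\<^sub>m z \<Longrightarrow> query y k f = Some n \<Longrightarrow> query z k f = Some n"
  by (auto simp: query_def dest: map_leD split: if_splits)

lemma ext_refl_iff [simp]: "ext p p \<longleftrightarrow> valid p"
  by (auto simp: ext_def)

lemma ext_trans: "ext r q \<Longrightarrow> ext q p \<Longrightarrow> ext r p"
  unfolding ext_def
  by (smt (verit) map_leD map_le_trans not_Some_eq subset_trans subsetD)

interpretation forcing ext "\<lambda>p. query (fst p)"
proof
  show "ext q p \<Longrightarrow> ext q q" for q p by (simp add: ext_def)
  show "ext q p \<Longrightarrow> query (fst p) k f = Some n \<Longrightarrow> query (fst q) k f = Some n" for q p k f n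
    by (erule query_mono[rotated]) (simp add: ext_def)
qed (rule ext_trans)

text \<open>A value outside \<open>snd p\<close> is not taken by \<open>fst p\<close>, since
  \<open>ran (fst p) \<subseteq> snd p\<close>; adding it to both components keeps injectivity and
  leaves infinitely many values free. This makes the generic functional total.\<close>

lemma extend:
  assumes "valid p"
  obtains q n where "ext q p" "fst q x = Some n"
proof (cases "fst p x")
  case None
  obtain c where c: "c \<notin> snd p" using assms unfolding valid_def by (metis Compl_iff finite.emptyI equals0I)
  let ?q = "((fst p)(x \<mapsto> c), insert c (snd p))"
  have "- insert c (snd p) = - snd p - {c}" by blast
  then have "infinite (- insert c (snd p))" using assms by (simp add: valid_def)
  moreover have "c \<notin> ran (fst p)" using c assms by (auto simp: valid_def)
  then have "inj_on (fst ?q) (dom (fst ?q))"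
    using assms None by (auto simp: valid_def inj_on_def ran_def dom_def fun_upd_apply)
  ultimately have "valid ?q" using assms None by (auto simp: valid_def ran_def fun_upd_apply split: if_splits)
  moreover have "fst p \<subseteq>\<^sub>m fst ?q" using None by (auto simp: map_le_def fun_upd_apply)
  ultimately have "ext ?q p" using assms c by (auto simp: ext_def fun_upd_apply split: if_splits)
  then show ?thesis using that by fastforce
next
  case (Some n)
  then show ?thesis using that assms ext_refl_iff by blast
qed

text \<open>Stage \<open>n\<close> forbids a fresh value \<open>c n\<close> before extending, so no
  stage ever takes a reserved value and the union of the injections misses an infinite set. The
  requirement \<open>Q\<close> sees only injections and grows with them, because the limit need not
  extend the stages.\<close>

lemma fusion:
  assumes p: "valid p"
    and step: "\<And>n a q. ext q p \<Longrightarrow> \<exists>r a'. ext r q \<and> Q n a a' (fst r)"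
    and mono: "\<And>n a a' y z. Q n a a' y \<Longrightarrow> y \<subseteq>\<^sub>m z \<Longrightarrow> Q n a a' z"
  obtains r a where "ext r p" "a 0 = a0" "\<And>n. Q n (a n) (a (Suc n)) (fst r)"
proof -
  let ?P = "\<lambda>(n::nat) x. ext (fst x) p \<and> (n = 0 \<longrightarrow> x = (p, a0))"
  let ?R = "\<lambda>(n::nat) x x'. Q n (snd x) (snd x') (fst (fst x')) \<and>
    (\<exists>c. c \<notin> snd (fst x) \<and> ext (fst x') (fst (fst x), insert c (snd (fst x))))"
  have res: "valid (fst q, insert c (snd q)) \<and> ext (fst q, insert c (snd q)) q"
    if "valid q" for q :: cond and c
  proof -
    have "- insert c (snd q) = - snd q - {c}" by blast
    then have "infinite (- insert c (snd q))" using that by (simp add: valid_def)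
    then have "valid (fst q, insert c (snd q))" using that by (auto simp: valid_def)
    then show ?thesis using that by (auto simp: ext_def)
  qed
  have "\<exists>s. \<forall>n. ?P n (s n) \<and> ?R n (s n) (s (Suc n))"
  proof (rule dependent_nat_choice)
    show "\<exists>x. ?P 0 x" using p by (intro exI[of _ "(p, a0)"]) simp
  next
    fix x :: "cond \<times> 'a" and n :: nat assume "?P n x"
    then have x: "ext (fst x) p" by blast
    then have v: "valid (fst x)" by (simp add: ext_def)
    obtain c where c: "c \<notin> snd (fst x)" using v unfolding valid_def by (metis Compl_iff finite.emptyI equals0I)
    let ?q = "(fst (fst x), insert c (snd (fst x)))"
    have q: "ext ?q p" using res[OF v] x ext_trans by blast
    obtain r a' where r: "ext r ?q" "Q n (snd x) a' (fst r)" using step[OF q] by blast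
    have "?P (Suc n) (r, a')" using ext_trans[OF r(1) q] by simp
    moreover have "?R n x (r, a')" using r c by auto
    ultimately show "\<exists>y. ?P (Suc n) y \<and> ?R n x y" by blast
  qed
  then obtain s where ss: "\<forall>n. ?P n (s n) \<and> ?R n (s n) (s (Suc n))" ..
  have s: "?P n (s n)" "?R n (s n) (s (Suc n))" for n using ss[rule_format, of n] by (rule conjunct1, rule conjunct2)
  define y where "y n = fst (fst (s n))" for n
  define B where "B n = snd (fst (s n))" for n
  define a where "a n = snd (s n)" for n
  have "\<exists>c. \<forall>n. c n \<notin> B n \<and> ext (y (Suc n), B (Suc n)) (y n, insert (c n) (B n))"
    by (rule choice) (use s(2) in \<open>auto simp: y_def B_def\<close>)
  then obtain c where "\<forall>n. c n \<notin> B n \<and> ext (y (Suc n), B (Suc n)) (y n, insert (c n) (B n))" ..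
  then have c: "c n \<notin> B n" "ext (y (Suc n), B (Suc n)) (y n, insert (c n) (B n))" for n by simp_all
  have v: "valid (y n, B n)" for n using s(1)[of n] by (simp add: y_def B_def ext_def)
  have suc: "ext (y m, B m) (y n, insert (c n) (B n))" if "n < m" for n m
    using that
  proof (induction m)
    case (Suc m)
    show ?case
    proof (cases "n = m")
      case True then show ?thesis using c by simp
    next
      case False
      then have "ext (y m, B m) (y n, insert (c n) (B n))" using Suc by simp
      moreover have "ext (y (Suc m), B (Suc m)) (y m, B m)" using ext_trans[OF c(2)[of m]] res[OF v[of m], of "c m"] by simp
      ultimately show ?thesis using ext_trans by blast
    qed
  qed simp
  have le: "ext (y m, B m) (y n, B n)" if "n \<le> m" for n m
    using ext_trans[OF suc[of n m], of "(y n, B n)"] res[OF v[of n], of "c n"] v that by (cases "n = m") auto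
  have ym: "y m x = Some k" if "y n x = Some k" "n \<le> m" for m n x k
    using le[OF that(2)] map_leD[of "y n" "y m" x k] that(1) by (simp add: ext_def)
  \<comment> \<open>Up to stage \<open>n\<close> all taken values lie in \<open>B n\<close>, which
    omits \<open>c n\<close>; afterwards \<open>c n\<close> is forbidden for new arguments.\<close>
  have cr: "c n \<notin> ran (y m)" for n m
  proof
    assume "c n \<in> ran (y m)"
    then obtain x where x: "y m x = Some (c n)" by (auto simp: ran_def)
    show False
    proof (cases "m \<le> n")
      case True
      have "c n \<in> B m" using x v[of m] by (auto simp: valid_def ran_def)
      then show False using le[OF True] c(1)[of n] by (auto simp: ext_def)
    next
      case False
      then have e: "ext (y m, B m) (y n, insert (c n) (B n))" using suc by simp
      have "y n x \<noteq> None" using e x by (auto simp: ext_def)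
      then obtain k where k: "y n x = Some k" by blast
      then have "k = c n" using ym[OF k, of m] False x by simp
      then have "c n \<in> B n" using k v[of n] by (auto simp: valid_def ran_def)
      then show False using c by blast
    qed
  qed
  \<comment> \<open>Stage \<open>m\<close> already forbids \<open>c n\<close> but not
    \<open>c m\<close>.\<close>
  have "c n \<noteq> c m" if "n < m" for n m
    using suc[OF that] c(1)[of m] by (auto simp: ext_def)
  then have "inj c" by (intro linorder_injI) simp
  then have infc: "infinite (range c)" by (simp add: finite_image_iff)
  define z where "z x = (if \<exists>n. y n x \<noteq> None then y (LEAST n. y n x \<noteq> None) x else None)" for x
  have z: "z x = Some k \<longleftrightarrow> (\<exists>n. y n x = Some k)" for x k
  proof
    assume "z x = Some k" then show "\<exists>n. y n x = Some k" by (auto simp: z_def split: if_splits)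
  next
    assume "\<exists>n. y n x = Some k"
    then obtain n where n: "y n x = Some k" by blast
    then have ex: "\<exists>n. y n x \<noteq> None" by auto
    let ?m = "LEAST n. y n x \<noteq> None"
    have "?m \<le> n" by (rule Least_le) (use n in simp)
    moreover have "y ?m x \<noteq> None" using LeastI_ex[OF ex] .
    ultimately obtain k' where k': "y ?m x = Some k'" and "?m \<le> n" by blast
    then have "y n x = Some k'" using ym by blast
    then have "y ?m x = Some k" using n k' by simp
    then show "z x = Some k" using ex by (simp add: z_def)
  qed
  \<comment> \<open>The reserved values become available again. They lie in the forbidden sets of
    later stages, so \<open>?r\<close> cannot extend those stages; it extends \<open>p\<close>, as
    every \<open>B n\<close> contains \<open>snd p\<close>.\<close>
  let ?r = "(z, - range c)"
  have yz: "y n \<subseteq>\<^sub>m z" for n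
    unfolding map_le_def
  proof
    fix x assume "x \<in> dom (y n)"
    then obtain k where k: "y n x = Some k" by blast
    then have "z x = Some k" using z by blast
    then show "y n x = z x" using k by simp
  qed
  have "inj_on z (dom z)"
  proof (rule inj_onI)
    fix u w assume "u \<in> dom z" "w \<in> dom z" "z u = z w"
    then obtain k where zk: "z u = Some k" "z w = Some k" by (metis domD)
    obtain i where i: "y i u = Some k" using z[of u k] zk by auto
    obtain j where j: "y j w = Some k" using z[of w k] zk by auto
    have "y (max i j) u = Some k" "y (max i j) w = Some k" using ym[OF i] ym[OF j] by simp_all
    moreover have "inj_on (y (max i j)) (dom (y (max i j)))" using v[of "max i j"] by (simp add: valid_def)
    ultimately show "u = w" by (auto simp: inj_on_def dom_def)
  qed
  moreover have "ran z \<subseteq> - range c" using cr z by (auto simp: ran_def)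
  ultimately have vr: "valid ?r" using infc by (simp add: valid_def)
  have s0: "y 0 = fst p" "B 0 = snd p" "a 0 = a0" using s(1)[of 0] by (simp_all add: y_def B_def a_def)
  have "ext ?r p"
    unfolding ext_def
  proof (intro conjI allI impI)
    show "fst p \<subseteq>\<^sub>m fst ?r" using yz[of 0] s0 by simp
    have "snd p \<subseteq> B n" for n using le[of 0 n] s0 by (simp add: ext_def)
    then show "snd p \<subseteq> snd ?r" using c(1) by fastforce
    fix x n assume "fst ?r x = Some n" "fst p x = None"
    then obtain i where "y i x = Some n" using z by auto
    then show "n \<notin> snd p" using le[of 0 i] s0 \<open>fst p x = None\<close> by (auto simp: ext_def)
  qed (use vr p in auto)
  moreover have "Q n (a n) (a (Suc n)) (fst ?r)" for n
    using s(2)[of n] mono[OF _ yz[of "Suc n"]] by (simp add: a_def y_def)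
  ultimately show ?thesis using that s0 by blast
qed

section \<open>No new elements of Baire space\<close>

lemma ev_query_mono: "ev (query y) s n \<Longrightarrow> y \<subseteq>\<^sub>m z \<Longrightarrow> ev (query z) s n"
  by (erule ev_mono) (rule query_mono)

text \<open>Each value is found densely, and stage \<open>n\<close> of a fusion settles the one at
  \<open>Num n\<close>. The outcome is one condition at which all of them evaluate, as the premises
  of \<open>ev_Orc\<close> demand.\<close>

lemma decide1:
  assumes "rel T1 p s t" "valid p"
  obtains q f where "ext q p" "\<And>m. ev (query (fst q)) (s \<bullet> Num m) (f m)" "\<And>m. ev (query (fst q)) (t \<bullet> Num m) (f m)"
proof -
  let ?Q = "\<lambda>n (a::nat) a' y. ev (query y) (s \<bullet> Num n) a' \<and> ev (query y) (t \<bullet> Num n) a'"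
  have step: "\<exists>r a'. ext r q \<and> ?Q n a a' (fst r)" if q: "ext q p" for n a q
  proof -
    have "rel T0 q (s \<bullet> Num n) (t \<bullet> Num n)"
      using assms(1) q rel_Num unfolding rel.simps(2) by blast
    then show ?thesis using rel_T0D le_refl[OF q] by blast
  qed
  obtain r a where r: "ext r p" "\<And>n. ?Q n (a n) (a (Suc n)) (fst r)"
  proof (rule fusion[of p ?Q 0])
    show "valid p" by fact
    show "\<exists>r a'. ext r q \<and> ?Q n a a' (fst r)" if "ext q p" for n a q by (rule step[OF that])
  qed (auto intro: ev_query_mono)
  \<comment> \<open>The state reached after stage \<open>n\<close> is the value at \<open>n\<close>,
    hence the shift.\<close>
  then show ?thesis using that[of r "\<lambda>n. a (Suc n)"] by blast
qed

lemma rel_Op_Fn0: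
  assumes "rel T0 p c (Num k)" "valid p"
  shows "rel T1 p (Op h \<bullet> c) (Fn0 (h k))"
proof -
  have p: "ext p p" using assms by simp
  have "rel T1 p (Op h \<bullet> Num k) (Fn0 (h k))"
    unfolding rel.simps(2)
  proof (intro allI impI)
    fix q a b assume q: "ext q p" and ab: "rel T0 q a b"
    show "rel T0 q (Op h \<bullet> Num k \<bullet> a) (Fn0 (h k) \<bullet> b)"
    proof (rule rel_stable)
      fix r assume r: "ext r q"
      obtain s n where s: "ext s r" "rel T0 s a (Num n)" "rel T0 s b (Num n)"
        using rel_decide[OF rel_mono[OF ab r] le_refl[OF r]] by metis
      have "rel T0 s (Op h \<bullet> Num k \<bullet> a) (Num (h k n))" "rel T0 s (Fn0 (h k) \<bullet> b) (Num (h k n))"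
        using rel_Op_Num[OF le_refl[OF s(1)]] s by blast+
      then show "\<exists>s. ext s r \<and> rel T0 s (Op h \<bullet> Num k \<bullet> a) (Fn0 (h k) \<bullet> b)"
        using s rel_sym rel_trans by blast
    qed
  qed
  moreover have "rel T1 p (Op h \<bullet> c) (Op h \<bullet> Num k)" using rel_app[OF rel_Op assms(1) p] .
  ultimately show ?thesis using rel_trans by blast
qed

text \<open>Values at numerals suffice, as every code of type 0 is densely related to a
  numeral.\<close>

lemma rel_Fn0I:
  assumes s: "rel T1 p s s" and f: "\<And>m. ev (query (fst p)) (s \<bullet> Num m) (f m)"
  shows "rel T1 p s (Fn0 f)"
  unfolding rel.simps(2)
proof (intro allI impI)
  fix q a b assume q: "ext q p" and ab: "rel T0 q a b"
  show "rel T0 q (s \<bullet> a) (Fn0 f \<bullet> b)"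
  proof (rule rel_stable)
    fix r assume r: "ext r q"
    obtain u n where u: "ext u r" "rel T0 u a (Num n)" "rel T0 u b (Num n)"
      using rel_decide[OF rel_mono[OF ab r] le_refl[OF r]] by metis
    have up: "ext u p" using u r q ext_trans by blast
    have "rel T0 u (s \<bullet> a) (s \<bullet> Num n)" using s up u(2) unfolding rel.simps(2) by blast
    moreover have "rel T0 u (s \<bullet> Num n) (Num (f n))" using rel_mono[OF rel_ev[OF f ev_Num] up] .
    moreover have "rel T0 u (Fn0 f \<bullet> b) (Num (f n))" using rel_Op_Num[OF le_refl[OF u(1)]] u by blast
    ultimately show "\<exists>u. ext u r \<and> rel T0 u (s \<bullet> a) (Fn0 f \<bullet> b)"
      using u rel_sym rel_trans by blast
  qed
qed

lemma decide_real:
  assumes "rel T1 p s t" "valid p"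
  obtains q f where "ext q p" "valid q" "rel T1 q s (Fn0 f)" "rel T1 q t (Fn0 f)"
    "\<And>m. ev (query (fst q)) (s \<bullet> Num m) (f m)" "\<And>m. ev (query (fst q)) (t \<bullet> Num m) (f m)"
proof -
  obtain q f where q: "ext q p" and f: "\<And>m. ev (query (fst q)) (s \<bullet> Num m) (f m)" "\<And>m. ev (query (fst q)) (t \<bullet> Num m) (f m)"
    using decide1[OF assms] by metis
  have "rel T1 q s s" "rel T1 q t t" using rel_mono[OF assms(1) q] rel_left rel_right by blast+
  then show ?thesis using that[OF q _ rel_Fn0I rel_Fn0I] f q by (auto simp: ext_def)
qed

text \<open>By fusion, related arguments evaluate to one and the same ground function; for
  \<open>Orc 0\<close> one further extension gives its limit a value.\<close>

lemma rel_Orc: "rel T2 p (Orc k) (Orc k)"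
  unfolding rel.simps(2)[of T1]
proof (intro allI impI, rule rel_T0I)
  fix q a b r assume "ext q p" and ab: "rel T1 q a b" and r: "ext r q"
  have "valid r" using r by (simp add: ext_def)
  then obtain u f where u: "ext u r" "\<And>m. ev (query (fst u)) (a \<bullet> Num m) (f m)" "\<And>m. ev (query (fst u)) (b \<bullet> Num m) (f m)"
    using decide1[OF rel_mono[OF ab r]] by metis
  have "valid u" using u by (simp add: ext_def)
  then obtain v n where v: "ext v u" "fst v (limval f) = Some n" by (rule extend)
  obtain n' where "query (fst v) k f = Some n'" using v by (cases "k = 0") (auto simp: query_def)
  then have "ev (query (fst v)) (Orc k \<bullet> a) n'" "ev (query (fst v)) (Orc k \<bullet> b) n'"
    using ev_le[OF u(2) v(1)] ev_le[OF u(3) v(1)] ev_Orc by blast+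
  then show "\<exists>v n. ext v r \<and> ev (query (fst v)) (Orc k \<bullet> a) n \<and> ev (query (fst v)) (Orc k \<bullet> b) n"
    using v u ext_trans by blast
qed

text \<open>The choice functional is one code, valid at all conditions: search through the
  characteristic term. Taking the least zero makes it extensional, which an arbitrary witness would
  not be.\<close>

lemma forced_AC:
  assumes \<phi>: "wff \<phi>" "qf \<phi>" and v: "f = (i, T1)" "n = (j, T0)" "\<Phi> = (k, T2)" "\<Phi> \<notin> fvs \<phi>"
  shows "forced ((\<^bold>\<forall>f. \<^bold>\<exists>n. \<phi>) \<^bold>\<longrightarrow> (\<^bold>\<exists>\<Phi>. \<^bold>\<forall>f. subst n (Var \<Phi> \<cdot> Var f) \<phi>))"
proof (rule forcedI, rule F_ImpI)
  fix p \<rho> q assume gp: "good p \<rho>" and qp: "ext q p" and H: "F q \<rho> (\<^bold>\<forall>f. \<^bold>\<exists>n. \<phi>)"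
  define G where "G = cl \<rho> (lam f (lam n (ch \<phi>)))"
  define P where "P = S \<bullet> (K \<bullet> Mu) \<bullet> G"
  have wch: "wft (ch \<phi>)" "tyof (ch \<phi>) = T0" using ch_wf \<phi> by blast+
  have hP: "hr (P \<bullet> a) (K \<bullet> Mu \<bullet> a \<bullet> (G \<bullet> a))" "hr (K \<bullet> Mu \<bullet> a \<bullet> (G \<bullet> a)) (Mu \<bullet> (G \<bullet> a))" for a
    unfolding P_def by (rule hrS) (rule hrA[OF hrK])
  have key: "\<exists>s k. ext s r \<and> ev (query (fst s)) (P \<bullet> a) k \<and> ev (query (fst s)) (P \<bullet> b) k \<and>
      F s (\<rho>(f := a, n := Num k)) \<phi>" if r: "ext r q" and ab: "rel T1 r a b" for r a b
  proof -
    have rr: "ext r r" and gr: "good r \<rho>" using r qp gp le_refl good_mono by blast+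
    have "rel (T1 \<rightarrow>\<^sub>t T1) r G G"
      unfolding G_def by (rule good_cl[OF gr]) (use wch rr v in simp_all)
    then have "rel T1 r (G \<bullet> a) (G \<bullet> b)" using rel_app ab rr by blast
    \<comment> \<open>All values of the characteristic term are now known, and are the same for
      \<open>a\<close> and \<open>b\<close>; what remains is to see that one of them is zero, for
      which \<open>w\<close> below serves.\<close>
    then obtain s h where s: "ext s r" "\<And>m. ev (query (fst s)) (G \<bullet> a \<bullet> Num m) (h m)"
       "\<And>m. ev (query (fst s)) (G \<bullet> b \<bullet> Num m) (h m)"
      using decide1 rr by (metis ext_refl_iff)
    have sq: "ext s q" using s r ext_trans by blast
    have aa: "rel T1 s a a" using rel_mono[OF rel_left[OF ab] s(1)] .
    have "F s (\<rho>(f := a)) (\<^bold>\<exists>n. \<phi>)" using F_AllD[OF H sq] aa v by simp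
    then obtain u c where u: "ext u s" "rel T0 u c c" "F u (\<rho>(f := a, n := c)) \<phi>"
      using F_ExD[OF _ le_refl[OF sq]] v by fastforce
    obtain w m where w: "ext w u" "rel T0 w c (Num m)" using rel_decide[OF u(2) le_refl[OF u(1)]] by metis
    have ww: "ext w w" and ws: "ext w s" using w u le_refl ext_trans by blast+
    have gw: "good w (\<rho>(f := a))" using good_upd[OF good_mono[OF good_mono[OF gr s(1)] ws]] rel_mono[OF aa ws] v by simp
    have iff: "F w (\<rho>(f := a, n := Num l)) \<phi> \<longleftrightarrow> h l = 0" for l
    proof -
      have g: "good w (\<rho>(f := a, n := Num l))" using good_upd[OF gw] rel_Num v by simp
      have "rel T0 w (G \<bullet> a \<bullet> Num l) (cl (\<rho>(f := a, n := Num l)) (ch \<phi>))"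
        unfolding G_def
        by (rule rel_lam2) (use wch v rel_mono[OF aa ws] rel_Num ww goodD[OF good_mono[OF good_mono[OF gr s(1)] ws]] in auto)
      moreover have "rel T0 w (G \<bullet> a \<bullet> Num l) (Num (h l))" using rel_mono[OF rel_ev[OF s(2) ev_Num] ws] .
      ultimately have "vt w (\<rho>(f := a, n := Num l)) (ch \<phi>) (h l)"
        unfolding vt_def using rel_sym rel_trans by blast
      then show ?thesis using F_ch[OF \<phi> g ww] vt_det ww by metis
    qed
    have "F w (\<rho>(f := a, n := Num m)) \<phi>"
      using F_cong_upd[OF \<phi>(1) gw _ ww F_mono[OF u(3) w(1)], of "Num m"] w(2) v by simp
    then have m: "h m = 0" using iff by simp
    define l where "l = (LEAST l. h l = 0)"
    have l0: "h l = 0" unfolding l_def using m by (rule LeastI)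
    have l1: "h i = Suc (h i - 1)" if "i < l" for i using not_less_Least[OF that[unfolded l_def]] by simp
    have "ev (query (fst w)) (Mu \<bullet> t) l" if t: "\<And>m. ev (query (fst s)) (t \<bullet> Num m) (h m)" for t
    proof (rule ev_Mu)
      show "ev (query (fst w)) (t \<bullet> Num l) 0" using ev_le[OF t[of l] ws] l0 by simp
      show "ev (query (fst w)) (t \<bullet> Num i) (Suc (h i - 1))" if "i < l" for i
        using ev_le[OF t[of i] ws] l1[OF that] by simp
    qed
    then have "ev (query (fst w)) (P \<bullet> a) l" "ev (query (fst w)) (P \<bullet> b) l"
      using ev_hr[OF hP(1) ev_hr[OF hP(2)]] s(2,3) by blast+
    then show ?thesis using iff l0 ws s ext_trans by blast
  qed
  show "F q \<rho> (\<^bold>\<exists>\<Phi>. \<^bold>\<forall>f. subst n (Var \<Phi> \<cdot> Var f) \<phi>)"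
  proof (rule F_ExI)
    fix q' assume q': "ext q' q"
    have "rel T2 q' P P"
      unfolding rel.simps(2)[of T1]
    proof (intro allI impI, rule rel_T0I)
      fix r a b s assume "ext r q'" and ab: "rel T1 r a b" and s: "ext s r"
      then have sq: "ext s q" using q' ext_trans by blast
      show "\<exists>u l. ext u s \<and> ev (query (fst u)) (P \<bullet> a) l \<and> ev (query (fst u)) (P \<bullet> b) l"
        using key[OF sq rel_mono[OF ab s]] by blast
    qed
    then have "rel (snd \<Phi>) q' P P" using v by simp
    moreover have "F q' (\<rho>(\<Phi> := P)) (\<^bold>\<forall>f. subst n (Var \<Phi> \<cdot> Var f) \<phi>)"
    proof (rule F_AllI, unfold F_subst[OF qf_free_for[OF \<phi>(2)]], rule F_stable)
      fix r a s assume r: "ext r q'" and a: "rel (snd f) r a a" and s: "ext s r"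
      have sq: "ext s q" using q' r s ext_trans by blast
      have aa: "rel T1 s a a" using rel_mono[OF a s] v by simp
      obtain u l where u: "ext u s" "ev (query (fst u)) (P \<bullet> a) l" "F u (\<rho>(f := a, n := Num l)) \<phi>"
        using key[OF sq aa] by blast
      have g: "good u (\<rho>(f := a))"
        using good_upd[OF good_mono[OF gp ext_trans[OF ext_trans[OF u(1) sq] qp]]] rel_mono[OF aa u(1)] v by simp
      have "rel T0 u (Num l) (P \<bullet> a)" using rel_ev u(2) ev_Num by metis
      then have "F u (\<rho>(f := a, n := P \<bullet> a)) \<phi>"
        using F_cong_upd[OF \<phi>(1) g _ le_refl[OF u(1)] u(3), of "P \<bullet> a"] v by simp
      then have "F u (\<rho>(\<Phi> := P, f := a, n := P \<bullet> a)) \<phi>"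
        by (subst F_coinc[of \<phi> _ "\<rho>(f := a, n := P \<bullet> a)"]) (use v in \<open>auto simp: fun_upd_apply\<close>)
      moreover have cl: "cl (\<rho>(\<Phi> := P, f := a)) (Var \<Phi> \<cdot> Var f) = P \<bullet> a" using v by simp
      ultimately show "\<exists>u. ext u s \<and> F u (\<rho>(\<Phi> := P, f := a, n := cl (\<rho>(\<Phi> := P, f := a)) (Var \<Phi> \<cdot> Var f))) \<phi>"
        unfolding cl using u(1) by blast
    qed (use le_refl in blast)
    ultimately show "\<exists>r a. ext r q' \<and> rel (snd \<Phi>) r a a \<and> F r (\<rho>(\<Phi> := a)) (\<^bold>\<forall>f. subst n (Var \<Phi> \<cdot> Var f) \<phi>)"
      using le_refl[OF q'] by blast
  qed
qed

lemma qf_subst: "qf \<phi> \<Longrightarrow> qf (subst x u \<phi>)"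
  by (induction \<phi>) auto

text \<open>A quantifier-free statement is decided by the injection of a condition alone, so the fusion
  of a sequence of conditions forces what each of them decides, although it does not extend them.\<close>

lemma forced_DC:
  assumes "\<psi> \<in> QF_DC_1_1"
  shows "forced \<psi>"
  using assms
proof (cases rule: QF_DC_1_1.cases)
  case (1 \<phi> n i f j g k A l)
  note \<phi> = 1(2,3) and v = 1(4-9)
  have n: "n \<noteq> f" "n \<noteq> g" "A \<noteq> n" "A \<noteq> f" "A \<noteq> g" "g \<noteq> f" using v by auto
  show ?thesis
    unfolding 1(1)
  proof (rule forcedI, rule F_ImpI, rule F_ExI)
    fix p \<rho> q q' assume gp: "good p \<rho>" and qp: "ext q p" and H: "F q \<rho> (\<^bold>\<forall>n. \<^bold>\<forall>f. \<^bold>\<exists>g. \<phi>)" and q': "ext q' q"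
    let ?e = "\<lambda>m a b. \<rho>(n := Num m, f := Fn0 a, g := Fn0 b)"
    let ?Q = "\<lambda>m a b y. ev (query y) (cl (?e m a b) (ch \<phi>)) 0"
    have g0: "good r (\<rho>(n := Num m, f := Fn0 a))" if "ext r q" for r m a
      using good_upd[OF good_upd[OF good_mono[OF gp ext_trans[OF that qp]]]] rel_Num rel_Fn0[OF le_refl[OF that]] v by simp
    have g1: "good r (?e m a b)" if "ext r q" for r m a b
      using good_upd[OF g0[OF that]] rel_Fn0[OF le_refl[OF that]] v by simp
    have step: "\<exists>r b. ext r q'' \<and> ?Q m a b (fst r)" if q'': "ext q'' q'" for m a q''
    proof -
      have qq: "ext q'' q" using q'' q' ext_trans by blast
      have "F q'' (\<rho>(n := Num m)) (\<^bold>\<forall>f. \<^bold>\<exists>g. \<phi>)" using F_AllD[OF H qq] rel_Num v by simp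
      then have "F q'' (\<rho>(n := Num m, f := Fn0 a)) (\<^bold>\<exists>g. \<phi>)"
        using F_AllD[OF _ le_refl[OF qq]] rel_Fn0[OF le_refl[OF qq]] v by simp
      then obtain r c where r: "ext r q''" "rel T1 r c c" "F r (\<rho>(n := Num m, f := Fn0 a, g := c)) \<phi>"
        using F_ExD[OF _ le_refl[OF qq]] v by fastforce
      have "valid r" using r(1) by (simp add: ext_def)
      \<comment> \<open>The states of the fusion must be ground functions, so the witness
        \<open>c\<close> is exchanged for the function that it equals at an extension.\<close>
      then obtain s b where s: "ext s r" "rel T1 s c (Fn0 b)" using decide_real[OF r(2)] by metis
      have sq: "ext s q" using s r qq ext_trans by blast
      have "F s (?e m a b) \<phi>"
        using F_cong_upd[OF \<phi>(1) g0[OF sq] _ le_refl[OF sq] F_mono[OF r(3) s(1)], of "Fn0 b"] s(2) v by simp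
      then have "vt s (?e m a b) (ch \<phi>) 0" using F_ch[OF \<phi> g1[OF sq] le_refl[OF sq]] by simp
      then obtain u where "ext u s" "?Q m a b (fst u)"
        using rel_T0D[OF _ le_refl[OF sq]] unfolding vt_def by (metis ev_NumE hr_simps(4))
      then show ?thesis using s r ext_trans by blast
    qed
    have vq': "valid q'" using q' by (simp add: ext_def)
    obtain r a where r: "ext r q'" "\<And>m. ?Q m (a m) (a (Suc m)) (fst r)"
    \<comment> \<open>The schema does not prescribe the first function; the zero function is
      taken.\<close>
    proof (rule fusion[of q' ?Q "\<lambda>_. 0"])
      show "\<exists>r b. ext r q'' \<and> ?Q m a b (fst r)" if "ext q'' q'" for m a q'' by (rule step[OF that])
    qed (use vq' ev_query_mono in auto)
    let ?G = "Var A \<cdot> (CSuc \<cdot> Var n)" and ?H = "Var A \<cdot> Var n"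
    \<comment> \<open>Here \<open>a\<close> is a function of two numbers, and \<open>Op a\<close>
      codes the sequence of its rows.\<close>
    have "F r (\<rho>(A := Op a)) (\<^bold>\<forall>n. subst g ?G (subst f ?H \<phi>))"
    proof (rule F_AllI, rule F_stable)
      fix s c u assume s: "ext s r" and c: "rel (snd n) s c c" and u: "ext u s"
      have "rel T0 u c c" using rel_mono[OF c u] v by simp
      then obtain w m where w: "ext w u" "rel T0 w c (Num m)" using rel_decide le_refl[OF u] by metis
      have wr: "ext w r" and wq: "ext w q" using w u s r q' ext_trans by blast+
      have ww: "ext w w" using le_refl wr by blast
      have vw: "valid w" using ww by simp
      have "rel T0 w (cl (?e m (a m) (a (Suc m))) (ch \<phi>)) (Num 0)"
        using rel_mono[OF rel_ev[OF r(2) ev_Num] wr] .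
      then have F1: "F w (?e m (a m) (a (Suc m))) \<phi>"
        using F_ch[OF \<phi> g1[OF wq] ww] unfolding vt_def by simp
      let ?c = "Op (\<lambda>_ n. Suc n) \<bullet> Num 0 \<bullet> c"
      \<comment> \<open>The substitution for \<open>f\<close> is the inner one, so its update comes
        last.\<close>
      let ?e' = "\<rho>(A := Op a, n := c, g := Op a \<bullet> ?c, f := Op a \<bullet> c)"
      have c1: "rel T0 w ?c (Num (Suc m))" using rel_Op_Num[OF ww w(2), of "\<lambda>_ n. Suc n"] by simp
      have gw: "good w \<rho>" using good_mono[OF good_mono[OF gp qp] wq] .
      have "F w ?e' \<phi>"
      proof (rule F_cong[OF \<phi>(1) _ ww F1])
        fix x assume x: "x \<in> fvs \<phi>"
        consider "x = n" | "x = f" | "x = g" | "x \<noteq> n" "x \<noteq> f" "x \<noteq> g" by blast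
        then show "rel (snd x) w (?e m (a m) (a (Suc m)) x) (?e' x)"
        proof cases
          case 1 then show ?thesis using n v(1) rel_sym[OF w(2)] by simp
        next
          case 2 then show ?thesis using n v(2) rel_sym[OF rel_Op_Fn0[OF w(2) vw]] by simp
        next
          case 3 then show ?thesis using n v(3) rel_sym[OF rel_Op_Fn0[OF c1 vw]] by simp
        next
          case 4
          moreover have "x \<noteq> A" using x v by blast
          ultimately show ?thesis using goodD[OF gw] by simp
        qed
      qed
      moreover have "F w (\<rho>(A := Op a, n := c)) (subst g ?G (subst f ?H \<phi>)) \<longleftrightarrow> F w ?e' \<phi>"
        unfolding F_subst[OF qf_free_for[OF qf_subst[OF \<phi>(2)]]] F_subst[OF qf_free_for[OF \<phi>(2)]]
        using n by simp
      ultimately show "\<exists>w. ext w u \<and> F w (\<rho>(A := Op a, n := c)) (subst g ?G (subst f ?H \<phi>))" using w by blast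
    qed (use le_refl in blast)
    moreover have "rel (snd A) r (Op a) (Op a)" using rel_Op v by simp
    ultimately show "\<exists>r c. ext r q' \<and> rel (snd A) r c c \<and> F r (\<rho>(A := c)) (\<^bold>\<forall>n. subst g ?G (subst f ?H \<phi>))"
      using r by blast
  qed
qed

section \<open>Second-order truth and the functionals S\<close>

fun second_order :: "fm \<Rightarrow> bool" where
  "second_order (\<phi> \<^bold>\<longrightarrow> \<psi>) \<longleftrightarrow> second_order \<phi> \<and> second_order \<psi>"
| "second_order (\<^bold>\<forall>x. \<phi>) \<longleftrightarrow> (snd x = T0 \<or> snd x = T1) \<and> second_order \<phi>"
| "second_order _ \<longleftrightarrow> True"

definition ground :: "var \<Rightarrow> code \<Rightarrow> bool" where
  "ground x c \<longleftrightarrow> (snd x = T0 \<and> (\<exists>n. c = Num n)) \<or> (snd x = T1 \<and> (\<exists>f. c = Fn0 f))"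

text \<open>Over a single condition without oracles, the logical relation shows that every
  well-typed arithmetical term has a value.\<close>

interpretation pure: forcing "\<lambda>_ _. True" "\<lambda>_::unit. \<lambda>_ _. None"
  by unfold_locales auto

lemma pure_vt_iff: "pure.vt () \<rho> t n \<longleftrightarrow> ev (\<lambda>_ _. None) (cl \<rho> t) n"
  unfolding pure.vt_def pure.rel.simps by (auto intro: ev_Num elim!: ev_NumE)

lemma truth_Eq: "pure.vt () \<rho> s m \<Longrightarrow> pure.vt () \<rho> t n \<Longrightarrow> truth \<rho> (s \<^bold>= t) \<longleftrightarrow> m = n"
  unfolding pure_vt_iff truth.simps using ev_det by metis

lemma pure_ground: "ground x c \<Longrightarrow> pure.rel (snd x) () c c"
  unfolding ground_def using pure.rel_Num pure.rel_Fn0 by auto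

lemma rel_ground: "ground x c \<Longrightarrow> ext p p \<Longrightarrow> rel (snd x) p c c"
  unfolding ground_def using rel_Num[of p] rel_Fn0[of p] by metis

lemma ground_Fn0 [simp]: "snd x = T1 \<Longrightarrow> ground x (Fn0 f)"
  unfolding ground_def by blast

lemma pure_value:
  assumes "wft t" "tyof t = T0" "\<And>x. x \<in> vars t \<Longrightarrow> ground x (\<rho> x)"
  obtains n where "ev (\<lambda>_ _. None) (cl \<rho> t) n"
proof -
  have "pure.rel T0 () (cl \<rho> t) (cl \<rho> t)"
    using pure.rel_cl[of t "()" \<rho> \<rho>] assms pure_ground by simp
  then show ?thesis using pure.rel_T0D that by blast
qed

text \<open>Absoluteness: equations with ground parameters evaluate without oracles, and by
  \<open>decide_real\<close> every code of type 1 is densely a ground function, so the quantifiers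
  of both readings range over the same objects.\<close>

lemma F_iff_truth:
  "wff \<phi> \<Longrightarrow> second_order \<phi> \<Longrightarrow> (\<And>x. x \<in> fvs \<phi> \<Longrightarrow> ground x (\<rho> x)) \<Longrightarrow> ext p p \<Longrightarrow>
   F p \<rho> \<phi> \<longleftrightarrow> truth \<rho> \<phi>"
proof (induction \<phi> arbitrary: p \<rho>)
  case (Eq s t)
  have s: "wft s" "tyof s = T0" and t: "wft t" "tyof t = T0" using Eq.prems by simp_all
  have g: "ground x (\<rho> x)" if "x \<in> vars s \<or> x \<in> vars t" for x using Eq.prems(3)[of x] that by auto
  obtain m where m: "ev (\<lambda>_ _. None) (cl \<rho> s) m" using pure_value[OF s] g by metis
  obtain n where n: "ev (\<lambda>_ _. None) (cl \<rho> t) n" using pure_value[OF t] g by metis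
  have "vt p \<rho> s m" "vt p \<rho> t n"
    unfolding vt_def using rel_ev[OF ev_mono[OF m] ev_Num] rel_ev[OF ev_mono[OF n] ev_Num] by simp_all
  then have "F p \<rho> (s \<^bold>= t) \<longleftrightarrow> m = n" using F_Eq_vt Eq.prems(4) by blast
  moreover have "truth \<rho> (s \<^bold>= t) \<longleftrightarrow> m = n" using truth_Eq m n pure_vt_iff by metis
  ultimately show ?case by simp
next
  case (Imp \<phi> \<psi>)
  have "F q \<rho> \<phi> \<longleftrightarrow> truth \<rho> \<phi>" "F q \<rho> \<psi> \<longleftrightarrow> truth \<rho> \<psi>" if "ext q p" for q
    using Imp.IH[of \<rho> q] Imp.prems le_refl[OF that] by simp_all
  then show ?case using Imp.prems(4) unfolding F.simps truth.simps by blast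
next
  case (Forall x \<phi>)
  have gx: "ground y ((\<rho>(x := c)) y)" if "y \<in> fvs \<phi>" "ground x c" for y c
    using Forall.prems(3)[of y] that by (cases "y = x") simp_all
  have IH: "F q (\<rho>(x := c)) \<phi> \<longleftrightarrow> truth (\<rho>(x := c)) \<phi>" if "ext q p" "ground x c" for q c
    using Forall.IH[of "\<rho>(x := c)" q] Forall.prems gx that le_refl[OF that(1)] by simp
  have truth: "truth \<rho> (\<^bold>\<forall>x. \<phi>) \<longleftrightarrow> (\<forall>c. ground x c \<longrightarrow> truth (\<rho>(x := c)) \<phi>)"
    using Forall.prems(2) by (auto simp: ground_def)
  show ?case
  proof
    assume H: "F p \<rho> (\<^bold>\<forall>x. \<phi>)"
    show "truth \<rho> (\<^bold>\<forall>x. \<phi>)"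
      unfolding truth using F_AllD[OF H Forall.prems(4)] rel_ground Forall.prems(4) IH by blast
  next
    assume H: "truth \<rho> (\<^bold>\<forall>x. \<phi>)"
    show "F p \<rho> (\<^bold>\<forall>x. \<phi>)"
    proof (rule F_AllI, rule F_stable)
      fix q a r assume q: "ext q p" and a: "rel (snd x) q a a" and r: "ext r q"
      have "\<exists>s c. ext s r \<and> ground x c \<and> rel (snd x) s c a"
      proof (cases "snd x = T0")
        case True
        then obtain s n where "ext s r" "rel T0 s a (Num n)"
          using rel_decide[of r a a] rel_mono[OF a r] le_refl[OF r] by metis
        then show ?thesis using True rel_sym unfolding ground_def by metis
      next
        case False
        then have x: "snd x = T1" using Forall.prems(2) by simp
        have "rel T1 r a a" "valid r" using rel_mono[OF a r] r x by (simp_all add: ext_def)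
        then obtain s f where "ext s r" "rel T1 s a (Fn0 f)" by (rule decide_real)
        then show ?thesis using x rel_sym unfolding ground_def by metis
      qed
      then obtain s c where s: "ext s r" "ground x c" "rel (snd x) s c a" by blast
      have sp: "ext s p" using s(1) r q ext_trans by blast
      have ss: "ext s s" using sp le_refl by blast
      have Fc: "F s (\<rho>(x := c)) \<phi>" using H IH[OF sp s(2)] s(2) unfolding truth by blast
      have "F s (\<rho>(x := a)) \<phi>"
      proof (rule F_cong[OF _ _ ss Fc])
        show "wff \<phi>" using Forall.prems by simp
        show "rel (snd y) s ((\<rho>(x := c)) y) ((\<rho>(x := a)) y)" if "y \<in> fvs \<phi>" for y
          using gx[OF that s(2)] rel_ground[OF _ ss, of y] s(3) by (cases "y = x") simp_all
      qed
      then show "\<exists>s. ext s r \<and> F s (\<rho>(x := a)) \<phi>" using s(1) by blast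
    qed (use le_refl in blast)
  qed
qed simp

lemma truth_coinc: "(\<And>x. x \<in> fvs \<phi> \<Longrightarrow> \<rho> x = \<rho>' x) \<Longrightarrow> truth \<rho> \<phi> \<longleftrightarrow> truth \<rho>' \<phi>"
proof (induction \<phi> arbitrary: \<rho> \<rho>')
  case (Eq s t)
  then show ?case using cl_cong[of s \<rho> \<rho>'] cl_cong[of t \<rho> \<rho>'] by simp
next
  case (Imp \<phi> \<psi>)
  have "truth \<rho> \<phi> \<longleftrightarrow> truth \<rho>' \<phi>" "truth \<rho> \<psi> \<longleftrightarrow> truth \<rho>' \<psi>"
    by (rule Imp.IH; use Imp.prems in simp)+
  then show ?case by simp
next
  case (Forall x \<phi>)
  have "truth (\<rho>(x := a)) \<phi> \<longleftrightarrow> truth (\<rho>'(x := a)) \<phi>" for a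
    by (rule Forall.IH) (use Forall.prems in \<open>auto simp: fun_upd_apply\<close>)
  then show ?case by simp
qed simp

lemma Sigma1_nf_props:
  "wff (Sigma1_nf k (Var (0, T1)))" "fvs (Sigma1_nf k (Var (0, T1))) \<subseteq> {(0, T1)}"
  "second_order (Sigma1_nf k (Var (0, T1)))"
proof -
  have so: "\<forall>x\<in>set xs. snd x = T0 \<or> snd x = T1 \<Longrightarrow> second_order (alternating e xs \<phi>) = second_order \<phi>" for e xs \<phi>
    by (induction e xs \<phi> rule: alternating.induct) auto
  show "wff (Sigma1_nf k (Var (0, T1)))" "fvs (Sigma1_nf k (Var (0, T1))) \<subseteq> {(0, T1)}"
    by (auto simp: Sigma1_nf_def Let_def alternating_wf alternating_fvs tuple_wf tuple_vars C_wf C_vars simp del: upt_Suc)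
  show "second_order (Sigma1_nf k (Var (0, T1)))"
    unfolding Sigma1_nf_def Let_def by (subst so) auto
qed

text \<open>\<open>Orc k\<close> reports truth in the ground model, which by absoluteness is what is
  forced. The bound on \<open>k\<close> is there because index 0 belongs to the injection.\<close>

lemma forced_S2:
  assumes "k \<ge> 1"
  shows "forced (S2 k)"
proof (rule forcedI)
  fix p \<rho> assume p: "ext p p" and gp: "good p \<rho>"
  let ?S = "(0, T2) :: var" and ?f = "(0, T1) :: var"
  let ?Sf = "Var ?S \<cdot> Var ?f"
  let ?\<Sigma> = "Sigma1_nf k (Var ?f)"
  let ?B = "(?Sf \<^bold>= CZero \<^bold>\<or> ?Sf \<^bold>= CSuc \<cdot> CZero) \<^bold>\<and> (?Sf \<^bold>= CZero \<^bold>\<longleftrightarrow> ?\<Sigma>)"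
  have S2: "S2 k = (\<^bold>\<exists>?S. \<^bold>\<forall>?f. ?B)" by (simp add: S2_def Let_def)
  have wB: "wff ?B" using S2_sentence[of k] unfolding S2 wff.simps by blast
  have body: "F r (\<rho>(?S := Orc k, ?f := Fn0 h)) ?B" if r: "ext r r" for r h
  proof -
    let ?e = "\<rho>(?S := Orc k, ?f := Fn0 h)"
    let ?v = "if Sigma1_true k h then 0 else 1 :: nat"
    have *: "(F s ?e (?Sf \<^bold>= CZero) \<longleftrightarrow> Sigma1_true k h) \<and> (F s ?e (?Sf \<^bold>= CSuc \<cdot> CZero) \<longleftrightarrow> \<not> Sigma1_true k h) \<and> (F s ?e ?\<Sigma> \<longleftrightarrow> Sigma1_true k h)"
      if s: "ext s s" for s
    proof -
      have "ev (query (fst s)) (Fn0 h \<bullet> Num m) (h m)" for m by (rule ev_Op[OF ev_Num ev_Num])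
      then have "ev (query (fst s)) (Orc k \<bullet> Fn0 h) ?v"
        by (rule ev_Orc) (use assms in \<open>simp add: query_def\<close>)
      then have v: "vt s ?e ?Sf ?v" unfolding vt_def cl.simps using rel_ev ev_Num by simp
      have "F s ?e (?Sf \<^bold>= CZero) \<longleftrightarrow> ?v = 0" by (rule F_Eq_vt[OF v vt_zero s])
      moreover have "F s ?e (?Sf \<^bold>= CSuc \<cdot> CZero) \<longleftrightarrow> ?v = Suc 0" by (rule F_Eq_vt[OF v vt_suc[OF s vt_zero] s])
      moreover have "F s ?e ?\<Sigma> \<longleftrightarrow> truth ?e ?\<Sigma>"
        by (rule F_iff_truth) (use Sigma1_nf_props[of k] s in auto)
      moreover have "truth ?e ?\<Sigma> \<longleftrightarrow> Sigma1_true k h"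
        unfolding Sigma1_true_def by (rule truth_coinc) (use Sigma1_nf_props[of k] in auto)
      ultimately show ?thesis by simp
    qed
    have "F r ?e (?Sf \<^bold>= CZero \<^bold>\<or> ?Sf \<^bold>= CSuc \<cdot> CZero)"
    proof (rule F_ImpI)
      fix s assume "ext s r" "F s ?e (\<^bold>\<not> (?Sf \<^bold>= CZero))"
      then show "F s ?e (?Sf \<^bold>= CSuc \<cdot> CZero)" using * le_refl unfolding F_Neg by blast
    qed
    moreover have "F r ?e (?Sf \<^bold>= CZero \<^bold>\<longrightarrow> ?\<Sigma>)" "F r ?e (?\<Sigma> \<^bold>\<longrightarrow> ?Sf \<^bold>= CZero)"
      by (rule F_ImpI; use * le_refl in blast)+
    ultimately show ?thesis using F_Conj[OF r] by blast
  qed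
  show "F p \<rho> (S2 k)"
    unfolding S2
  proof (rule F_ExI)
    fix q assume q: "ext q p"
    have "F q (\<rho>(?S := Orc k)) (\<^bold>\<forall>?f. ?B)"
    proof (rule F_AllI, rule F_stable)
      fix r a s assume r: "ext r q" and a: "rel (snd ?f) r a a" and s: "ext s r"
      have "rel T1 s a a" "valid s" using rel_mono[OF a s] s by (simp_all add: ext_def)
      \<comment> \<open>An arbitrary argument is exchanged for a ground function, to which
        \<open>body\<close> applies.\<close>
      then obtain u h where u: "ext u s" "rel T1 u a (Fn0 h)" by (rule decide_real)
      have uu: "ext u u" using u le_refl by blast
      have "good u \<rho>" using gp good_mono ext_trans q r s u(1) by blast
      then have g: "good u (\<rho>(?S := Orc k))" using good_upd rel_Orc by simp
      have "F u (\<rho>(?S := Orc k, ?f := a)) ?B"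
        using F_cong_upd[OF wB g _ uu body[OF uu, of h], of a] rel_sym[OF u(2)] by simp
      then show "\<exists>u. ext u s \<and> F u (\<rho>(?S := Orc k, ?f := a)) ?B" using u(1) by blast
    qed (use le_refl in blast)
    moreover have "rel (snd ?S) q (Orc k) (Orc k)" using rel_Orc by simp
    ultimately show "\<exists>r c. ext r q \<and> rel (snd ?S) r c c \<and> F r (\<rho>(?S := c)) (\<^bold>\<forall>?f. ?B)"
      using le_refl[OF q] by blast
  qed
qed

lemma forced_axioms: "\<phi> \<in> Z2\<omega> \<union> QF_DC_1_1 \<Longrightarrow> forced \<phi>"
  using forced_RCA[OF _ forced_AC] forced_DC forced_S2
  by (auto simp: Z2\<omega>_def Pi1_CA0\<omega>_def)

section \<open>Rational and real arithmetic in the ground model\<close>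

abbreviation v0 :: "(var \<Rightarrow> code) \<Rightarrow> trm \<Rightarrow> nat \<Rightarrow> bool" where
  "v0 \<equiv> pure.vt ()"

lemmas v0_intros = pure.vt_add[OF TrueI] pure.vt_mul[OF TrueI] pure.vt_pred[OF TrueI] pure.vt_sub[OF TrueI]
  pure.vt_pow2[OF TrueI] pure.vt_pair[OF TrueI] pure.vt_fst[OF TrueI] pure.vt_snd[OF TrueI]
  pure.vt_suc[OF TrueI] pure.vt_zero

definition addn :: "nat \<Rightarrow> nat \<Rightarrow> nat" where
  "addn a b = pr (pr (fs (fs a) * Suc (sn b) + fs (fs b) * Suc (sn a)) (sn (fs a) * Suc (sn b) + sn (fs b) * Suc (sn a)))
     (Suc (sn a) * Suc (sn b) - 1)"

lemma ratval_addn: "ratval (addn a b) = ratval a + ratval b"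
proof -
  have e: "real (Suc (Suc (sn a) * Suc (sn b) - 1)) = real (Suc (sn a)) * real (Suc (sn b))"
    by (simp add: algebra_simps)
  have frac: "(A * y + C * x - (B * y + D * x)) / (x * y) = (A - B) / x + (C - D) / y"
    if "x > 0" "y > 0" for A B C D x y :: real
    using that by (simp add: field_simps)
  have "ratval (addn a b) = (real (fs (fs a) * Suc (sn b) + fs (fs b) * Suc (sn a)) - real (sn (fs a) * Suc (sn b) + sn (fs b) * Suc (sn a)))
      / (real (Suc (sn a)) * real (Suc (sn b)))"
    unfolding ratval_def addn_def fs_pr sn_pr e ..
  also have "\<dots> = ratval a + ratval b"
    unfolding ratval_def of_nat_add of_nat_mult by (rule frac) simp_all
  finally show ?thesis .
qed

lemma v0_addq: "v0 \<rho> p a \<Longrightarrow> v0 \<rho> q b \<Longrightarrow> v0 \<rho> (addq p q) (addn a b)"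
  unfolding addq_def ratq_def posq_def negq_def denq_def addn_def
  by (intro v0_intros)

text \<open>After cross-multiplication and moving the negative parts across, both sides are natural
  numbers, so truncated subtraction decides the inequality.\<close>

lemma truth_leq: "v0 \<rho> p a \<Longrightarrow> v0 \<rho> q b \<Longrightarrow> truth \<rho> (leq p q) \<longleftrightarrow> ratval a \<le> ratval b"
proof -
  assume *: "v0 \<rho> p a" "v0 \<rho> q b"
  let ?l = "fs (fs a) * Suc (sn b) + sn (fs b) * Suc (sn a)"
  let ?r = "fs (fs b) * Suc (sn a) + sn (fs a) * Suc (sn b)"
  have "truth \<rho> (leq p q) \<longleftrightarrow> ?l - ?r = 0"
    unfolding leq_def le0_def posq_def negq_def denq_def
    by (rule truth_Eq) (intro v0_intros *)+
  also have "\<dots> \<longleftrightarrow> real ?l \<le> real ?r" by linarith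
  also have "\<dots> \<longleftrightarrow> ratval a \<le> ratval b"
    unfolding ratval_def by (simp add: divide_simps) (simp add: algebra_simps)
  finally show ?thesis .
qed

lemma v0_epsq: "v0 \<rho> n m \<Longrightarrow> \<exists>e. v0 \<rho> (epsq n) e \<and> ratval e = 1 / 2 ^ m"
proof -
  assume "v0 \<rho> n m"
  \<comment> \<open>Denominators are coded decreased by one, hence \<open>2 ^ m - 1\<close>.\<close>
  then have "v0 \<rho> (epsq n) (pr (pr (Suc 0) 0) (2 ^ m - 1))"
    unfolding epsq_def ratq_def by (intro v0_intros)
  moreover have "ratval (pr (pr (Suc 0) 0) (2 ^ m - 1)) = 1 / 2 ^ m" by (simp add: ratval_def of_nat_diff)
  ultimately show ?thesis by blast
qed

lemma v0_eps2q: "v0 \<rho> n m \<Longrightarrow> \<exists>e. v0 \<rho> (eps2q n) e \<and> ratval e = 2 / 2 ^ m"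
proof -
  assume "v0 \<rho> n m"
  then have "v0 \<rho> (eps2q n) (pr (pr (Suc (Suc 0)) 0) (2 ^ m - 1))"
    unfolding eps2q_def ratq_def by (intro v0_intros)
  moreover have "ratval (pr (pr (Suc (Suc 0)) 0) (2 ^ m - 1)) = 2 / 2 ^ m" by (simp add: ratval_def of_nat_diff)
  ultimately show ?thesis by blast
qed

lemma v0_Fn0: "\<rho> x = Fn0 f \<Longrightarrow> v0 \<rho> t n \<Longrightarrow> v0 \<rho> (Var x \<cdot> t) (f n)"
  unfolding pure_vt_iff cl.simps by (auto intro: ev_Op[OF ev_Num, of _ _ _ "\<lambda>_. f"])

lemma truth_eqR:
  assumes "\<rho> (i, T1) = Fn0 f" "\<rho> (j, T1) = Fn0 g"
  shows "truth \<rho> (eqR (Var (i, T1)) (Var (j, T1))) \<longleftrightarrow> (\<forall>n. \<bar>ratval (f n) - ratval (g n)\<bar> \<le> 2 / 2 ^ n)"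
proof -
  define n where "n = (max (fresh (Var (i, T1))) (fresh (Var (j, T1))), T0)"
  have *: "truth (\<rho>(n := Num m)) (leq p (addq q (eps2q (Var n)))) \<longleftrightarrow> ratval a \<le> ratval b + 2 / 2 ^ m"
    if "v0 (\<rho>(n := Num m)) p a" "v0 (\<rho>(n := Num m)) q b" for p q a b m
  proof -
    obtain e where e: "v0 (\<rho>(n := Num m)) (eps2q (Var n)) e" "ratval e = 2 / 2 ^ m"
      using v0_eps2q pure.vt_Var[of "\<rho>(n := Num m)" n m] by fastforce
    show ?thesis using truth_leq[OF that(1) v0_addq[OF that(2) e(1)]] e(2) by (simp add: ratval_addn)
  qed
  have v: "v0 (\<rho>(n := Num m)) (Var (i, T1) \<cdot> Var n) (f m)" "v0 (\<rho>(n := Num m)) (Var (j, T1) \<cdot> Var n) (g m)" for m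
    by (rule v0_Fn0; use assms in \<open>auto simp: n_def intro: pure.vt_Var\<close>)+
  have n: "snd n = T0" by (simp add: n_def)
  show ?thesis
    unfolding eqR_def Let_def n_def[symmetric] truth.simps n
    using *[OF v(1) v(2)] *[OF v(2) v(1)] by (auto simp: abs_le_iff algebra_simps)
qed

lemma truth_isreal:
  assumes "\<rho> (i, T1) = Fn0 f"
  shows "truth \<rho> (isreal (Var (i, T1))) \<longleftrightarrow> (\<forall>n k. \<bar>ratval (f n) - ratval (f (n + k))\<bar> < 1 / 2 ^ n)"
proof -
  define n where "n = (fresh (Var (i, T1)), T0)"
  define k where "k = (Suc (fresh (Var (i, T1))), T0)"
  have nk: "n \<noteq> k" "snd n = T0" "snd k = T0" "(i, T1) \<noteq> n" "(i, T1) \<noteq> k" by (simp_all add: n_def k_def)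
  let ?e = "\<lambda>m l. \<rho>(n := Num m, k := Num l)"
  have *: "truth (?e m l) (lessq p (addq q (epsq (Var n)))) \<longleftrightarrow> ratval a < ratval b + 1 / 2 ^ m"
    if "v0 (?e m l) p a" "v0 (?e m l) q b" for p q a b m l
  proof -
    obtain e where e: "v0 (?e m l) (epsq (Var n)) e" "ratval e = 1 / 2 ^ m"
      using v0_epsq pure.vt_Var[of "?e m l" n m] nk by fastforce
    show ?thesis using truth_leq[OF v0_addq[OF that(2) e(1)] that(1)] e(2) by (auto simp: ratval_addn lessq_def)
  qed
  have v: "v0 (?e m l) (Var (i, T1) \<cdot> Var n) (f m)" "v0 (?e m l) (Var (i, T1) \<cdot> (Var n \<^bold>+ Var k)) (f (m + l))" for m l
    by (rule v0_Fn0; use assms nk in \<open>auto intro!: pure.vt_Var v0_intros\<close>)+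
  show ?thesis
    unfolding isreal_def Let_def n_def[symmetric] k_def[symmetric] truth.simps nk
    using *[OF v(1) v(2)] *[OF v(2) v(1)] by (auto simp: abs_less_iff algebra_simps)
qed

lemma limval_lim:
  assumes "\<forall>n k. \<bar>ratval (f n) - ratval (f (n + k))\<bar> < 1 / 2 ^ n"
  shows "(\<lambda>n. ratval (f n)) \<longlonglongrightarrow> limval f"
proof -
  have "Cauchy (\<lambda>n. ratval (f n))"
  proof (rule CauchyI')
    fix e :: real assume "0 < e"
    then obtain M where M: "(1 / 2) ^ M < e" using real_arch_pow_inv[of e "1/2"] by auto
    have "dist (ratval (f m)) (ratval (f n)) < e" if "m \<ge> M" "n > m" for m n
    proof -
      have "\<bar>ratval (f m) - ratval (f (m + (n - m)))\<bar> < 1 / 2 ^ m" using assms by blast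
      moreover have "(1 / 2) ^ m \<le> (1 / 2 :: real) ^ M" using that by (intro power_decreasing) auto
      ultimately show ?thesis using M that by (simp add: power_one_over dist_real_def)
    qed
    then show "\<exists>M. \<forall>m\<ge>M. \<forall>n>m. dist (ratval (f m)) (ratval (f n)) < e" by blast
  qed
  then have "convergent (\<lambda>n. ratval (f n))" by (rule Cauchy_convergent)
  then show ?thesis unfolding limval_def by (simp add: convergent_LIMSEQ_iff)
qed

lemma limval_approx:
  assumes "\<forall>n k. \<bar>ratval (f n) - ratval (f (n + k))\<bar> < 1 / 2 ^ n"
  shows "\<bar>ratval (f n) - limval f\<bar> \<le> 1 / 2 ^ n"
proof (rule LIMSEQ_le_const2)
  show "(\<lambda>k. \<bar>ratval (f n) - ratval (f (k + n))\<bar>) \<longlonglongrightarrow> \<bar>ratval (f n) - limval f\<bar>"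
    by (intro tendsto_intros LIMSEQ_ignore_initial_segment limval_lim assms)
  have "\<bar>ratval (f n) - ratval (f (k + n))\<bar> \<le> 1 / 2 ^ n" for k
    using assms[rule_format, of n k] by (simp add: add.commute)
  then show "\<exists>N. \<forall>k\<ge>N. \<bar>ratval (f n) - ratval (f (k + n))\<bar> \<le> 1 / 2 ^ n" by blast
qed

text \<open>Each representation is within \<open>1 / 2 ^ n\<close> of its limit. Two such errors
  give the bound \<open>2 / 2 ^ n\<close>; conversely that bound and two errors put the limits
  within \<open>4 / 2 ^ n\<close> for every \<open>n\<close>.\<close>

lemma limval_eq_iff:
  assumes f: "\<forall>n k. \<bar>ratval (f n) - ratval (f (n + k))\<bar> < 1 / 2 ^ n"
    and g: "\<forall>n k. \<bar>ratval (g n) - ratval (g (n + k))\<bar> < 1 / 2 ^ n"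
  shows "(\<forall>n. \<bar>ratval (f n) - ratval (g n)\<bar> \<le> 2 / 2 ^ n) \<longleftrightarrow> limval f = limval g"
proof
  assume H: "\<forall>n. \<bar>ratval (f n) - ratval (g n)\<bar> \<le> 2 / 2 ^ n"
  have le: "\<bar>limval f - limval g\<bar> \<le> 4 * (1 / 2) ^ n" for n
    using limval_approx[OF f, of n] limval_approx[OF g, of n] H[rule_format, of n]
    by (simp add: power_one_over abs_le_iff)
  have lim: "(\<lambda>n. 4 * (1 / 2 :: real) ^ n) \<longlonglongrightarrow> 4 * 0"
    by (intro tendsto_intros LIMSEQ_realpow_zero) auto
  have "\<bar>limval f - limval g\<bar> \<le> 4 * 0" by (rule LIMSEQ_le_const[OF lim]) (use le in blast)
  then show "limval f = limval g" by simp
next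
  assume "limval f = limval g"
  then have "\<bar>ratval (f n) - ratval (g n)\<bar> \<le> 1 / 2 ^ n + 1 / 2 ^ n" for n
    using limval_approx[OF f, of n] limval_approx[OF g, of n] by (simp only: abs_le_iff) linarith
  then show "\<forall>n. \<bar>ratval (f n) - ratval (g n)\<bar> \<le> 2 / 2 ^ n" by simp
qed

lemma second_order_leq [simp]: "second_order (leq p q)" "second_order (lessq p q)"
  by (simp_all add: leq_def lessq_def le0_def)

lemma second_order_real [simp]: "second_order (isreal x)" "second_order (eqR x y)" "second_order (leR x y)"
  "second_order (in01 x)"
  by (simp_all add: isreal_def eqR_def leR_def in01_def Let_def)

text \<open>Extracts the fast convergence that makes \<open>limval\<close> the represented
  real.\<close>

lemma F_in01D:
  assumes "F p \<rho> (in01 (Var (i, T1)))" "\<rho> (i, T1) = Fn0 f" "ext p p"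
  shows "\<forall>n k. \<bar>ratval (f n) - ratval (f (n + k))\<bar> < 1 / 2 ^ n"
proof -
  have "F p \<rho> (isreal (Var (i, T1)))" using assms(1) F_Conj[OF assms(3)] unfolding in01_def by blast
  moreover have "F p \<rho> (isreal (Var (i, T1))) \<longleftrightarrow> truth \<rho> (isreal (Var (i, T1)))"
    by (rule F_iff_truth) (use assms real_wf(1)[of "Var (i, T1)" "Var (i, T1)"] in \<open>auto simp: real_fvs\<close>)
  ultimately show ?thesis using truth_isreal[of \<rho> i f] assms(2) by blast
qed

lemma F_eqR_iff:
  assumes "F p \<rho> (in01 (Var (i, T1)))" "F p \<rho> (in01 (Var (j, T1)))"
    and "\<rho> (i, T1) = Fn0 f" "\<rho> (j, T1) = Fn0 g" "ext p p"
  shows "F p \<rho> (eqR (Var (i, T1)) (Var (j, T1))) \<longleftrightarrow> limval f = limval g"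
proof -
  have "F p \<rho> (eqR (Var (i, T1)) (Var (j, T1))) \<longleftrightarrow> truth \<rho> (eqR (Var (i, T1)) (Var (j, T1)))"
    by (rule F_iff_truth) (use assms real_wf(3) in \<open>auto simp: real_fvs\<close>)
  then show ?thesis
    using truth_eqR[of \<rho> i f j g] limval_eq_iff[of f g] F_in01D[of p \<rho> i f] F_in01D[of p \<rho> j g] assms by blast
qed

section \<open>The generic functional\<close>

lemma ev_Orc0_iff:
  "ev (query y) (Orc 0 \<bullet> Fn0 f) n \<longleftrightarrow> y (limval f) = Some n"
proof
  assume "ev (query y) (Orc 0 \<bullet> Fn0 f) n"
  then show "y (limval f) = Some n"
  proof (rule ev_OrcE, goal_cases)
    case (1 f')
    have "f' m = f m" for m using ev_det[OF 1(1) ev_Op[OF ev_Num ev_Num]] .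
    then have "f' = f" by blast
    then show ?case using 1(2) by (simp add: query_def)
  qed simp
next
  assume "y (limval f) = Some n"
  then show "ev (query y) (Orc 0 \<bullet> Fn0 f) n"
    by (intro ev_Orc[where f = f] ev_Op[OF ev_Num ev_Num, of _ "\<lambda>_. f"]) (simp add: query_def)
qed

text \<open>Left to right uses that conditions are injective, right to left that they can be
  extended to any real. One equivalence thus yields both that the functional respects equality of
  reals and that it takes no value twice.\<close>

lemma rel_Orc0_iff:
  assumes "valid p"
  shows "rel T0 p (Orc 0 \<bullet> Fn0 f) (Orc 0 \<bullet> Fn0 g) \<longleftrightarrow> limval f = limval g"
proof
  have pp: "ext p p" using assms by simp
  assume "rel T0 p (Orc 0 \<bullet> Fn0 f) (Orc 0 \<bullet> Fn0 g)"
  from rel_T0D[OF this pp]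
  obtain r n where r: "ext r p" "fst r (limval f) = Some n" "fst r (limval g) = Some n"
    unfolding ev_Orc0_iff by blast
  then show "limval f = limval g" unfolding ext_def valid_def by (metis domI inj_onD)
next
  assume eq: "limval f = limval g"
  show "rel T0 p (Orc 0 \<bullet> Fn0 f) (Orc 0 \<bullet> Fn0 g)"
  proof (rule rel_T0I)
    fix q assume "ext q p"
    then have "valid q" by (simp add: ext_def)
    then obtain r n where "ext r q" and f: "fst r (limval f) = Some n" by (rule extend)
    moreover have "fst r (limval g) = Some n" using f eq by simp
    ultimately show "\<exists>r n. ext r q \<and> ev (query (fst r)) (Orc 0 \<bullet> Fn0 f) n \<and> ev (query (fst r)) (Orc 0 \<bullet> Fn0 g) n"
      unfolding ev_Orc0_iff using f by blast
  qed
qed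

text \<open>Environments are total, so every type needs some self-related code.\<close>

fun dflt :: "ty \<Rightarrow> code" where
  "dflt T0 = Num 0"
| "dflt (\<sigma> \<rightarrow>\<^sub>t \<tau>) = K \<bullet> dflt \<tau>"

lemma rel_dflt: "rel \<sigma> p (dflt \<sigma>) (dflt \<sigma>)"
proof (induction \<sigma> arbitrary: p)
  case T0
  show ?case using rel_Num by simp
next
  case (Fn \<sigma> \<tau>)
  then show ?case unfolding rel.simps(2) dflt.simps by (intro allI impI rel_hr2[OF hrK hrK])
qed

text \<open>Reduces statements about two real variables to ground functions. Transport goes both
  ways: hypotheses are unpacked for the ground functions, and conclusions return to the original
  codes.\<close>

lemma decide_pair:
  assumes "good p \<rho>" "ext p p" "snd x = T1" "snd y = T1" "x \<noteq> y"
  obtains q f g where "ext q p" "ext q q"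
    "\<And>\<phi>. wff \<phi> \<Longrightarrow> F p \<rho> \<phi> \<Longrightarrow> F q (\<rho>(x := Fn0 f, y := Fn0 g)) \<phi>"
    "\<And>\<phi>. wff \<phi> \<Longrightarrow> F q (\<rho>(x := Fn0 f, y := Fn0 g)) \<phi> \<Longrightarrow> F q \<rho> \<phi>"
proof -
  have "rel T1 p (\<rho> x) (\<rho> x)" "valid p" using goodD[OF assms(1,3)] assms(2) by simp_all
  then obtain r f where r: "ext r p" "valid r" "rel T1 r (\<rho> x) (Fn0 f)" by (rule decide_real)
  have "rel T1 r (\<rho> y) (\<rho> y)" using goodD[OF good_mono[OF assms(1) r(1)] assms(4)] .
  then obtain q g where q: "ext q r" "rel T1 q (\<rho> y) (Fn0 g)" by (rule decide_real[OF _ r(2)])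
  have qp: "ext q p" and qq: "ext q q" using ext_trans[OF q(1) r(1)] le_refl[OF q(1)] .
  let ?e = "\<rho>(x := Fn0 f, y := Fn0 g)"
  have e: "rel (snd z) q (\<rho> z) (?e z)" for z
  proof -
    consider "z = x" | "z = y" | "z \<noteq> x" "z \<noteq> y" by blast
    then show ?thesis
    proof cases
      case 1 then show ?thesis using rel_mono[OF r(3) q(1)] assms by simp
    next
      case 2 then show ?thesis using q(2) assms by simp
    next
      case 3 then show ?thesis using goodD[OF good_mono[OF assms(1) qp]] by simp
    qed
  qed
  show ?thesis
  proof (rule that[OF qp qq])
    fix \<phi> assume w: "wff \<phi>"
    show "F q ?e \<phi>" if "F p \<rho> \<phi>" by (rule F_cong[OF w e qq F_mono[OF that qp]])
    show "F q \<rho> \<phi>" if "F q ?e \<phi>" by (rule F_cong[OF w rel_sym[OF e] qq that])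
  qed
qed

theorem corollary2p15:
  shows "\<not> (Z2\<omega> \<union> QF_DC_1_1 \<turnstile> NIN01)"
proof
  assume "Z2\<omega> \<union> QF_DC_1_1 \<turnstile> NIN01"
  then have forced: "forced NIN01" by (rule soundness) (rule forced_axioms)
  define Y :: var where "Y = (0, T2)"
  \<comment> \<open>The weakest condition: nothing is decided and nothing is forbidden.\<close>
  define p :: cond where "p = (Map.empty, {})"
  define e where "e = (\<lambda>x. dflt (snd x))(Y := Orc 0)"
  have p: "ext p p" by (simp add: p_def valid_def)
  have "good p (\<lambda>x. dflt (snd x))" unfolding good_def using rel_dflt by blast
  then have ge: "good p e" and eY: "e Y = Orc 0"
    unfolding e_def using good_upd rel_Orc by (simp_all add: Y_def)
  have YF: "F q \<rho> (Var Y \<cdot> Var x \<^bold>= Var Y \<cdot> Var y) \<longleftrightarrow> limval f = limval g"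
    if "\<rho> Y = Orc 0" "\<rho> x = Fn0 f" "\<rho> y = Fn0 g" "ext q q" for q \<rho> x y f g
    using that rel_Orc0_iff[of q f g] by simp
  define \<psi> where "\<psi> i j = (in01 (Var (i, T1)) \<^bold>\<and> in01 (Var (j, T1)) \<^bold>\<and> \<^bold>\<not> eqR (Var (i, T1)) (Var (j, T1)) \<^bold>\<and>
      Var Y \<cdot> Var (i, T1) \<^bold>= Var Y \<cdot> Var (j, T1))" for i j
  define \<chi> where "\<chi> i j = (in01 (Var (i, T1)) \<^bold>\<and> in01 (Var (j, T1)) \<^bold>\<and> eqR (Var (i, T1)) (Var (j, T1)))" for i j
  have w: "wff (\<psi> i j)" "wff (\<chi> i j)" "wff (Var Y \<cdot> Var (i, T1) \<^bold>= Var Y \<cdot> Var (j, T1))" for i j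
    by (simp_all add: \<psi>_def \<chi>_def Y_def in01_wf real_wf)
  have NIN: "NIN01 = (\<^bold>\<forall>Y. fun01 (Var Y) \<^bold>\<longrightarrow> (\<^bold>\<exists>(0, T1). \<^bold>\<exists>(1, T1). \<psi> 0 1))"
    by (simp add: NIN01_def \<psi>_def Y_def Let_def)
  \<comment> \<open>Since \<open>fresh (Var Y)\<close> is 1, the bound variables here have the
    indices 1 and 2.\<close>
  have fun01: "fun01 (Var Y) = (\<^bold>\<forall>(1, T1). \<^bold>\<forall>(2, T1). \<chi> 1 2 \<^bold>\<longrightarrow> Var Y \<cdot> Var (1, T1) \<^bold>= Var Y \<cdot> Var (2, T1))"
    by (simp add: fun01_def \<chi>_def Y_def Let_def numeral_2_eq_2)
  have "F p e (fun01 (Var Y))"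
    unfolding fun01
  proof (rule F_AllI, rule F_AllI, rule F_ImpI)
    fix q a q' b r
    let ?e = "e((1, T1) := a, (2, T1) := b)"
    assume q: "ext q p" and a: "rel (snd (1 :: nat, T1)) q a a" and q': "ext q' q"
      and b: "rel (snd (2 :: nat, T1)) q' b b" and r: "ext r q'" and H: "F r ?e (\<chi> 1 2)"
    have "good q' (e((1, T1) := a))" using good_upd[OF good_mono[OF ge ext_trans[OF q' q]] rel_mono[OF a q']] .
    then have gr: "good r ?e" using good_upd b good_mono[OF _ r] by blast
    show "F r ?e (Var Y \<cdot> Var (1, T1) \<^bold>= Var Y \<cdot> Var (2, T1))"
    proof (rule F_stable)
      fix s assume s: "ext s r"
      obtain u f g where u: "ext u s" "ext u u"
        and up: "\<And>\<phi>. wff \<phi> \<Longrightarrow> F s ?e \<phi> \<Longrightarrow> F u (?e((1, T1) := Fn0 f, (2, T1) := Fn0 g)) \<phi>"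
        and down: "\<And>\<phi>. wff \<phi> \<Longrightarrow> F u (?e((1, T1) := Fn0 f, (2, T1) := Fn0 g)) \<phi> \<Longrightarrow> F u ?e \<phi>"
        by (rule decide_pair[OF good_mono[OF gr s] le_refl[OF s], of "(1, T1)" "(2, T1)"]) (simp, simp, simp, (rule that; assumption))
      let ?d = "?e((1, T1) := Fn0 f, (2, T1) := Fn0 g)"
      have d: "?d Y = Orc 0" "?d (1, T1) = Fn0 f" "?d (2, T1) = Fn0 g" using eY by (simp_all add: Y_def)
      have "F u ?d (\<chi> 1 2)" using up[OF w(2) F_mono[OF H s]] .
      then have "F u ?d (in01 (Var (1, T1)))" "F u ?d (in01 (Var (2, T1)))" "F u ?d (eqR (Var (1, T1)) (Var (2, T1)))"
        unfolding \<chi>_def F_Conj[OF u(2)] by blast+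
      then have "limval f = limval g" using F_eqR_iff[of u ?d 1 2 f g] d u(2) by blast
      then have "F u ?d (Var Y \<cdot> Var (1, T1) \<^bold>= Var Y \<cdot> Var (2, T1))" using YF[of ?d _ f _ g u] d u(2) by blast
      then show "\<exists>u. ext u s \<and> F u ?e (Var Y \<cdot> Var (1, T1) \<^bold>= Var Y \<cdot> Var (2, T1))"
        using down[OF w(3)] u(1) by blast
    qed (rule le_refl[OF r])
  qed
  moreover have "F p e (fun01 (Var Y) \<^bold>\<longrightarrow> (\<^bold>\<exists>(0, T1). \<^bold>\<exists>(1, T1). \<psi> 0 1))"
  proof -
    have "good p (\<lambda>x. dflt (snd x))" unfolding good_def using rel_dflt by blast
    then have "F p (\<lambda>x. dflt (snd x)) NIN01" using forcedD[OF forced p] by blast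
    moreover have "rel (snd Y) p (Orc 0) (Orc 0)" using rel_Orc by (simp add: Y_def)
    ultimately show ?thesis unfolding NIN e_def using F_AllD p by blast
  qed
  ultimately have "F p e (\<^bold>\<exists>(0, T1). \<^bold>\<exists>(1, T1). \<psi> 0 1)" using F_ImpD p by blast
  then obtain q a where q: "ext q p" "rel T1 q a a" "F q (e((0, T1) := a)) (\<^bold>\<exists>(1, T1). \<psi> 0 1)"
    using F_ExD[OF _ p] by fastforce
  then obtain r b where r: "ext r q" "rel T1 r b b" "F r (e((0, T1) := a, (1, T1) := b)) (\<psi> 0 1)"
    using F_ExD[OF q(3) le_refl[OF q(1)]] by fastforce
  let ?e = "e((0, T1) := a, (1, T1) := b)"
  have "good r ?e"
    using good_upd[OF good_upd[OF good_mono[OF ge ext_trans[OF r(1) q(1)]]]] rel_mono[OF q(2) r(1)] r(2) by simp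
  then obtain u f g where u: "ext u r" "ext u u"
    and up: "\<And>\<phi>. wff \<phi> \<Longrightarrow> F r ?e \<phi> \<Longrightarrow> F u (?e((0, T1) := Fn0 f, (1, T1) := Fn0 g)) \<phi>"
    by (rule decide_pair[OF _ le_refl[OF r(1)], of _ "(0, T1)" "(1, T1)"]) (simp, simp, simp, (rule that; assumption))
  let ?d = "?e((0, T1) := Fn0 f, (1, T1) := Fn0 g)"
  have d: "?d Y = Orc 0" "?d (0, T1) = Fn0 f" "?d (1, T1) = Fn0 g" using eY by (simp_all add: Y_def)
  have "F u ?d (\<psi> 0 1)" using up[OF w(1) r(3)] .
  then have *: "F u ?d (in01 (Var (0, T1)))" "F u ?d (in01 (Var (1, T1)))"
    "F u ?d (\<^bold>\<not> eqR (Var (0, T1)) (Var (1, T1)))" "F u ?d (Var Y \<cdot> Var (0, T1) \<^bold>= Var Y \<cdot> Var (1, T1))"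
    unfolding \<psi>_def F_Conj[OF u(2)] by blast+
  \<comment> \<open>Injectivity turns the equal values into equal reals, against the forced
    inequality.\<close>
  then have "limval f = limval g" using YF[of ?d _ f _ g u] d u(2) by blast
  then have "F u ?d (eqR (Var (0, T1)) (Var (1, T1)))" using F_eqR_iff[of u ?d 0 1 f g] * d u(2) by blast
  then show False using *(3) u(2) unfolding F_Neg by blast
qed

end
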